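(* Let $n\geqslant2$, $\lambda\in\mathbb R_+$, and let $u\in\mathring B^\ast_2$ solve \[\left(-\Delta-\lambda\right)u=f\quad\text{in }\mathbb R^n,\] where $f$ vanishes in $\mathbb R^{n-1}\times\mathbb R_-$ and satisfies \[\sup_{\substack{\zeta\in\mathbb C^{n}\\|\Im\zeta|<\gamma_0}}\int_{\mathbb R^n}\left|\left\langle x\right\rangle^2 f(x)\,e(x\cdot\zeta)\right|\mathrm dx<\infty\] for some $\gamma_0\in\mathbb R_+$. Then $u$ vanishes in $\mathbb R^{n-1}\times\mathbb R_-$.
   Context: For $x\in\mathbb R^n$, $\left\langle x\right\rangle=\sqrt{1+|x|^2}$; $e(t)=e^{2\pi i t}$; for $\zeta\in\mathbb C^n$, $\Im\zeta=(\Im\zeta_1,\dots,\Im\zeta_n)\in\mathbb R^n$ and $x\cdot\zeta=\sum_j x_j\zeta_j$; $\mathbb R_-=\left]-\infty,0\right[$. The space $\mathring B^\ast$ consists of those $u\in L^2_{\mathrm{loc}}(\mathbb R^n)$ with $\frac1R\int_{B(0,R)}|u|^2\to0$ as $R\to\infty$. The notation $u\in\mathring B^\ast_2$ means that $u$ and all its partial derivatives of order at most $2$ belong to $\mathring B^\ast$. *)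

theory Defs
  imports "HOL-Analysis.Analysis"
begin

definition jbr :: "'a::euclidean_space \<Rightarrow> real" where
  "jbr x = sqrt (1 + (norm x)\<^sup>2)"

definition ee :: "complex \<Rightarrow> complex" where
  "ee t = exp (2 * complex_of_real pi * \<i> * t)"

text \<open>x . zeta for zeta = xi + i eta in C^n (xi = Re zeta, eta = Im zeta).\<close>
definition cdot :: "'a::euclidean_space \<Rightarrow> 'a \<Rightarrow> 'a \<Rightarrow> complex" where
  "cdot x xi eta = complex_of_real (x \<bullet> xi) + \<i> * complex_of_real (x \<bullet> eta)"

definition pd :: "'a::euclidean_space \<Rightarrow> ('a \<Rightarrow> real) \<Rightarrow> ('a \<Rightarrow> real)" where
  "pd b \<phi> = (\<lambda>x. frechet_derivative \<phi> (at x) b)"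

fun pds :: "'a::euclidean_space list \<Rightarrow> ('a \<Rightarrow> real) \<Rightarrow> ('a \<Rightarrow> real)" where
  "pds [] \<phi> = \<phi>"
| "pds (b # bs) \<phi> = pd b (pds bs \<phi>)"

definition test_fun :: "('a::euclidean_space \<Rightarrow> real) \<Rightarrow> bool" where
  "test_fun \<phi> \<longleftrightarrow>
     (\<forall>bs. set bs \<subseteq> Basis \<longrightarrow> (\<forall>x. pds bs \<phi> differentiable (at x)))
     \<and> compact (closure {x. \<phi> x \<noteq> 0})"

definition Bstar0 :: "('a::euclidean_space \<Rightarrow> complex) set" where
  "Bstar0 = {u. u \<in> borel_measurable lborel
     \<and> (\<forall>R. (\<integral>\<^sup>+ x \<in> ball 0 R. ennreal ((norm (u x))\<^sup>2) \<partial>lborel) < \<infinity>)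
     \<and> ((\<lambda>R. enn2real (\<integral>\<^sup>+ x \<in> ball 0 R. ennreal ((norm (u x))\<^sup>2) \<partial>lborel) / R)
          \<longlongrightarrow> 0) at_top}"

definition weak_deriv :: "'a::euclidean_space list \<Rightarrow> ('a \<Rightarrow> complex) \<Rightarrow> ('a \<Rightarrow> complex) \<Rightarrow> bool" where
  "weak_deriv bs u g \<longleftrightarrow> (\<forall>\<phi>. test_fun \<phi> \<longrightarrow>
      (LINT x|lborel. u x * complex_of_real (pds bs \<phi> x))
        = (-1) ^ length bs * (LINT x|lborel. g x * complex_of_real (\<phi> x)))"

definition Bstar0_2 :: "('a::euclidean_space \<Rightarrow> complex) \<Rightarrow> ('a \<Rightarrow> 'a \<Rightarrow> complex)
     \<Rightarrow> ('a \<Rightarrow> 'a \<Rightarrow> 'a \<Rightarrow> complex) \<Rightarrow> bool" where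
  "Bstar0_2 u D1 D2 \<longleftrightarrow> u \<in> Bstar0
     \<and> (\<forall>b\<in>Basis. D1 b \<in> Bstar0 \<and> weak_deriv [b] u (D1 b))
     \<and> (\<forall>b\<in>Basis. \<forall>c\<in>Basis. D2 b c \<in> Bstar0 \<and> weak_deriv [b, c] u (D2 b c))"

end

(* Pair u with superpositions v(y,t) = int a(xi) e^{i y.xi} w(xi,t) d xi of plane waves with profiles w bounded
   uniformly in xi and t. By Bessel's inequality on every slice t = const, both v and its gradient have
   L^2 mass O(R) on balls of radius R, so that all boundary terms against u (mass o(R)) disappear and Green's
   identity gives  int u (-Laplace - lam) v = int f v.  Three choices of w are used.

   1. w = e^{-i kappa t}, kappa^2 = lam - |xi|^2, |xi|^2 < lam: a homogeneous solution. Hence the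
      Fourier-Laplace transform fl(xi) = int f e^{i y.xi - mu t}, mu^2 = |xi|^2 - lam, vanishes for |xi|^2 < lam.
   2. f lives in t >= 0 and decays exponentially, so along each ray of the quadric xi^2 + kappa^2 = lam the
      transform is holomorphic near the turning point kappa = 0, and the identity theorem propagates fl = 0
      to |xi|^2 >= lam. This is where n >= 2 enters: there is a tangential frequency xi to vary.
   3. w solves -w'' + mu^2 w = H' (up to sign) with H a bump in t < 0. For t >= 0 it is a multiple of e^{-mu t},
      so int f v = 0. Since the datum is a derivative, w stays bounded as mu -> 0.

   Consequently u is orthogonal to g(y) H'(t) for all Gaussians g, i.e. u does not depend on t for t < 0,
   and the only such function with mass o(R) is 0. *)
theory Submission
  imports Defs "HOL-Complex_Analysis.Conformal_Mappings" "HOL-Probability.Characteristic_Functions"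
    "HOL-Real_Asymp.Real_Asymp"
begin

subsection \<open>Smooth functions\<close>

text \<open>A single plane wave has mass of order R^n on balls of radius R, too much to be paired
  with \<open>u\<close>. Smearing it over the tangential frequency makes every slice square
  integrable, uniformly in t, and brings the mass down to O(R). The price is that the profile must
  be bounded on the whole t-line. For |\<xi>|^2 > lam the solution e^{-\<mu> t} explodes as t tends
  to minus infinity, so it is no admissible test function; this forces the detour through analytic
  continuation. It also forces the third profile, which follows e^{-\<mu> t} only where
  \<open>F\<close> lives and, thanks to a source in t < 0, stays bounded on the other side. The root
  \<mu> branches at |\<xi>|^2 = lam, so the continuation cannot run in |\<xi>|; a trigonometric
  parameter on the quadric removes the branch point. The quadratic weight in the decay hypothesis
  pays for differentiating the exponential, which costs a factor of size |x|. Weak derivatives are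
  tested against real functions, so complex superpositions enter through their real and imaginary
  parts.\<close>

definition smooth_fun :: "('a::euclidean_space \<Rightarrow> real) \<Rightarrow> bool" where
  "smooth_fun f \<longleftrightarrow> (\<forall>bs. set bs \<subseteq> Basis \<longrightarrow> (\<forall>x. pds bs f differentiable (at x)))"

text \<open>\<open>pds\<close> adds new derivatives on the outside. Peeling them off from the inside
  instead makes smoothness of order n recursive in the function itself, so that the sum and product
  rules close by induction on n.\<close>

primrec smooth_upto :: "nat \<Rightarrow> ('a::euclidean_space \<Rightarrow> real) \<Rightarrow> bool" where
  "smooth_upto 0 f \<longleftrightarrow> (\<forall>x. f differentiable (at x))"
| "smooth_upto (Suc n) f \<longleftrightarrow> (\<forall>x. f differentiable (at x)) \<and> (\<forall>b\<in>Basis. smooth_upto n (pd b f))"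

lemma pds_append: "pds (as @ bs) f = pds as (pds bs f)"
  by (induction as) auto

lemma pd_eq: "(f has_derivative f') (at x) \<Longrightarrow> pd b f x = f' b"
  unfolding pd_def by (metis frechet_derivative_at)

lemma pd_real_eq: "(f has_real_derivative D) (at x) \<Longrightarrow> pd 1 f x = D"
  unfolding has_field_derivative_def using pd_eq[of f "(*) D" x 1] by simp

lemma pd_add:
  assumes "f differentiable (at x)" "g differentiable (at x)"
  shows "pd b (\<lambda>x. f x + g x) x = pd b f x + pd b g x"
proof -
  obtain f' g' where d: "(f has_derivative f') (at x)" "(g has_derivative g') (at x)"
    using assms unfolding differentiable_def by blast
  show ?thesis using pd_eq[OF has_derivative_add[OF d]] pd_eq[OF d(1)] pd_eq[OF d(2)] by simp
qed

lemma pd_mult: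
  fixes f g :: "'a::euclidean_space \<Rightarrow> real"
  assumes "f differentiable (at x)" "g differentiable (at x)"
  shows "pd b (\<lambda>x. f x * g x) x = pd b f x * g x + f x * pd b g x"
proof -
  obtain f' g' where d: "(f has_derivative f') (at x)" "(g has_derivative g') (at x)"
    using assms unfolding differentiable_def by blast
  show ?thesis using pd_eq[OF has_derivative_mult[OF d]] pd_eq[OF d(1)] pd_eq[OF d(2)] by simp
qed

lemma smooth_upto_SucD: "smooth_upto (Suc n) f \<Longrightarrow> smooth_upto n f"
  by (induction n arbitrary: f) auto

lemma smooth_upto_add:
  "smooth_upto n f \<Longrightarrow> smooth_upto n g \<Longrightarrow> smooth_upto n (\<lambda>x. f x + g x)"
proof (induction n arbitrary: f g)
  case 0 then show ?case by simp
next
  case (Suc n)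
  have "pd b (\<lambda>x. f x + g x) = (\<lambda>x. pd b f x + pd b g x)" for b
    using Suc.prems by (auto intro!: pd_add)
  then show ?case using Suc by simp
qed

lemma smooth_upto_mult:
  "smooth_upto n f \<Longrightarrow> smooth_upto n g \<Longrightarrow> smooth_upto n (\<lambda>x. f x * g x)"
proof (induction n arbitrary: f g)
  case 0 then show ?case by simp
next
  case (Suc n)
  have "pd b (\<lambda>x. f x * g x) = (\<lambda>x. pd b f x * g x + f x * pd b g x)" for b
    using Suc.prems by (auto intro!: pd_mult)
  moreover have "smooth_upto n f" "smooth_upto n g"
    using Suc.prems by (auto intro: smooth_upto_SucD)
  ultimately show ?case using Suc by (auto intro!: smooth_upto_add)
qed

lemma smooth_upto_pds:
  "smooth_upto n f \<Longrightarrow> set bs \<subseteq> Basis \<Longrightarrow> length bs \<le> n \<Longrightarrow> pds bs f differentiable (at x)"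
proof (induction n arbitrary: f bs)
  case 0 then show ?case by simp
next
  case (Suc n)
  show ?case
  \<comment> \<open>The last entry of \<open>bs\<close> is the derivative that is taken first, the
    one \<open>smooth_upto\<close> peels off.\<close>
  proof (cases bs rule: rev_cases)
    case Nil then show ?thesis using Suc.prems by simp
  next
    case (snoc cs b)
    then show ?thesis using Suc by (simp add: pds_append)
  qed
qed

lemma smooth_fun_pd: "smooth_fun f \<Longrightarrow> b \<in> Basis \<Longrightarrow> smooth_fun (pd b f)"
  unfolding smooth_fun_def
proof (intro allI impI)
  fix bs :: "'a list" and x :: 'a
  assume *: "\<forall>bs. set bs \<subseteq> Basis \<longrightarrow> (\<forall>x. pds bs f differentiable at x)"
    and "b \<in> Basis" "set bs \<subseteq> Basis"
  then have "pds (bs @ [b]) f differentiable at x" by simp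
  then show "pds bs (pd b f) differentiable at x" by (simp add: pds_append)
qed

lemma smooth_fun_differentiable: "smooth_fun f \<Longrightarrow> f differentiable (at x)"
  unfolding smooth_fun_def by (metis empty_subsetI list.set(1) pds.simps(1))

lemma smooth_fun_continuous: "smooth_fun f \<Longrightarrow> continuous_on S f"
  by (simp add: continuous_at_imp_continuous_on differentiable_imp_continuous_within smooth_fun_differentiable)

lemma smooth_fun_iff: "smooth_fun f \<longleftrightarrow> (\<forall>n. smooth_upto n f)"
proof
  have "smooth_fun f \<Longrightarrow> smooth_upto n f" for n and f :: "'a \<Rightarrow> real"
    by (induction n arbitrary: f) (auto simp: smooth_fun_differentiable smooth_fun_pd)
  then show "smooth_fun f \<Longrightarrow> \<forall>n. smooth_upto n f" by blast
  show "\<forall>n. smooth_upto n f \<Longrightarrow> smooth_fun f"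
    unfolding smooth_fun_def using smooth_upto_pds by blast
qed

text \<open>Smoothness is the largest property that implies differentiability and passes to partial
  derivatives. An explicit family closed under \<open>pd\<close> is therefore smooth, without any
  induction on the order.\<close>

lemma smooth_fun_coinduct:
  assumes "P f" "\<And>f x. P f \<Longrightarrow> f differentiable (at x)" "\<And>f b. P f \<Longrightarrow> b \<in> Basis \<Longrightarrow> P (pd b f)"
  shows "smooth_fun f"
proof -
  have "P f \<Longrightarrow> smooth_upto n f" for n f
    by (induction n arbitrary: f) (auto simp: assms)
  then show ?thesis using assms(1) smooth_fun_iff by blast
qed

lemma smooth_fun_mult: "smooth_fun f \<Longrightarrow> smooth_fun g \<Longrightarrow> smooth_fun (\<lambda>x. f x * g x)"
  by (simp add: smooth_fun_iff smooth_upto_mult)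

lemma smooth_fun_const: "smooth_fun (\<lambda>x. c)"
  by (rule smooth_fun_coinduct[where P = "\<lambda>f. \<exists>c. f = (\<lambda>x. c)"])
    (auto simp: pd_def)

lemma smooth_fun_prod:
  "finite I \<Longrightarrow> (\<And>i. i \<in> I \<Longrightarrow> smooth_fun (f i)) \<Longrightarrow> smooth_fun (\<lambda>x. \<Prod>i\<in>I. f i x)"
  by (induction I rule: finite_induct) (auto simp: smooth_fun_const smooth_fun_mult)

lemma smooth_fun_real_deriv:
  "smooth_fun f \<Longrightarrow> (f has_real_derivative pd 1 f x) (at x)"
proof -
  assume "smooth_fun f"
  then obtain f' where f': "(f has_derivative f') (at x)"
    using smooth_fun_differentiable differentiable_def by metis
  have "f' h = f' 1 * h" for h
    using linear_scale[OF has_derivative_linear[OF f'], of h 1] by (simp add: mult.commute)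
  then have "f' = (\<lambda>h. f' 1 * h)" by (rule ext)
  then show ?thesis using f' pd_eq[OF f', of 1] by (simp add: has_field_derivative_def)
qed

lemma pd_affine:
  fixes \<sigma> :: "real \<Rightarrow> real" and a b x :: "'a::euclidean_space"
  assumes "smooth_fun \<sigma>"
  shows "((\<lambda>x. \<sigma> (x \<bullet> a + c)) has_derivative (\<lambda>h. (h \<bullet> a) * pd 1 \<sigma> (x \<bullet> a + c))) (at x)"
  by (rule DERIV_compose_FDERIV[OF smooth_fun_real_deriv[OF assms]])
    (auto intro!: derivative_eq_intros)

lemma smooth_fun_affine:
  fixes \<sigma> :: "real \<Rightarrow> real" and a :: "'a::euclidean_space"
  assumes "smooth_fun \<sigma>"
  shows "smooth_fun (\<lambda>x. \<sigma> (x \<bullet> a + c))"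
\<comment> \<open>The scalar \<open>r\<close> collects the inner derivatives
  \<open>b \<bullet> a\<close> produced by the chain rule.\<close>
proof (rule smooth_fun_coinduct[where P = "\<lambda>f. \<exists>r \<sigma>. smooth_fun \<sigma> \<and> f = (\<lambda>x. r * \<sigma> (x \<bullet> a + c))"])
  show "\<exists>r \<sigma>'. smooth_fun \<sigma>' \<and> (\<lambda>x. \<sigma> (x \<bullet> a + c)) = (\<lambda>x. r * \<sigma>' (x \<bullet> a + c))"
    using assms by (intro exI[of _ 1]) auto
next
  fix f :: "'a \<Rightarrow> real" and x
  assume "\<exists>r \<sigma>. smooth_fun \<sigma> \<and> f = (\<lambda>x. r * \<sigma> (x \<bullet> a + c))"
  then show "f differentiable at x"
    using pd_affine[of _ a c x] by (force simp: differentiable_def intro: has_derivative_mult_right)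
next
  fix f :: "'a \<Rightarrow> real" and b :: 'a
  assume "\<exists>r \<sigma>. smooth_fun \<sigma> \<and> f = (\<lambda>x. r * \<sigma> (x \<bullet> a + c))"
  then obtain r \<sigma> where s: "smooth_fun \<sigma>" and f: "f = (\<lambda>x. r * \<sigma> (x \<bullet> a + c))" by blast
  have "pd b f x = r * (b \<bullet> a) * pd 1 \<sigma> (x \<bullet> a + c)" for x
    unfolding f using pd_eq[OF has_derivative_mult_right[OF pd_affine[OF s, of a c x], of r], of b] by simp
  then show "\<exists>r \<sigma>. smooth_fun \<sigma> \<and> pd b f = (\<lambda>x. r * \<sigma> (x \<bullet> a + c))"
    using smooth_fun_pd[OF s, of 1] by (intro exI[of _ "r * (b \<bullet> a)"] exI[of _ "pd 1 \<sigma>"]) auto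
qed

section \<open>A compactly supported smooth bump\<close>

definition exp_germ :: "real poly \<Rightarrow> real \<Rightarrow> real" where
  "exp_germ p x = (if x > 0 then poly p (1 / x) * exp (- (1 / x)) else 0)"

lemma poly_exp_tendsto_0: "((\<lambda>y::real. poly p y * exp (- y)) \<longlongrightarrow> 0) at_top"
proof -
  have "((\<lambda>y::real. \<Sum>i\<le>degree p. coeff p i * (y ^ i / exp y)) \<longlongrightarrow> (\<Sum>i\<le>degree p. coeff p i * 0)) at_top"
    by (intro tendsto_sum tendsto_mult tendsto_const tendsto_power_div_exp_0)
  then show ?thesis by (simp add: poly_altdef exp_minus field_simps sum_divide_distrib)
qed

text \<open>Put y = 1/x. Then d/dx = -y^2 d/dy and (p e^{-y})' = (p' - p) e^{-y}, whence the new
  polynomial y^2 (p - p'). At the origin the right difference quotient is y p(y) e^{-y}, which tends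
  to 0 as y grows.\<close>

lemma exp_germ_deriv:
  "(exp_germ p has_real_derivative exp_germ ([:0, 0, 1:] * (p - pderiv p)) x) (at x)"
proof (cases x "0::real" rule: linorder_cases)
  case less
  have "((\<lambda>_. 0) has_real_derivative 0) (at x)" by simp
  then have "(exp_germ p has_real_derivative 0) (at x)"
    by (rule has_field_derivative_transform_within_open[of _ _ _ "{..<0}"])
      (use less in \<open>auto simp: exp_germ_def\<close>)
  then show ?thesis using less by (simp add: exp_germ_def)
next
  case equal
  have "((\<lambda>h. (exp_germ p (0 + h) - exp_germ p 0) / h) \<longlongrightarrow> 0) (at_left 0)"
    by (rule tendsto_eventually)
      (auto simp: eventually_at_filter exp_germ_def)
  moreover have "((\<lambda>h. (exp_germ p (0 + h) - exp_germ p 0) / h) \<longlongrightarrow> 0) (at_right 0)"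
  proof -
    have "((\<lambda>h::real. poly (pCons 0 p) (inverse h) * exp (- inverse h)) \<longlongrightarrow> 0) (at_right 0)"
      by (rule filterlim_compose[OF poly_exp_tendsto_0 filterlim_inverse_at_top_right])
    then show ?thesis
      by (rule Lim_transform_eventually)
        (auto simp: eventually_at_filter exp_germ_def field_simps)
  qed
  ultimately have "(\<lambda>h. (exp_germ p (0 + h) - exp_germ p 0) / h) \<midarrow>0\<rightarrow> 0"
    by (simp add: filterlim_split_at)
  then show ?thesis using equal by (simp add: DERIV_def exp_germ_def)
next
  case greater
  have "((\<lambda>x. poly p (1 / x) * exp (- (1 / x))) has_real_derivative
     exp_germ ([:0, 0, 1:] * (p - pderiv p)) x) (at x)"
    using greater
    by (auto intro!: derivative_eq_intros DERIV_chain'[OF _ poly_DERIV] simp: exp_germ_def field_simps power2_eq_square)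
  then show ?thesis
    by (rule has_field_derivative_transform_within_open[of _ _ _ "{0<..}"])
      (use greater in \<open>auto simp: exp_germ_def\<close>)
qed

lemma smooth_exp_germ: "smooth_fun (exp_germ p)"
proof (rule smooth_fun_coinduct[where P = "\<lambda>f. \<exists>p. f = exp_germ p"])
  fix f :: "real \<Rightarrow> real" and b :: real assume "\<exists>p. f = exp_germ p" "b \<in> Basis"
  then obtain p where "f = exp_germ p" "b = 1" by auto
  then show "\<exists>p. pd b f = exp_germ p"
    using pd_real_eq[OF exp_germ_deriv] by blast
next
  fix f :: "real \<Rightarrow> real" and x assume "\<exists>p. f = exp_germ p"
  then show "f differentiable at x"
    using exp_germ_deriv has_field_derivative_imp_has_derivative differentiable_def by blast
qed blast

text \<open>On \<open>\<bar>t\<bar> < 1\<close> this is exp(-2 / (1 - t^2)), since 1/(1 - t) + 1/(1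
  + t) = 2/(1 - t^2).\<close>

definition bump :: "real \<Rightarrow> real" where
  "bump t = exp_germ 1 (1 - t) * exp_germ 1 (1 + t)"

lemma smooth_bump: "smooth_fun bump"
proof -
  have "smooth_fun (\<lambda>t::real. exp_germ 1 (t \<bullet> (-1) + 1))" "smooth_fun (\<lambda>t::real. exp_germ 1 (t \<bullet> 1 + 1))"
    by (rule smooth_fun_affine[OF smooth_exp_germ])+
  from smooth_fun_mult[OF this] show ?thesis
    by (simp add: bump_def[abs_def] inner_real_def add.commute)
qed

lemma bump_nonneg: "bump t \<ge> 0" by (simp add: bump_def exp_germ_def)

lemma bump_pos: "\<bar>t\<bar> < 1 \<Longrightarrow> bump t > 0" by (simp add: bump_def exp_germ_def)

lemma bump_eq_0: "\<bar>t\<bar> \<ge> 1 \<Longrightarrow> bump t = 0" by (auto simp: bump_def exp_germ_def)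

lemma bump_le_1: "bump t \<le> 1"
  by (auto simp: bump_def exp_germ_def mult_le_one)

subsection \<open>Differentiation under the integral sign\<close>

lemma norm_integral_le:
  fixes f :: "'p \<Rightarrow> 'b::{banach, second_countable_topology}"
  assumes "integrable M g" "\<And>x. x \<in> space M \<Longrightarrow> norm (f x) \<le> g x"
  shows "norm (\<integral>x. f x \<partial>M) \<le> (\<integral>x. g x \<partial>M)"
proof (cases "integrable M f")
  case True
  have "norm (\<integral>x. f x \<partial>M) \<le> (\<integral>x. norm (f x) \<partial>M)" by (rule integral_norm_bound)
  also have "\<dots> \<le> (\<integral>x. g x \<partial>M)"
    using True assms by (intro integral_mono) auto
  finally show ?thesis .
next
  \<comment> \<open>A function that is not integrable has integral 0 by convention, so the bound
    survives.\<close>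
  case False
  have "0 \<le> (\<integral>x. g x \<partial>M)"
    by (rule Bochner_Integration.integral_nonneg) (use assms(2) norm_ge_zero order_trans in blast)
  then show ?thesis using False by (simp add: not_integrable_integral_eq)
qed

text \<open>The mean value inequality turns the bound \<open>B\<close> on the derivative into a
  Lipschitz bound for the integrand. Difference quotients minus their linear part are thus dominated
  by 2 B, and dominated convergence applies along every sequence tending to 0.\<close>

lemma has_derivative_integral:
  fixes f :: "'a::real_normed_vector \<Rightarrow> 'p \<Rightarrow> 'b::{banach, second_countable_topology}"
  assumes e: "e > 0"
    and int: "\<And>x. x \<in> ball x0 e \<Longrightarrow> integrable M (f x)"
    and der: "\<And>x p. x \<in> ball x0 e \<Longrightarrow> p \<in> space M \<Longrightarrow> ((\<lambda>x. f x p) has_derivative f' x p) (at x)"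
    and meas: "\<And>h. (\<lambda>p. f' x0 p h) \<in> borel_measurable M"
    and bound: "\<And>x p h. x \<in> ball x0 e \<Longrightarrow> p \<in> space M \<Longrightarrow> norm (f' x p h) \<le> B p * norm h"
    and B: "integrable M B" and B0: "\<And>p. p \<in> space M \<Longrightarrow> 0 \<le> B p"
  shows "((\<lambda>x. \<integral>p. f x p \<partial>M) has_derivative (\<lambda>h. \<integral>p. f' x0 p h \<partial>M)) (at x0)"
proof -
  have x0: "x0 \<in> ball x0 e" using e by simp
  have int': "integrable M (\<lambda>p. f' x0 p h)" for h
    by (rule Bochner_Integration.integrable_bound[OF integrable_mult_left[OF B, of "norm h"] meas])
      (use bound[OF x0] B0 in \<open>auto intro!: AE_I2 simp: abs_mult\<close>)
  have lin: "linear (f' x0 p)" if "p \<in> space M" for p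
    using der[OF x0 that] by (rule has_derivative_linear)
  have bl: "bounded_linear (\<lambda>h. \<integral>p. f' x0 p h \<partial>M)"
  proof (rule bounded_linear_intro[where K = "\<integral>p. B p \<partial>M"])
    fix h h'
    have "(\<integral>p. f' x0 p (h + h') \<partial>M) = (\<integral>p. f' x0 p h + f' x0 p h' \<partial>M)"
      by (intro Bochner_Integration.integral_cong) (auto simp: linear_add[OF lin])
    then show "(\<integral>p. f' x0 p (h + h') \<partial>M) = (\<integral>p. f' x0 p h \<partial>M) + (\<integral>p. f' x0 p h' \<partial>M)"
      using int' by simp
  next
    fix r h
    have "(\<integral>p. f' x0 p (r *\<^sub>R h) \<partial>M) = (\<integral>p. r *\<^sub>R f' x0 p h \<partial>M)"
      by (intro Bochner_Integration.integral_cong) (auto simp: linear_scale[OF lin])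
    then show "(\<integral>p. f' x0 p (r *\<^sub>R h) \<partial>M) = r *\<^sub>R (\<integral>p. f' x0 p h \<partial>M)" by simp
  next
    fix h
    have "norm (\<integral>p. f' x0 p h \<partial>M) \<le> (\<integral>p. B p * norm h \<partial>M)"
      by (rule norm_integral_le) (use B bound[OF x0] in auto)
    then show "norm (\<integral>p. f' x0 p h \<partial>M) \<le> norm h * (\<integral>p. B p \<partial>M)" by (simp add: mult.commute)
  qed
  have lip: "norm (f (x0 + h) p - f x0 p) \<le> B p * norm h" if "h \<in> ball 0 e" "p \<in> space M" for h p
  proof -
    have "norm (f (x0 + h) p - f x0 p) \<le> B p * norm ((x0 + h) - x0)"
    proof (rule differentiable_bound[OF convex_ball[of x0 e]])
      fix x assume x: "x \<in> ball x0 e"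
      show "((\<lambda>x. f x p) has_derivative f' x p) (at x within ball x0 e)"
        using der[OF x that(2)] by (rule has_derivative_at_withinI)
      show "onorm (f' x p) \<le> B p"
        by (rule onorm_bound) (use bound[OF x that(2)] B0 that in auto)
    qed (use that x0 in \<open>auto simp: dist_norm\<close>)
    then show ?thesis by simp
  qed
  let ?q = "\<lambda>h p. inverse (norm h) *\<^sub>R (f (x0 + h) p - f x0 p - f' x0 p h)"
  have lim: "((\<lambda>h. \<integral>p. ?q h p \<partial>M) \<longlongrightarrow> 0) (at 0 within ball 0 e)"
    unfolding tendsto_at_iff_sequentially
  proof (intro allI impI)
    fix X :: "nat \<Rightarrow> 'a" assume X: "\<forall>i. X i \<in> ball 0 e - {0}" "X \<longlonglongrightarrow> 0"
    have inb: "x0 + X i \<in> ball x0 e" for i using X(1)[rule_format, of i] by (simp add: dist_norm)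
    have "(\<lambda>i. \<integral>p. ?q (X i) p \<partial>M) \<longlonglongrightarrow> (\<integral>p. 0 \<partial>M)"
    proof (rule integral_dominated_convergence[where w = "\<lambda>p. 2 * B p"])
      show "?q (X i) \<in> borel_measurable M" for i
        using borel_measurable_integrable[OF int[OF inb]] borel_measurable_integrable[OF int[OF x0]] meas
        by measurable
      show "integrable M (\<lambda>p. 2 * B p)" using B by simp
      show "AE p in M. (\<lambda>i. ?q (X i) p) \<longlonglongrightarrow> 0"
      proof (rule AE_I2)
        fix p assume p: "p \<in> space M"
        have "(\<lambda>h. norm (f (x0 + h) p - f x0 p - f' x0 p h) / norm h) \<midarrow>0\<rightarrow> 0"
          using der[OF x0 p] unfolding has_derivative_at by simp
        then have "((\<lambda>h. norm (?q h p)) \<longlongrightarrow> 0) (at 0)"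
          by (simp add: divide_inverse mult.commute)
        then have "((\<lambda>h. ?q h p) \<longlongrightarrow> 0) (at 0)" by (rule tendsto_norm_zero_cancel)
        then show "(\<lambda>i. ?q (X i) p) \<longlonglongrightarrow> 0"
          using X unfolding tendsto_at_iff_sequentially by (auto simp: o_def)
      qed
      show "AE p in M. norm (?q (X i) p) \<le> 2 * B p" for i
      proof (rule AE_I2)
        fix p assume p: "p \<in> space M"
        have Xi: "X i \<in> ball 0 e" "X i \<noteq> 0" using X(1) by auto
        have "norm (f (x0 + X i) p - f x0 p - f' x0 p (X i)) \<le> B p * norm (X i) + B p * norm (X i)"
          using norm_triangle_ineq4[of "f (x0 + X i) p - f x0 p" "f' x0 p (X i)"]
            lip[OF Xi(1) p] bound[OF x0 p, of "X i"] by linarith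
        then have "norm (f (x0 + X i) p - f x0 p - f' x0 p (X i)) / norm (X i) \<le> 2 * B p"
          using Xi(2) by (simp add: divide_le_eq)
        then show "norm (?q (X i) p) \<le> 2 * B p"
          by (simp add: divide_inverse mult.commute)
      qed
    qed simp
    then show "((\<lambda>h. \<integral>p. ?q h p \<partial>M) \<circ> X) \<longlonglongrightarrow> 0" by (simp add: o_def)
  qed
  have "((\<lambda>h. norm ((\<integral>p. f (x0 + h) p \<partial>M) - (\<integral>p. f x0 p \<partial>M) - (\<integral>p. f' x0 p h \<partial>M)) / norm h) \<longlongrightarrow> 0)
     (at 0 within ball 0 e)"
  proof (rule Lim_transform_eventually[OF tendsto_norm_zero[OF lim]])
    have "norm (\<integral>p. ?q h p \<partial>M) =
        norm ((\<integral>p. f (x0 + h) p \<partial>M) - (\<integral>p. f x0 p \<partial>M) - (\<integral>p. f' x0 p h \<partial>M)) / norm h"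
      if "h \<in> ball 0 e" for h
    proof -
      have i: "integrable M (f (x0 + h))" using int[of "x0 + h"] that by (simp add: dist_norm)
      have "(\<integral>p. ?q h p \<partial>M) = inverse (norm h) *\<^sub>R
          ((\<integral>p. f (x0 + h) p \<partial>M) - (\<integral>p. f x0 p \<partial>M) - (\<integral>p. f' x0 p h \<partial>M))"
        using i int[OF x0] int' by simp
      then show ?thesis by (simp only: norm_scaleR) (simp add: divide_inverse)
    qed
    then show "\<forall>\<^sub>F h in at 0 within ball 0 e. norm (\<integral>p. ?q h p \<partial>M) =
        norm ((\<integral>p. f (x0 + h) p \<partial>M) - (\<integral>p. f x0 p \<partial>M) - (\<integral>p. f' x0 p h \<partial>M)) / norm h"
      by (auto simp: eventually_at_filter)
  qed
  then have "((\<lambda>h. norm ((\<integral>p. f (x0 + h) p \<partial>M) - (\<integral>p. f x0 p \<partial>M) - (\<integral>p. f' x0 p h \<partial>M)) / norm h) \<longlongrightarrow> 0) (at 0)"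
    using e by (simp add: at_within_open[of 0 "ball 0 e"])
  then show ?thesis using bl unfolding has_derivative_at by simp
qed

text \<open>\<open>\<Phi> bs\<close> is the integrand differentiated along \<open>bs\<close>.
  Indexing by lists lets one first-order statement, applied to each \<open>\<Phi> bs\<close>, serve
  all orders at once. \<open>L\<close> will be the real or the imaginary part, as test functions are
  real.\<close>

lemma pds_integral:
  fixes \<Phi> :: "'a::euclidean_space list \<Rightarrow> 'a \<Rightarrow> 'p \<Rightarrow> complex" and L :: "complex \<Rightarrow> real"
  assumes int: "\<And>bs x. set bs \<subseteq> Basis \<Longrightarrow> integrable M (\<Phi> bs x)"
    and der: "\<And>bs x p. set bs \<subseteq> Basis \<Longrightarrow> p \<in> space M \<Longrightarrow>
      ((\<lambda>x. \<Phi> bs x p) has_derivative (\<lambda>h. \<Sum>b\<in>Basis. (h \<bullet> b) *\<^sub>R \<Phi> (b # bs) x p)) (at x)"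
    and bd: "\<And>bs x p. set bs \<subseteq> Basis \<Longrightarrow> p \<in> space M \<Longrightarrow> norm (\<Phi> bs x p) \<le> B bs p"
    and B: "\<And>bs. set bs \<subseteq> Basis \<Longrightarrow> integrable M (B bs)"
    and L: "bounded_linear L"
  shows "smooth_fun (\<lambda>x. L (\<integral>p. \<Phi> [] x p \<partial>M))"
    and "set bs \<subseteq> Basis \<Longrightarrow> pds bs (\<lambda>x. L (\<integral>p. \<Phi> [] x p \<partial>M)) = (\<lambda>x. L (\<integral>p. \<Phi> bs x p \<partial>M))"
proof -
  have d: "((\<lambda>x. L (\<integral>p. \<Phi> bs x p \<partial>M)) has_derivative
      (\<lambda>h. L (\<integral>p. (\<Sum>b\<in>Basis. (h \<bullet> b) *\<^sub>R \<Phi> (b # bs) x p) \<partial>M))) (at x)"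
    if bs: "set bs \<subseteq> Basis" for bs x
  proof (rule bounded_linear.has_derivative[OF L],
      rule has_derivative_integral[where e = 1 and B = "\<lambda>p. \<Sum>b\<in>Basis. B (b # bs) p"
        and f' = "\<lambda>x p h. \<Sum>b\<in>Basis. (h \<bullet> b) *\<^sub>R \<Phi> (b # bs) x p"])
    show "(\<lambda>p. \<Sum>b\<in>Basis. (h \<bullet> b) *\<^sub>R \<Phi> (b # bs) x p) \<in> borel_measurable M" for h
      using borel_measurable_integrable[OF int] bs by (intro borel_measurable_sum borel_measurable_scaleR) auto
    show "integrable M (\<lambda>p. \<Sum>b\<in>Basis. B (b # bs) p)"
      using B bs by (intro Bochner_Integration.integrable_sum) auto
  next
    fix x p and h :: 'a assume p: "p \<in> space M"
    have nn: "0 \<le> B (b # bs) p" if "b \<in> Basis" for b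
      using order_trans[OF norm_ge_zero bd[of "b # bs" p x]] that bs p by simp
    have "norm (\<Sum>b\<in>Basis. (h \<bullet> b) *\<^sub>R \<Phi> (b # bs) x p) \<le> (\<Sum>b\<in>Basis. norm h * B (b # bs) p)"
    proof (rule sum_norm_le)
      fix b :: 'a assume b: "b \<in> Basis"
      show "norm ((h \<bullet> b) *\<^sub>R \<Phi> (b # bs) x p) \<le> norm h * B (b # bs) p"
        using bd[of "b # bs" p x] Basis_le_norm[OF b, of h] b bs p by (auto intro!: mult_mono)
    qed
    then show "norm (\<Sum>b\<in>Basis. (h \<bullet> b) *\<^sub>R \<Phi> (b # bs) x p) \<le> (\<Sum>b\<in>Basis. B (b # bs) p) * norm h"
      by (simp add: sum_distrib_left mult.commute)
    show "0 \<le> (\<Sum>b\<in>Basis. B (b # bs) p)" using nn by (intro sum_nonneg) auto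
  qed (use int der bs in auto)
  have pd: "pd b (\<lambda>x. L (\<integral>p. \<Phi> bs x p \<partial>M)) = (\<lambda>x. L (\<integral>p. \<Phi> (b # bs) x p \<partial>M))"
    if bs: "set bs \<subseteq> Basis" and b: "b \<in> Basis" for b bs
  proof
    fix x
    have "(\<Sum>c\<in>Basis. (b \<bullet> c) *\<^sub>R \<Phi> (c # bs) x p) = \<Phi> (b # bs) x p" for p
    proof -
      have "(\<Sum>c\<in>Basis. (b \<bullet> c) *\<^sub>R \<Phi> (c # bs) x p) = (\<Sum>c\<in>Basis. if c = b then \<Phi> (c # bs) x p else 0)"
        by (rule sum.cong) (auto simp: inner_Basis b)
      then show ?thesis using b by simp
    qed
    then show "pd b (\<lambda>x. L (\<integral>p. \<Phi> bs x p \<partial>M)) x = L (\<integral>p. \<Phi> (b # bs) x p \<partial>M)"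
      using pd_eq[OF d[OF bs], of b x] by simp
  qed
  show pds: "pds bs (\<lambda>x. L (\<integral>p. \<Phi> [] x p \<partial>M)) = (\<lambda>x. L (\<integral>p. \<Phi> bs x p \<partial>M))"
    if "set bs \<subseteq> Basis" for bs
    using that by (induction bs) (auto simp: pd)
  show "smooth_fun (\<lambda>x. L (\<integral>p. \<Phi> [] x p \<partial>M))"
    unfolding smooth_fun_def using d pds by (auto simp: differentiable_def) 
qed

subsection \<open>Gaussians\<close>

lemma norm_integral_le_nn_integral:
  fixes f :: "'p \<Rightarrow> 'b::{banach, second_countable_topology}"
  shows "ennreal (norm (\<integral>x. f x \<partial>M)) \<le> (\<integral>\<^sup>+x. ennreal (norm (f x)) \<partial>M)"
  by (cases "integrable M f") (auto simp: integral_norm_bound_ennreal not_integrable_integral_eq)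

lemma integrable_tensor:
  fixes f :: "'a::euclidean_space \<Rightarrow> real" and g :: "'b::euclidean_space \<Rightarrow> real"
  assumes f: "integrable lborel f" and g: "integrable lborel g"
  shows "integrable (lborel \<Otimes>\<^sub>M lborel) (\<lambda>p. f (fst p) * g (snd p))"
proof -
  have [measurable]: "f \<in> borel_measurable borel" "g \<in> borel_measurable borel" using f g by auto
  show ?thesis
  proof (rule lborel_pair.Fubini_integrable)
    show "(\<lambda>p. f (fst p) * g (snd p)) \<in> borel_measurable (lborel \<Otimes>\<^sub>M lborel)" by measurable
    have "integrable lborel (\<lambda>x. norm (f x) * (\<integral>y. norm (g y) \<partial>lborel))"
      using f by (intro integrable_mult_left integrable_norm)
    then show "integrable lborel (\<lambda>x. \<integral>y. norm (f (fst (x, y)) * g (snd (x, y))) \<partial>lborel)"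
      by (simp add: abs_mult)
    show "AE x in lborel. integrable lborel (\<lambda>y. f (fst (x, y)) * g (snd (x, y)))" using g by simp
  qed
qed

lemma integral_swap_dominated:
  fixes F :: "'a::euclidean_space \<Rightarrow> 'b::euclidean_space \<Rightarrow> complex"
  assumes f: "integrable lborel f" and g: "integrable lborel g"
    and [measurable]: "(\<lambda>p. F (fst p) (snd p)) \<in> borel_measurable (lborel \<Otimes>\<^sub>M lborel)"
    and bd: "\<And>x y. norm (F x y) \<le> f x * g y"
  shows "integrable (lborel \<Otimes>\<^sub>M lborel) (\<lambda>p. F (fst p) (snd p))"
    and "(\<integral>x. \<integral>y. F x y \<partial>lborel \<partial>lborel) = (\<integral>y. \<integral>x. F x y \<partial>lborel \<partial>lborel)"
proof -
  show i: "integrable (lborel \<Otimes>\<^sub>M lborel) (\<lambda>p. F (fst p) (snd p))"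
    by (rule Bochner_Integration.integrable_bound[OF integrable_tensor[OF f g]])
      (auto intro!: AE_I2 order_trans[OF bd])
  show "(\<integral>x. \<integral>y. F x y \<partial>lborel \<partial>lborel) = (\<integral>y. \<integral>x. F x y \<partial>lborel \<partial>lborel)"
    using lborel_pair.Fubini_integral[of F] i by (simp add: split_beta')
qed

text \<open>The characteristic function of the standard normal distribution, after the substitution
  of sqrt s * x for x.\<close>

lemma gauss_fourier_real:
  assumes s: "s > 0"
  shows "integrable lborel (\<lambda>x::real. complex_of_real (exp (- (s * x\<^sup>2 / 2))) * iexp (t * x))"
    and "(\<integral>x. complex_of_real (exp (- (s * x\<^sup>2 / 2))) * iexp (t * x) \<partial>lborel)
      = complex_of_real (sqrt (2 * pi / s) * exp (- (t\<^sup>2 / (2 * s))))"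
proof -
  have "integrable lborel (\<lambda>x. sqrt (2 * pi / s) * normal_density 0 (1 / sqrt s) x)"
    using s by (intro integrable_mult_right integrable_normal_density) simp
  moreover have "sqrt (2 * pi / s) * normal_density 0 (1 / sqrt s) x = exp (- (s * x\<^sup>2 / 2))" for x
    using s by (simp add: normal_density_def power_divide field_simps)
  ultimately have r: "integrable lborel (\<lambda>x::real. exp (- (s * x\<^sup>2 / 2)))" by simp
  show "integrable lborel (\<lambda>x::real. complex_of_real (exp (- (s * x\<^sup>2 / 2))) * iexp (t * x))"
    by (rule Bochner_Integration.integrable_bound[OF r]) (auto simp: norm_mult)
  define \<tau> where "\<tau> = t / sqrt s"
  define F where "F = (\<lambda>x::real. complex_of_real (exp (- (x\<^sup>2 / 2))) * iexp (\<tau> * x))"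
  have "complex_of_real (exp (- (\<tau>\<^sup>2 / 2))) = char std_normal_distribution \<tau>"
    by (simp add: char_std_normal_distribution)
  also have "\<dots> = (\<integral>x. std_normal_density x *\<^sub>R iexp (\<tau> * x) \<partial>lborel)"
    unfolding char_def by (rule integral_density) auto
  also have "\<dots> = (\<integral>x. (1 / sqrt (2 * pi)) *\<^sub>R F x \<partial>lborel)"
    by (simp add: std_normal_density_def F_def scaleR_conv_of_real mult.assoc)
  also have "\<dots> = (1 / sqrt (2 * pi)) *\<^sub>R (\<integral>x. F x \<partial>lborel)" by simp
  also have "(\<integral>x. F x \<partial>lborel) = sqrt s *\<^sub>R (\<integral>x. F (0 + sqrt s * x) \<partial>lborel)"
    using s by (subst lborel_integral_real_affine[of "sqrt s" F 0]) auto
  also have "(\<lambda>x. F (0 + sqrt s * x)) = (\<lambda>x::real. complex_of_real (exp (- (s * x\<^sup>2 / 2))) * iexp (t * x))"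
    using s by (auto simp: F_def \<tau>_def power_mult_distrib)
  finally have e: "complex_of_real (exp (- (\<tau>\<^sup>2 / 2))) = (sqrt s / sqrt (2 * pi)) *\<^sub>R
    (\<integral>x. complex_of_real (exp (- (s * x\<^sup>2 / 2))) * iexp (t * x) \<partial>lborel)" (is "?a = ?c *\<^sub>R ?I") by simp
  have "(sqrt (2 * pi) / sqrt s) *\<^sub>R ?a = ?I" unfolding e using s by simp
  moreover have "\<tau>\<^sup>2 / 2 = t\<^sup>2 / (2 * s)" using s by (simp add: \<tau>_def power_divide)
  ultimately show "?I = complex_of_real (sqrt (2 * pi / s) * exp (- (t\<^sup>2 / (2 * s))))"
    by (simp add: scaleR_conv_of_real real_sqrt_divide)
qed

text \<open>The centred Gaussian with inverse variance \<open>s\<close>; up to a constant the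
  Fourier transform replaces \<open>s\<close> by 1/s.\<close>

definition gss :: "real \<Rightarrow> 'a::euclidean_space \<Rightarrow> real" where
  "gss s x = exp (- (s * (norm x)\<^sup>2 / 2))"

lemma gss_pos: "gss s x > 0" by (simp add: gss_def)
lemma gss_nonneg[simp]: "gss s x \<ge> 0" by (simp add: gss_def)
lemma gss_minus: "gss s (- x) = gss s x" by (simp add: gss_def)

lemma measurable_gss[measurable]: "gss s \<in> borel_measurable borel"
  unfolding gss_def[abs_def] by measurable

lemma gss_le_1: "s \<ge> 0 \<Longrightarrow> gss s x \<le> 1" by (simp add: gss_def)

lemma gauss_fourier:
  fixes y :: "'a::euclidean_space"
  assumes s: "s > 0"
  shows "integrable lborel (\<lambda>x::'a. complex_of_real (gss s x) * iexp (y \<bullet> x))"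
    and "(\<integral>x. complex_of_real (gss s (x::'a)) * iexp (y \<bullet> x) \<partial>lborel)
      = complex_of_real (sqrt (2 * pi / s) ^ DIM('a) * gss (1 / s) y)"
proof -
  interpret product_sigma_finite "\<lambda>_::'a. lborel :: real measure" ..
  let ?F = "\<lambda>x::'a. complex_of_real (gss s x) * iexp (y \<bullet> x)"
  let ?h = "\<lambda>b x::real. complex_of_real (exp (- (s * x\<^sup>2 / 2))) * iexp ((y \<bullet> b) * x)"
  let ?T = "\<lambda>f::'a \<Rightarrow> real. \<Sum>b\<in>Basis. f b *\<^sub>R b"
  have sq: "(norm x)\<^sup>2 = (\<Sum>b\<in>Basis. (x \<bullet> b)\<^sup>2)" for x :: 'a
    unfolding power2_norm_eq_inner by (subst euclidean_inner) (simp add: power2_eq_square)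
  have F: "?F x = (\<Prod>b\<in>Basis. ?h b (x \<bullet> b))" for x
  proof -
    have "complex_of_real (gss s x) = (\<Prod>b\<in>Basis. complex_of_real (exp (- (s * (x \<bullet> b)\<^sup>2 / 2))))"
      by (simp add: gss_def sq sum_distrib_left sum_divide_distrib exp_sum flip: sum_negf)
    moreover have "iexp (y \<bullet> x) = (\<Prod>b\<in>Basis. iexp ((y \<bullet> b) * (x \<bullet> b)))"
      by (subst euclidean_inner) (simp add: sum_distrib_left exp_sum)
    ultimately show ?thesis by (simp add: prod.distrib)
  qed
  have FT: "?F (?T f) = (\<Prod>b\<in>Basis. ?h b (f b))" for f
    unfolding F by (intro prod.cong) auto
  have [measurable]: "?T \<in> measurable (\<Pi>\<^sub>M b\<in>Basis. lborel) borel" by measurable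
  have "integrable (\<Pi>\<^sub>M b\<in>Basis. lborel) (\<lambda>f. \<Prod>b\<in>Basis. ?h b (f b))"
    by (rule product_integrable_prod) (use gauss_fourier_real(1)[OF s] in auto)
  then show "integrable lborel ?F"
    by (subst lborel_eq, subst integrable_distr_eq) (auto simp: FT)
  have "(\<integral>x. ?F x \<partial>lborel) = (\<integral>f. (\<Prod>b\<in>Basis. ?h b (f b)) \<partial>(\<Pi>\<^sub>M b\<in>Basis. lborel))"
    by (subst lborel_eq, subst integral_distr) (auto simp: FT)
  also have "\<dots> = (\<Prod>b\<in>Basis. \<integral>x. ?h b x \<partial>lborel)"
    by (rule product_integral_prod) (use gauss_fourier_real(1)[OF s] in auto)
  also have "\<dots> = (\<Prod>b\<in>(Basis::'a set). complex_of_real (sqrt (2 * pi / s) * exp (- ((y \<bullet> b)\<^sup>2 / (2 * s)))))"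
    by (simp only: gauss_fourier_real(2)[OF s])
  also have "\<dots> = complex_of_real (sqrt (2 * pi / s) ^ DIM('a) * gss (1 / s) y)"
    using s by (simp add: prod.distrib gss_def sq sum_divide_distrib exp_sum mult.commute[of 2 s] flip: sum_negf)
  finally show "(\<integral>x. complex_of_real (gss s (x::'a)) * iexp (y \<bullet> x) \<partial>lborel)
      = complex_of_real (sqrt (2 * pi / s) ^ DIM('a) * gss (1 / s) y)" .
qed

lemma gss_integrable:
  assumes "s > 0" shows "integrable lborel (gss s :: 'a::euclidean_space \<Rightarrow> real)"
  using integrable_norm[OF gauss_fourier(1)[OF assms, of "0::'a"]] by simp

lemma gss_integral:
  assumes "s > 0" shows "(\<integral>x. gss s (x::'a::euclidean_space) \<partial>lborel) = sqrt (2 * pi / s) ^ DIM('a)"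
proof -
  have "complex_of_real (\<integral>x. gss s (x::'a) \<partial>lborel) = complex_of_real (sqrt (2 * pi / s) ^ DIM('a))"
    using gauss_fourier(2)[OF assms, of "0::'a"] gss_integrable[OF assms, where ?'a = 'a]
    by (simp add: gss_def[of _ "0::'a"])
  then show ?thesis by (simp only: of_real_eq_iff)
qed

lemma lborel_distr_reflect: "distr lborel borel (\<lambda>x::'a::euclidean_space. c - x) = lborel"
  using lborel_affine[of "-1" c] by (simp add: density_1)

lemma nn_integral_translate_reflect:
  fixes f :: "'a::euclidean_space \<Rightarrow> ennreal"
  assumes [measurable]: "f \<in> borel_measurable borel"
  shows "(\<integral>\<^sup>+x. f (c - x) \<partial>lborel) = (\<integral>\<^sup>+x. f x \<partial>lborel)"
  by (subst (2) lborel_distr_reflect[of c, symmetric], subst nn_integral_distr) auto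

text \<open>A local form of Plancherel's inequality: expanding the square and integrating the Gaussian weight
  first leaves a convolution with a Gaussian, to which Schur's test applies.\<close>

lemma gauss_bessel:
  fixes a :: "'a::euclidean_space \<Rightarrow> complex"
  assumes s: "s > 0" and a: "integrable lborel a"
  defines "V \<equiv> \<lambda>y. \<integral>\<xi>. a \<xi> * iexp (y \<bullet> \<xi>) \<partial>lborel"
  shows "(\<integral>\<^sup>+y. ennreal (gss s y * (norm (V y))\<^sup>2) \<partial>lborel)
     \<le> ennreal ((2 * pi) ^ DIM('a)) * (\<integral>\<^sup>+\<xi>. ennreal ((norm (a \<xi>))\<^sup>2) \<partial>lborel)"
proof -
  have [measurable]: "a \<in> borel_measurable borel" using a by auto
  have [measurable]: "V \<in> borel_measurable borel" unfolding V_def by measurable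
  have [measurable]: "cnj \<in> borel_measurable borel"
    by (intro borel_measurable_continuous_onI continuous_intros)
  define A where "A = (\<integral>\<xi>. norm (a \<xi>) \<partial>lborel)"
  have na: "integrable lborel (\<lambda>\<xi>. norm (a \<xi>))" using a by simp
  have gi: "integrable lborel (gss s :: 'a \<Rightarrow> real)" by (rule gss_integrable[OF s])
  have VA: "norm (V y) \<le> A" for y
    unfolding V_def A_def by (rule norm_integral_le[OF na]) (simp add: norm_mult)
  have A0: "A \<ge> 0" unfolding A_def by simp
  define K where "K = (\<lambda>z::'a. sqrt (2 * pi / s) ^ DIM('a) * gss (1 / s) z)"
  have [measurable]: "K \<in> borel_measurable borel" unfolding K_def by measurable
  have K0: "K z \<ge> 0" for z using s by (simp add: K_def)
  \<comment> \<open>The total mass of \<open>K\<close>, the Fourier transform of the weight, does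
    not depend on \<open>s\<close>. Taking s = 1/R^2 later, this makes the slice estimate uniform in
    R.\<close>
  have nnK: "(\<integral>\<^sup>+\<eta>. ennreal (K (\<xi> - \<eta>)) \<partial>lborel) = ennreal ((2 * pi) ^ DIM('a))" for \<xi>
  proof -
    have "(\<integral>\<^sup>+\<eta>. ennreal (K (\<xi> - \<eta>)) \<partial>lborel) = (\<integral>\<^sup>+\<eta>. ennreal (K \<eta>) \<partial>lborel)"
      by (rule nn_integral_translate_reflect) simp
    also have "\<dots> = ennreal (\<integral>\<eta>. K \<eta> \<partial>lborel)"
      by (rule nn_integral_eq_integral) (use s gss_integrable[of "1 / s"] K0 in \<open>auto simp: K_def\<close>)
    also have "(\<integral>\<eta>. K \<eta> \<partial>lborel) = sqrt (2 * pi / s) ^ DIM('a) * sqrt (2 * pi * s) ^ DIM('a)"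
      unfolding K_def using gss_integral[of "1 / s", where ?'a = 'a] s by simp
    also have "\<dots> = (2 * pi) ^ DIM('a)"
    proof -
      have "sqrt (2 * pi / s) * sqrt (2 * pi * s) = sqrt ((2 * pi)\<^sup>2)"
        unfolding real_sqrt_mult[symmetric] using s by (simp add: power2_eq_square)
      then have "sqrt (2 * pi / s) * sqrt (2 * pi * s) = 2 * pi" by (simp only: real_sqrt_abs) simp
      then show ?thesis by (simp only: power_mult_distrib[symmetric])
    qed
    finally show ?thesis .
  qed
  have Vint: "integrable lborel (\<lambda>y. gss s y * (norm (V y))\<^sup>2)"
    by (rule Bochner_Integration.integrable_bound[OF integrable_mult_left[OF gi, of "A\<^sup>2"]])
      (auto intro!: AE_I2 mult_left_mono power_mono VA simp: abs_mult)
  have "complex_of_real (\<integral>y. gss s y * (norm (V y))\<^sup>2 \<partial>lborel)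
      = (\<integral>y. \<integral>\<xi>. a \<xi> * iexp (y \<bullet> \<xi>) * (gss s y * cnj (V y)) \<partial>lborel \<partial>lborel)"
  proof -
    have "(\<integral>\<xi>. a \<xi> * iexp (y \<bullet> \<xi>) * c \<partial>lborel) = V y * c" for y c
      unfolding V_def by simp
    moreover have "complex_of_real (gss s y * (norm (V y))\<^sup>2) = V y * (gss s y * cnj (V y))" for y
      using complex_norm_square[of "V y"] by simp
    ultimately show ?thesis by (simp only: integral_complex_of_real[symmetric])
  qed
  also have "\<dots> = (\<integral>\<xi>. \<integral>y. a \<xi> * iexp (y \<bullet> \<xi>) * (gss s y * cnj (V y)) \<partial>lborel \<partial>lborel)"
  proof (rule integral_swap_dominated(2))
    show "integrable lborel (\<lambda>y::'a. gss s y * A)" using gi by simp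
    show "norm (a \<xi> * iexp (y \<bullet> \<xi>) * (gss s y * cnj (V y))) \<le> gss s y * A * norm (a \<xi>)" for y \<xi>
      using mult_left_mono[OF mult_left_mono[OF VA[of y] gss_nonneg[of s y]] norm_ge_zero[of "a \<xi>"]]
      by (simp add: norm_mult mult_ac)
  qed (use na in \<open>measurable\<close>)
  also have "\<dots> = (\<integral>\<xi>. a \<xi> * (\<integral>y. \<integral>\<eta>. cnj (a \<eta>) * (gss s y * iexp (y \<bullet> (\<xi> - \<eta>))) \<partial>lborel \<partial>lborel) \<partial>lborel)"
  proof -
    have "cnj (V y) = (\<integral>\<eta>. cnj (a \<eta>) * iexp (- (y \<bullet> \<eta>)) \<partial>lborel)" for y
    proof -
      have "integrable lborel (\<lambda>\<xi>. a \<xi> * iexp (y \<bullet> \<xi>))"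
        by (rule Bochner_Integration.integrable_bound[OF na]) (auto simp: norm_mult)
      from integral_bounded_linear[OF bounded_linear_cnj this] show ?thesis
        unfolding V_def by (simp add: exp_cnj)
    qed
    then have "iexp (y \<bullet> \<xi>) * (gss s y * cnj (V y)) = (\<integral>\<eta>. (iexp (y \<bullet> \<xi>) * gss s y) * (cnj (a \<eta>) * iexp (- (y \<bullet> \<eta>))) \<partial>lborel)" for y \<xi>
      by (simp only: integral_mult_right_zero mult.assoc)
    also have "\<dots> y \<xi> = (\<integral>\<eta>. cnj (a \<eta>) * (gss s y * iexp (y \<bullet> (\<xi> - \<eta>))) \<partial>lborel)" for y \<xi>
      by (rule Bochner_Integration.integral_cong) (simp_all add: inner_diff_right exp_diff exp_minus field_simps)
    finally show ?thesis by (simp only: mult.assoc integral_mult_right_zero)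
  qed
  also have "\<dots> = (\<integral>\<xi>. a \<xi> * (\<integral>\<eta>. cnj (a \<eta>) * K (\<xi> - \<eta>) \<partial>lborel) \<partial>lborel)"
  proof -
    have "(\<integral>y. \<integral>\<eta>. cnj (a \<eta>) * (gss s y * iexp (y \<bullet> (\<xi> - \<eta>))) \<partial>lborel \<partial>lborel) =
      (\<integral>\<eta>. \<integral>y. cnj (a \<eta>) * (gss s y * iexp (y \<bullet> (\<xi> - \<eta>))) \<partial>lborel \<partial>lborel)" for \<xi>
      by (rule integral_swap_dominated(2)[OF gi na]) (auto simp: norm_mult)
    moreover have "(\<integral>y. cnj (a \<eta>) * (gss s y * iexp (y \<bullet> (\<xi> - \<eta>))) \<partial>lborel) = cnj (a \<eta>) * K (\<xi> - \<eta>)" for \<xi> \<eta>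
      using gauss_fourier(2)[OF s, of "\<xi> - \<eta>"] by (simp add: K_def inner_commute)
    ultimately show ?thesis by (simp only:)
  qed
  finally have main: "complex_of_real (\<integral>y. gss s y * (norm (V y))\<^sup>2 \<partial>lborel)
      = (\<integral>\<xi>. a \<xi> * (\<integral>\<eta>. cnj (a \<eta>) * K (\<xi> - \<eta>) \<partial>lborel) \<partial>lborel)" .
  have "(\<integral>\<^sup>+y. ennreal (gss s y * (norm (V y))\<^sup>2) \<partial>lborel) = ennreal (\<integral>y. gss s y * (norm (V y))\<^sup>2 \<partial>lborel)"
    by (rule nn_integral_eq_integral[OF Vint]) simp
  also have "\<dots> = ennreal (norm (complex_of_real (\<integral>y. gss s y * (norm (V y))\<^sup>2 \<partial>lborel)))"
    by (simp add: Bochner_Integration.integral_nonneg)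
  also have "\<dots> \<le> (\<integral>\<^sup>+\<xi>. ennreal (norm (a \<xi> * (\<integral>\<eta>. cnj (a \<eta>) * K (\<xi> - \<eta>) \<partial>lborel))) \<partial>lborel)"
    unfolding main by (rule norm_integral_le_nn_integral)
  also have "\<dots> \<le> (\<integral>\<^sup>+\<xi>. \<integral>\<^sup>+\<eta>. ennreal ((norm (a \<xi>))\<^sup>2 / 2 * K (\<xi> - \<eta>)) + ennreal ((norm (a \<eta>))\<^sup>2 / 2 * K (\<xi> - \<eta>)) \<partial>lborel \<partial>lborel)"
  proof (rule nn_integral_mono)
    fix \<xi> :: 'a
    have "ennreal (norm (a \<xi> * (\<integral>\<eta>. cnj (a \<eta>) * K (\<xi> - \<eta>) \<partial>lborel))) =
        ennreal (norm (\<integral>\<eta>. a \<xi> * (cnj (a \<eta>) * K (\<xi> - \<eta>)) \<partial>lborel))" by simp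
    also have "\<dots> \<le> (\<integral>\<^sup>+\<eta>. ennreal (norm (a \<xi> * (cnj (a \<eta>) * K (\<xi> - \<eta>)))) \<partial>lborel)"
      by (rule norm_integral_le_nn_integral)
    also have "\<dots> \<le> (\<integral>\<^sup>+\<eta>. ennreal ((norm (a \<xi>))\<^sup>2 / 2 * K (\<xi> - \<eta>)) + ennreal ((norm (a \<eta>))\<^sup>2 / 2 * K (\<xi> - \<eta>)) \<partial>lborel)"
    proof (rule nn_integral_mono)
      fix \<eta> :: 'a
      \<comment> \<open>Schur's test: the arithmetic-geometric mean splits the double integral into
        two halves, which agree because \<open>K\<close> is even.\<close>
      have "norm (a \<xi>) * norm (a \<eta>) \<le> (norm (a \<xi>))\<^sup>2 / 2 + (norm (a \<eta>))\<^sup>2 / 2"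
        using sum_squares_bound[of "norm (a \<xi>)" "norm (a \<eta>)"] by simp
      then have "norm (a \<xi>) * norm (a \<eta>) * K (\<xi> - \<eta>) \<le> ((norm (a \<xi>))\<^sup>2 / 2 + (norm (a \<eta>))\<^sup>2 / 2) * K (\<xi> - \<eta>)"
        by (rule mult_right_mono) (rule K0)
      then have "ennreal (norm (a \<xi> * (cnj (a \<eta>) * K (\<xi> - \<eta>)))) \<le>
          ennreal ((norm (a \<xi>))\<^sup>2 / 2 * K (\<xi> - \<eta>) + (norm (a \<eta>))\<^sup>2 / 2 * K (\<xi> - \<eta>))"
        using K0[of "\<xi> - \<eta>"] by (intro ennreal_leI) (simp add: norm_mult distrib_right mult.assoc)
      also have "\<dots> = ennreal ((norm (a \<xi>))\<^sup>2 / 2 * K (\<xi> - \<eta>)) + ennreal ((norm (a \<eta>))\<^sup>2 / 2 * K (\<xi> - \<eta>))"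
        using K0[of "\<xi> - \<eta>"] by (intro ennreal_plus) auto
      finally show "ennreal (norm (a \<xi> * (cnj (a \<eta>) * K (\<xi> - \<eta>)))) \<le>
          ennreal ((norm (a \<xi>))\<^sup>2 / 2 * K (\<xi> - \<eta>)) + ennreal ((norm (a \<eta>))\<^sup>2 / 2 * K (\<xi> - \<eta>))" .
    qed
    finally show "ennreal (norm (a \<xi> * (\<integral>\<eta>. cnj (a \<eta>) * K (\<xi> - \<eta>) \<partial>lborel))) \<le>
      (\<integral>\<^sup>+\<eta>. ennreal ((norm (a \<xi>))\<^sup>2 / 2 * K (\<xi> - \<eta>)) + ennreal ((norm (a \<eta>))\<^sup>2 / 2 * K (\<xi> - \<eta>)) \<partial>lborel)" .
  qed
  also have "\<dots> = (\<integral>\<^sup>+\<xi>. \<integral>\<^sup>+\<eta>. ennreal ((norm (a \<xi>))\<^sup>2 / 2 * K (\<xi> - \<eta>)) \<partial>lborel \<partial>lborel)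
      + (\<integral>\<^sup>+\<xi>. \<integral>\<^sup>+\<eta>. ennreal ((norm (a \<eta>))\<^sup>2 / 2 * K (\<xi> - \<eta>)) \<partial>lborel \<partial>lborel)"
    by (subst nn_integral_add[symmetric]) (auto intro!: nn_integral_cong nn_integral_add)
  also have "(\<integral>\<^sup>+\<xi>. \<integral>\<^sup>+\<eta>. ennreal ((norm (a \<eta>))\<^sup>2 / 2 * K (\<xi> - \<eta>)) \<partial>lborel \<partial>lborel) =
      (\<integral>\<^sup>+\<eta>. \<integral>\<^sup>+\<xi>. ennreal ((norm (a \<eta>))\<^sup>2 / 2 * K (\<xi> - \<eta>)) \<partial>lborel \<partial>lborel)"
    by (rule lborel_pair.Fubini'[symmetric]) measurable
  also have "\<dots> = (\<integral>\<^sup>+\<xi>. \<integral>\<^sup>+\<eta>. ennreal ((norm (a \<xi>))\<^sup>2 / 2 * K (\<xi> - \<eta>)) \<partial>lborel \<partial>lborel)"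
  proof -
    have "K (\<xi> - \<eta>) = K (\<eta> - \<xi>)" for \<xi> \<eta>
      using gss_minus[of "1 / s" "\<eta> - \<xi>"] by (simp add: K_def)
    then show ?thesis by simp
  qed
  also have "(\<integral>\<^sup>+\<xi>. \<integral>\<^sup>+\<eta>. ennreal ((norm (a \<xi>))\<^sup>2 / 2 * K (\<xi> - \<eta>)) \<partial>lborel \<partial>lborel)
      = (\<integral>\<^sup>+\<xi>. ennreal ((norm (a \<xi>))\<^sup>2 / 2) * ennreal ((2 * pi) ^ DIM('a)) \<partial>lborel)"
  proof (rule nn_integral_cong)
    fix \<xi> :: 'a
    have "(\<integral>\<^sup>+\<eta>. ennreal ((norm (a \<xi>))\<^sup>2 / 2 * K (\<xi> - \<eta>)) \<partial>lborel)
        = (\<integral>\<^sup>+\<eta>. ennreal ((norm (a \<xi>))\<^sup>2 / 2) * ennreal (K (\<xi> - \<eta>)) \<partial>lborel)"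
      by (rule nn_integral_cong, rule ennreal_mult) (use K0 in auto)
    also have "\<dots> = ennreal ((norm (a \<xi>))\<^sup>2 / 2) * (\<integral>\<^sup>+\<eta>. ennreal (K (\<xi> - \<eta>)) \<partial>lborel)"
      by (rule nn_integral_cmult) simp
    finally show "(\<integral>\<^sup>+\<eta>. ennreal ((norm (a \<xi>))\<^sup>2 / 2 * K (\<xi> - \<eta>)) \<partial>lborel)
        = ennreal ((norm (a \<xi>))\<^sup>2 / 2) * ennreal ((2 * pi) ^ DIM('a))" unfolding nnK .
  qed
  also have "\<dots> + \<dots> = (\<integral>\<^sup>+\<xi>. ennreal ((2 * pi) ^ DIM('a)) * ennreal ((norm (a \<xi>))\<^sup>2) \<partial>lborel)"
  proof -
    have "ennreal (r / 2) * c + ennreal (r / 2) * c = c * ennreal r" if "r \<ge> 0" for r c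
      using that ennreal_plus[of "r / 2" "r / 2"] by (simp add: mult.commute flip: distrib_left)
    then show ?thesis by (subst nn_integral_add[symmetric]) simp_all
  qed
  also have "\<dots> = ennreal ((2 * pi) ^ DIM('a)) * (\<integral>\<^sup>+\<xi>. ennreal ((norm (a \<xi>))\<^sup>2) \<partial>lborel)"
    by (rule nn_integral_cmult) simp
  finally show ?thesis .
qed

subsection \<open>The Green identity against functions of bounded growth\<close>

lemma measurable_ball_mult:
  fixes f :: "'a::euclidean_space \<Rightarrow> real"
  assumes [measurable]: "f \<in> borel_measurable borel"
  shows "(\<lambda>x. indicator (ball c r) x * f x) \<in> borel_measurable lborel"
proof -
  have "indicat_real (ball c r) \<in> borel_measurable borel"
    by (rule borel_measurable_indicator) simp
  then show ?thesis using assms by simp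
qed

lemma smooth_fun_dilate:
  fixes f :: "'a::euclidean_space \<Rightarrow> real"
  assumes "smooth_fun f"
  shows "smooth_fun (\<lambda>x. f (r *\<^sub>R x))" and "pd b (\<lambda>x. f (r *\<^sub>R x)) = (\<lambda>x. r * pd b f (r *\<^sub>R x))"
proof -
  have d: "\<exists>f'. ((\<lambda>x. c * f (r *\<^sub>R x)) has_derivative (\<lambda>h. c * f' (r *\<^sub>R h))) (at x) \<and> linear f' \<and> (\<forall>b. f' b = pd b f (r *\<^sub>R x))"
    if f: "smooth_fun f" for f :: "'a \<Rightarrow> real" and x c
  proof -
    obtain f' where f': "(f has_derivative f') (at (r *\<^sub>R x))"
      using smooth_fun_differentiable[OF f] unfolding differentiable_def by blast
    have "((\<lambda>x. f (r *\<^sub>R x)) has_derivative (\<lambda>h. f' (r *\<^sub>R h))) (at x)"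
      by (rule has_derivative_compose[of "\<lambda>x. r *\<^sub>R x" "\<lambda>h. r *\<^sub>R h" x UNIV f f'])
        (auto intro!: derivative_eq_intros f')
    then have "((\<lambda>x. c * f (r *\<^sub>R x)) has_derivative (\<lambda>h. c * f' (r *\<^sub>R h))) (at x)"
      by (rule has_derivative_mult_right)
    then show ?thesis using has_derivative_linear[OF f'] pd_eq[OF f'] by metis
  qed
  have p: "pd b (\<lambda>x. c * f (r *\<^sub>R x)) = (\<lambda>x. (c * r) * pd b f (r *\<^sub>R x))"
    if f: "smooth_fun f" for f :: "'a \<Rightarrow> real" and b c
  proof
    fix x
    obtain f' where f': "((\<lambda>x. c * f (r *\<^sub>R x)) has_derivative (\<lambda>h. c * f' (r *\<^sub>R h))) (at x)"
      "linear f'" "\<forall>b. f' b = pd b f (r *\<^sub>R x)" using d[OF f] by blast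
    show "pd b (\<lambda>x. c * f (r *\<^sub>R x)) x = (c * r) * pd b f (r *\<^sub>R x)"
      using pd_eq[OF f'(1), of b] linear_scale[OF f'(2), of r b] f'(3) by simp
  qed
  show "pd b (\<lambda>x. f (r *\<^sub>R x)) = (\<lambda>x. r * pd b f (r *\<^sub>R x))"
    using p[OF assms, of b 1] by simp
  show "smooth_fun (\<lambda>x. f (r *\<^sub>R x))"
  proof (rule smooth_fun_coinduct[where P = "\<lambda>g. \<exists>c f. smooth_fun f \<and> g = (\<lambda>x. c * f (r *\<^sub>R x))"])
    show "\<exists>c fa. smooth_fun fa \<and> (\<lambda>x. f (r *\<^sub>R x)) = (\<lambda>x. c * fa (r *\<^sub>R x))"
      using assms by (intro exI[of _ 1] exI[of _ f]) simp
  next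
    fix g :: "'a \<Rightarrow> real" and x assume "\<exists>c f. smooth_fun f \<and> g = (\<lambda>x. c * f (r *\<^sub>R x))"
    then show "g differentiable at x" using d unfolding differentiable_def by blast
  next
    fix g :: "'a \<Rightarrow> real" and b :: 'a
    assume "\<exists>c f. smooth_fun f \<and> g = (\<lambda>x. c * f (r *\<^sub>R x))" "b \<in> Basis"
    then show "\<exists>c f. smooth_fun f \<and> pd b g = (\<lambda>x. c * f (r *\<^sub>R x))"
      using p smooth_fun_pd by metis
  qed
qed

text \<open>The inequality is strict so that the region is open: \<open>f\<close> then vanishes in a
  neighbourhood of \<open>x\<close> and not just at \<open>x\<close>.\<close>

lemma pd_zero_outside:
  fixes f :: "'a::euclidean_space \<Rightarrow> real"
  assumes "\<And>x. norm x > N \<Longrightarrow> f x = 0" "norm x > N"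
  shows "pd b f x = 0"
proof -
  have "((\<lambda>_. 0) has_derivative (\<lambda>_. 0)) (at x)" by simp
  then have "(f has_derivative (\<lambda>_. 0)) (at x)"
    by (rule has_derivative_transform_within_open[of _ _ _ _ "- cball 0 N"]) (use assms in auto)
  then show ?thesis by (rule pd_eq)
qed

lemma smooth_fun_bounded:
  fixes f :: "'a::euclidean_space \<Rightarrow> real"
  assumes "smooth_fun f" "\<And>x. norm x > N \<Longrightarrow> f x = 0"
  obtains C where "C \<ge> 0" "\<And>x. \<bar>f x\<bar> \<le> C"
proof -
  have "compact (f ` cball 0 N)"
    using assms(1) by (intro compact_continuous_image smooth_fun_continuous) auto
  then obtain C where C: "\<forall>y\<in>f ` cball 0 N. \<bar>y\<bar> \<le> C"
    using compact_imp_bounded bounded_iff real_norm_def by metis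
  have "\<bar>f x\<bar> \<le> max 0 C" for x
    using C assms(2)[of x] by (cases "norm x \<le> N") (auto simp: le_max_iff_disj)
  then show ?thesis using that[of "max 0 C"] by simp
qed

lemma smooth_fun_measurable: "smooth_fun f \<Longrightarrow> f \<in> borel_measurable borel"
  by (intro borel_measurable_continuous_onI smooth_fun_continuous)

text \<open>The value 1 is prescribed at the origin only; by continuity the dilates
  \<open>cutoff ((1 / R) *\<^sub>R x)\<close> still tend to 1 pointwise, which is what dominated
  convergence asks for. The summand 0 puts each factor into the shape of
  \<open>smooth_fun_affine\<close>.\<close>

definition cutoff :: "'a::euclidean_space \<Rightarrow> real" where
  "cutoff x = (\<Prod>b\<in>Basis. bump (x \<bullet> b + 0) * inverse (bump 0))"

lemma smooth_cutoff: "smooth_fun cutoff"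
  unfolding cutoff_def[abs_def]
  by (intro smooth_fun_prod smooth_fun_mult smooth_fun_const smooth_fun_affine smooth_bump) auto

lemma cutoff_0: "cutoff 0 = 1"
  using bump_pos[of 0] by (simp add: cutoff_def)

text \<open>The radius is crude: if every coordinate is below 1 in modulus, the l^1 norm, and hence
  the Euclidean norm, is at most the dimension.\<close>

lemma cutoff_outside: "norm x > DIM('a) \<Longrightarrow> cutoff (x::'a::euclidean_space) = 0"
proof -
  assume x: "norm x > DIM('a)"
  have "\<exists>b\<in>Basis. \<bar>x \<bullet> b\<bar> \<ge> 1"
  proof (rule ccontr)
    assume "\<not> (\<exists>b\<in>Basis. \<bar>x \<bullet> b\<bar> \<ge> 1)"
    then have "(\<Sum>b\<in>Basis. \<bar>x \<bullet> b\<bar>) \<le> (\<Sum>b\<in>(Basis::'a set). 1)" by (intro sum_mono) force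
    then show False using norm_le_l1[of x] x by simp
  qed
  then obtain b where "b \<in> Basis" "bump (x \<bullet> b) = 0" using bump_eq_0 by blast
  then show ?thesis unfolding cutoff_def by (intro prod_zero) auto
qed

section \<open>Mass on balls and the pairing of o(R) with O(R)\<close>

definition mass :: "('a::euclidean_space \<Rightarrow> complex) \<Rightarrow> real \<Rightarrow> real" where
  "mass u R = (\<integral>x. indicator (ball 0 R) x * (norm (u x))\<^sup>2 \<partial>lborel)"

lemma Bstar0_measurable: "u \<in> Bstar0 \<Longrightarrow> u \<in> borel_measurable borel"
  by (simp add: Bstar0_def)

lemma Bstar0_mass:
  assumes "u \<in> Bstar0"
  shows "integrable lborel (\<lambda>x. indicator (ball 0 R) x * (norm (u x))\<^sup>2)"
    and "((\<lambda>R. mass u R / R) \<longlongrightarrow> 0) at_top"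
    and "(\<integral>\<^sup>+ x \<in> ball 0 R. ennreal ((norm (u x))\<^sup>2) \<partial>lborel) = ennreal (mass u R)"
proof -
  have [measurable]: "u \<in> borel_measurable borel" by (rule Bstar0_measurable[OF assms])
  have e: "(\<integral>\<^sup>+ x \<in> ball 0 R. ennreal ((norm (u x))\<^sup>2) \<partial>lborel) =
      (\<integral>\<^sup>+ x. ennreal (indicator (ball 0 R) x * (norm (u x))\<^sup>2) \<partial>lborel)" for R
    by (rule nn_integral_cong) (simp split: split_indicator)
  show i: "integrable lborel (\<lambda>x. indicator (ball 0 R) x * (norm (u x))\<^sup>2)" for R
  proof (rule integrableI_nonneg)
    show "(\<integral>\<^sup>+ x. ennreal (indicator (ball 0 R) x * (norm (u x))\<^sup>2) \<partial>lborel) < \<infinity>"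
      using assms unfolding e[symmetric] by (simp add: Bstar0_def)
    have "(\<lambda>x. (norm (u x))\<^sup>2) \<in> borel_measurable borel" by measurable
    then show "(\<lambda>x. indicator (ball 0 R) x * (norm (u x))\<^sup>2) \<in> borel_measurable lborel"
      by (rule measurable_ball_mult)
    show "AE x in lborel. 0 \<le> indicator (ball 0 R) x * (norm (u x))\<^sup>2"
      by (intro AE_I2 mult_nonneg_nonneg) auto
  qed
  show *: "(\<integral>\<^sup>+ x \<in> ball 0 R. ennreal ((norm (u x))\<^sup>2) \<partial>lborel) = ennreal (mass u R)" for R
    unfolding e mass_def by (rule nn_integral_eq_integral[OF i]) auto
  have "mass u R \<ge> 0" for R unfolding mass_def by simp
  then show "((\<lambda>R. mass u R / R) \<longlongrightarrow> 0) at_top"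
    using assms by (simp add: Bstar0_def *)
qed

lemma mass_nonneg: "mass u R \<ge> 0" unfolding mass_def by simp

text \<open>The partner of \<open>Bstar0\<close>: mass O(R) instead of o(R). Using the extended
  integral makes local square integrability part of the bound.\<close>

definition growth :: "('a::euclidean_space \<Rightarrow> real) \<Rightarrow> bool" where
  "growth w \<longleftrightarrow> w \<in> borel_measurable borel \<and>
     (\<exists>C\<ge>0. \<forall>R\<ge>1. (\<integral>\<^sup>+ x \<in> ball 0 R. ennreal ((w x)\<^sup>2) \<partial>lborel) \<le> ennreal (C * R))"

lemma growth_integrable:
  assumes "growth w"
  obtains C where "C \<ge> 0" "\<And>R. R \<ge> 1 \<Longrightarrow> integrable lborel (\<lambda>x. indicator (ball 0 R) x * (w x)\<^sup>2)"
    "\<And>R. R \<ge> 1 \<Longrightarrow> (\<integral>x. indicator (ball 0 R) x * (w x)\<^sup>2 \<partial>lborel) \<le> C * R"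
proof -
  have [measurable]: "w \<in> borel_measurable borel" using assms by (simp add: growth_def)
  obtain C where C: "C \<ge> 0" "\<And>R. R \<ge> 1 \<Longrightarrow> (\<integral>\<^sup>+ x \<in> ball 0 R. ennreal ((w x)\<^sup>2) \<partial>lborel) \<le> ennreal (C * R)"
    using assms by (auto simp: growth_def)
  have e: "(\<integral>\<^sup>+ x \<in> ball 0 R. ennreal ((w x)\<^sup>2) \<partial>lborel) =
      (\<integral>\<^sup>+ x. ennreal (indicator (ball 0 R) x * (w x)\<^sup>2) \<partial>lborel)" for R
    by (rule nn_integral_cong) (simp split: split_indicator)
  have i: "integrable lborel (\<lambda>x. indicator (ball 0 R) x * (w x)\<^sup>2)" if "R \<ge> 1" for R
  proof (rule integrableI_nonneg)
    show "(\<integral>\<^sup>+ x. ennreal (indicator (ball 0 R) x * (w x)\<^sup>2) \<partial>lborel) < \<infinity>"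
      unfolding e[symmetric] by (rule le_less_trans[OF C(2)[OF that]]) simp
    have "(\<lambda>x. (w x)\<^sup>2) \<in> borel_measurable borel" by measurable
    then show "(\<lambda>x. indicator (ball 0 R) x * (w x)\<^sup>2) \<in> borel_measurable lborel"
      by (rule measurable_ball_mult)
    show "AE x in lborel. 0 \<le> indicator (ball 0 R) x * (w x)\<^sup>2"
      by (intro AE_I2 mult_nonneg_nonneg) auto
  qed
  have "(\<integral>x. indicator (ball 0 R) x * (w x)\<^sup>2 \<partial>lborel) \<le> C * R" if "R \<ge> 1" for R
    using C(2)[OF that] C(1) that unfolding e by (subst (asm) nn_integral_eq_integral[OF i[OF that]]) auto
  then show ?thesis using that C(1) i by blast
qed

text \<open>Cauchy--Schwarz for \<open>f\<close> dominated by the geometric mean of \<open>p\<close> and \<open>q\<close>; the optimal weight is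
  \<open>\<delta> = sqrt ((\<integral>p) / R + 1 / R)\<close>, the second summand only keeps it positive.\<close>

lemma mean_tendsto_0:
  fixes f p q :: "real \<Rightarrow> 'x \<Rightarrow> real"
  assumes f: "\<And>R. R \<ge> 1 \<Longrightarrow> integrable M (f R)" "\<And>R x. 0 \<le> f R x"
    and p: "\<And>R. R \<ge> 1 \<Longrightarrow> integrable M (p R)" "\<And>R x. 0 \<le> p R x"
    and q: "\<And>R. R \<ge> 1 \<Longrightarrow> integrable M (q R)"
    and am: "\<And>\<delta> R x. \<delta> > 0 \<Longrightarrow> f R x \<le> (1 / (2 * \<delta>)) * p R x + (\<delta> / 2) * q R x"
    and lim: "((\<lambda>R. (\<integral>x. p R x \<partial>M) / R) \<longlongrightarrow> 0) at_top"
    and C: "\<And>R. R \<ge> 1 \<Longrightarrow> (\<integral>x. q R x \<partial>M) \<le> C * R"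
  shows "((\<lambda>R. (\<integral>x. f R x \<partial>M) / R) \<longlongrightarrow> 0) at_top"
proof (rule Lim_null_comparison)
  define m where "m = (\<lambda>R. (\<integral>x. p R x \<partial>M) / R)"
  have "((\<lambda>R::real. 1 / R) \<longlongrightarrow> 0) at_top" by real_asymp
  then have "((\<lambda>R. (1 + C) / 2 * sqrt (m R + 1 / R)) \<longlongrightarrow> (1 + C) / 2 * sqrt (0 + 0)) at_top"
    unfolding m_def by (intro tendsto_mult tendsto_const tendsto_real_sqrt tendsto_add lim)
  then show "((\<lambda>R. (1 + C) / 2 * sqrt (m R + 1 / R)) \<longlongrightarrow> 0) at_top" by simp
  show "\<forall>\<^sub>F R in at_top. norm ((\<integral>x. f R x \<partial>M) / R) \<le> (1 + C) / 2 * sqrt (m R + 1 / R)"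
    using eventually_ge_at_top[of "1::real"]
  proof eventually_elim
    case (elim R)
    define \<delta> where "\<delta> = sqrt (m R + 1 / R)"
    have m0: "m R \<ge> 0" using p(2) elim by (simp add: m_def)
    have d: "\<delta> > 0" using m0 elim by (simp add: \<delta>_def add_nonneg_pos)
    have dd: "m R \<le> \<delta> * \<delta>" using m0 elim by (simp add: \<delta>_def)
    have "(\<integral>x. f R x \<partial>M) \<le> (\<integral>x. (1 / (2 * \<delta>)) * p R x + (\<delta> / 2) * q R x \<partial>M)"
      by (intro integral_mono f(1) am d Bochner_Integration.integrable_add integrable_mult_right p(1) q elim)
    also have "\<dots> = (1 / (2 * \<delta>)) * (m R * R) + (\<delta> / 2) * (\<integral>x. q R x \<partial>M)"
      by (subst Bochner_Integration.integral_add) (use p(1)[OF elim] q[OF elim] elim in \<open>auto simp: m_def\<close>)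
    also have "\<dots> \<le> (1 / (2 * \<delta>)) * (m R * R) + (\<delta> / 2) * (C * R)"
      using C[OF elim] d by (intro add_left_mono mult_left_mono) auto
    finally have "(\<integral>x. f R x \<partial>M) / R \<le> (1 / (2 * \<delta>)) * m R + (\<delta> / 2) * C"
      using elim by (simp add: field_simps)
    also have "(1 / (2 * \<delta>)) * m R \<le> (1 / (2 * \<delta>)) * (\<delta> * \<delta>)"
      using dd d by (intro mult_left_mono) auto
    also have "(1 / (2 * \<delta>)) * (\<delta> * \<delta>) + (\<delta> / 2) * C = (1 + C) / 2 * \<delta>"
      using d by (simp add: field_simps)
    finally show ?case using f(2) elim by (simp add: \<delta>_def)
  qed
qed

text \<open>By Cauchy-Schwarz the pairing is at most the square root of o(R) times O(R), hence o(R).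
  The factor \<open>c\<close> leaves room for the support of a dilated cutoff, which is larger than
  the ball of radius R.\<close>

lemma Bstar0_pairing:
  fixes u :: "'a::euclidean_space \<Rightarrow> complex"
  assumes u: "u \<in> Bstar0" and w: "growth w" and c: "c \<ge> 1"
  shows "R \<ge> 1 \<Longrightarrow> integrable lborel (\<lambda>x. indicator (ball 0 (c * R)) x * (norm (u x) * \<bar>w x\<bar>))"
    and "((\<lambda>R. (\<integral>x. indicator (ball 0 (c * R)) x * (norm (u x) * \<bar>w x\<bar>) \<partial>lborel) / R) \<longlongrightarrow> 0) at_top"
proof -
  have [measurable]: "u \<in> borel_measurable borel" by (rule Bstar0_measurable[OF u])
  have [measurable]: "w \<in> borel_measurable borel" using w by (simp add: growth_def)
  obtain C where C: "C \<ge> 0" "\<And>R. R \<ge> 1 \<Longrightarrow> integrable lborel (\<lambda>x. indicator (ball 0 R) x * (w x)\<^sup>2)"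
    "\<And>R. R \<ge> 1 \<Longrightarrow> (\<integral>x. indicator (ball 0 R) x * (w x)\<^sup>2 \<partial>lborel) \<le> C * R"
    by (rule growth_integrable[OF w], rule that)
  have am: "indicator (ball 0 R) x * (norm (u x) * \<bar>w x\<bar>) \<le>
      (1 / (2 * \<delta>)) * (indicator (ball 0 R) x * (norm (u x))\<^sup>2) + (\<delta> / 2) * (indicator (ball 0 R) x * (w x)\<^sup>2)"
    if "\<delta> > 0" for \<delta> R :: real and x :: 'a
  proof -
    have "2 * (norm (u x) * (\<delta> * \<bar>w x\<bar>)) \<le> (norm (u x))\<^sup>2 + (\<delta> * \<bar>w x\<bar>)\<^sup>2"
      using sum_squares_bound[of "norm (u x)" "\<delta> * \<bar>w x\<bar>"] by (simp add: mult.assoc)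
    then show ?thesis using that
      by (auto simp: field_simps power2_eq_square split: split_indicator)
  qed
  have cR: "c * R \<ge> 1" if "R \<ge> 1" for R using c that mult_mono[of 1 c 1 R] by simp
  show i: "integrable lborel (\<lambda>x. indicator (ball 0 (c * R)) x * (norm (u x) * \<bar>w x\<bar>))" if "R \<ge> 1" for R
  proof (rule Bochner_Integration.integrable_bound)
    show "integrable lborel (\<lambda>x. (1 / (2 * 1)) * (indicator (ball 0 (c * R)) x * (norm (u x))\<^sup>2)
         + (1 / 2) * (indicator (ball 0 (c * R)) x * (w x)\<^sup>2))"
      by (intro Bochner_Integration.integrable_add integrable_mult_right Bstar0_mass(1)[OF u] C(2) cR that)
    show "AE x in lborel. norm (indicator (ball 0 (c * R)) x * (norm (u x) * \<bar>w x\<bar>))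
       \<le> norm ((1 / (2 * 1)) * (indicator (ball 0 (c * R)) x * (norm (u x))\<^sup>2)
         + (1 / 2) * (indicator (ball 0 (c * R)) x * (w x)\<^sup>2))"
      using am[of 1] by (intro AE_I2) (auto simp: abs_mult split: split_indicator)
  qed (rule measurable_ball_mult, measurable)
  show "((\<lambda>R. (\<integral>x. indicator (ball 0 (c * R)) x * (norm (u x) * \<bar>w x\<bar>) \<partial>lborel) / R) \<longlongrightarrow> 0) at_top"
  proof (rule mean_tendsto_0[OF i _ Bstar0_mass(1)[OF u] _ _ am])
    have "filterlim (\<lambda>R. c * R) at_top at_top"
      using c by (intro filterlim_tendsto_pos_mult_at_top[OF tendsto_const] filterlim_ident) auto
    from filterlim_compose[OF Bstar0_mass(2)[OF u] this]
    have "((\<lambda>R. c * (mass u (c * R) / (c * R))) \<longlongrightarrow> c * 0) at_top" by (intro tendsto_mult tendsto_const)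
    then show "((\<lambda>R. (\<integral>x. indicator (ball 0 (c * R)) x * (norm (u x))\<^sup>2 \<partial>lborel) / R) \<longlongrightarrow> 0) at_top"
      using c by (simp add: mass_def)
    show "(\<integral>x. indicator (ball 0 (c * R)) x * (w x)\<^sup>2 \<partial>lborel) \<le> C * c * R" if "R \<ge> 1" for R
      using C(3)[OF cR[OF that]] by (simp add: mult.assoc)
  qed (use C(2) cR in auto)
qed

text \<open>Local square integrability gives local integrability through |u| \<le> 1 +
  |u|^2.\<close>

lemma Bstar0_integrable_compact:
  fixes u :: "'a::euclidean_space \<Rightarrow> complex" and \<phi> :: "'a \<Rightarrow> real"
  assumes u: "u \<in> Bstar0" and [measurable]: "\<phi> \<in> borel_measurable borel"
    and C: "\<And>x. \<bar>\<phi> x\<bar> \<le> C" and N: "\<And>x. norm x > N \<Longrightarrow> \<phi> x = 0"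
  shows "integrable lborel (\<lambda>x. u x * complex_of_real (\<phi> x))"
proof (rule Bochner_Integration.integrable_bound)
  have [measurable]: "u \<in> borel_measurable borel" by (rule Bstar0_measurable[OF u])
  show "(\<lambda>x. u x * complex_of_real (\<phi> x)) \<in> borel_measurable lborel" by measurable
  have "integrable lborel (\<lambda>x::'a. indicat_real (ball 0 (N + 1)) x)"
    by (rule integrable_real_indicator) (use emeasure_bounded_finite[OF bounded_ball] in auto)
  then show "integrable lborel (\<lambda>x. C * (indicator (ball 0 (N + 1)) x + indicator (ball 0 (N + 1)) x * (norm (u x))\<^sup>2))"
    by (intro integrable_mult_right Bochner_Integration.integrable_add Bstar0_mass(1)[OF u])
  show "AE x in lborel. norm (u x * complex_of_real (\<phi> x)) \<le>
      norm (C * (indicator (ball 0 (N + 1)) x + indicator (ball 0 (N + 1)) x * (norm (u x))\<^sup>2))"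
  proof (rule AE_I2)
    fix x
    have C0: "C \<ge> 0" using C[of x] by linarith
    show "norm (u x * complex_of_real (\<phi> x)) \<le>
      norm (C * (indicator (ball 0 (N + 1)) x + indicator (ball 0 (N + 1)) x * (norm (u x))\<^sup>2))"
    proof (cases "norm x \<le> N")
      case True
      have "norm (u x) \<le> 1 + (norm (u x))\<^sup>2"
      proof -
        have "2 * norm (u x) \<le> (norm (u x))\<^sup>2 + 1" using sum_squares_bound[of "norm (u x)" 1] by simp
        then show ?thesis using norm_ge_zero[of "u x"] by linarith
      qed
      then have "norm (u x) * \<bar>\<phi> x\<bar> \<le> (1 + (norm (u x))\<^sup>2) * C" using C[of x] by (intro mult_mono) auto
      then show ?thesis using True C0 by (simp add: norm_mult mult.commute abs_mult)
    next
      case False then show ?thesis using N[of x] by simp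
    qed
  qed
qed

text \<open>Two integrations by parts, which is what \<open>weak_deriv\<close> provides, move the
  Laplacian from \<phi> to \<open>u\<close>, where the equation holds almost everywhere.\<close>

lemma helmholtz_weak:
  fixes u F :: "'a::euclidean_space \<Rightarrow> complex"
  assumes u: "u \<in> Bstar0" and D2: "\<And>b. b \<in> Basis \<Longrightarrow> D2 b b \<in> Bstar0"
    and weak: "\<And>b. b \<in> Basis \<Longrightarrow> weak_deriv [b, b] u (D2 b b)"
    and eq: "AE x in lborel. - (\<Sum>b\<in>Basis. D2 b b x) - complex_of_real lam * u x = F x"
    and F[measurable]: "F \<in> borel_measurable borel"
    and \<phi>: "smooth_fun \<phi>" and supp: "\<And>x. norm x > N \<Longrightarrow> \<phi> x = 0"
  shows "(\<integral>x. u x * complex_of_real ((\<Sum>b\<in>Basis. pds [b, b] \<phi> x) + lam * \<phi> x) \<partial>lborel)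
    = - (\<integral>x. F x * complex_of_real (\<phi> x) \<partial>lborel)"
proof -
  have [measurable]: "u \<in> borel_measurable borel" by (rule Bstar0_measurable[OF u])
  have [measurable]: "D2 b b \<in> borel_measurable borel" if "b \<in> Basis" for b
    by (rule Bstar0_measurable[OF D2[OF that]])
  have [measurable]: "\<phi> \<in> borel_measurable borel" by (rule smooth_fun_measurable[OF \<phi>])
  have "bounded {x. \<phi> x \<noteq> 0}"
    by (rule bounded_subset[OF bounded_cball[of 0 N]]) (use supp in force)
  then have test: "test_fun \<phi>"
    using \<phi> by (simp add: test_fun_def smooth_fun_def compact_closure)
  have int: "integrable lborel (\<lambda>x. g x * complex_of_real (\<sigma> x))"
    if g: "g \<in> Bstar0" and s: "smooth_fun \<sigma>" "\<And>x. norm x > N \<Longrightarrow> \<sigma> x = 0" for g \<sigma>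
  proof -
    obtain C where "\<And>x. \<bar>\<sigma> x\<bar> \<le> C" using smooth_fun_bounded[OF s(1), of N] s(2) by metis
    then show ?thesis by (rule Bstar0_integrable_compact[OF g smooth_fun_measurable[OF s(1)] _ s(2)])
  qed
  have s2: "smooth_fun (pds [b, b] \<phi>)" if "b \<in> Basis" for b
    using that by (simp add: smooth_fun_pd \<phi>)
  have z2: "pds [b, b] \<phi> x = 0" if "norm x > N" for b x
    using that by (simp add: pd_zero_outside[of N] supp)
  have iu: "integrable lborel (\<lambda>x. u x * complex_of_real (pds [b, b] \<phi> x))" if "b \<in> Basis" for b
    by (rule int[OF u s2[OF that] z2])
  have iD: "integrable lborel (\<lambda>x. D2 b b x * complex_of_real (\<phi> x))" if "b \<in> Basis" for b
    by (rule int[OF D2[OF that] \<phi> supp])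
  have i0: "integrable lborel (\<lambda>x. u x * complex_of_real (\<phi> x))" by (rule int[OF u \<phi> supp])
  have w: "(\<integral>x. u x * complex_of_real (pds [b, b] \<phi> x) \<partial>lborel) = (\<integral>x. D2 b b x * complex_of_real (\<phi> x) \<partial>lborel)"
    if "b \<in> Basis" for b
    using weak[OF that] test unfolding weak_deriv_def by (simp del: pds.simps)
  have "(\<integral>x. u x * complex_of_real ((\<Sum>b\<in>Basis. pds [b, b] \<phi> x) + lam * \<phi> x) \<partial>lborel)
    = (\<integral>x. (\<Sum>b\<in>Basis. u x * complex_of_real (pds [b, b] \<phi> x)) + lam * (u x * complex_of_real (\<phi> x)) \<partial>lborel)"
    by (simp add: distrib_left sum_distrib_left mult.left_commute del: pds.simps)
  also have "\<dots> = (\<Sum>b\<in>Basis. \<integral>x. u x * complex_of_real (pds [b, b] \<phi> x) \<partial>lborel)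
      + (\<integral>x. lam * (u x * complex_of_real (\<phi> x)) \<partial>lborel)"
    by (subst Bochner_Integration.integral_add)
      (use iu i0 in \<open>simp_all add: Bochner_Integration.integral_sum del: pds.simps\<close>)
  also have "\<dots> = (\<Sum>b\<in>Basis. \<integral>x. D2 b b x * complex_of_real (\<phi> x) \<partial>lborel)
      + (\<integral>x. lam * (u x * complex_of_real (\<phi> x)) \<partial>lborel)"
    by (simp add: w del: pds.simps)
  also have "\<dots> = (\<integral>x. (\<Sum>b\<in>Basis. D2 b b x * complex_of_real (\<phi> x)) + lam * (u x * complex_of_real (\<phi> x)) \<partial>lborel)"
    by (subst Bochner_Integration.integral_add)
      (use iD i0 in \<open>simp_all add: Bochner_Integration.integral_sum\<close>)
  also have "\<dots> = (\<integral>x. - (F x * complex_of_real (\<phi> x)) \<partial>lborel)"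
  proof (rule integral_cong_AE)
    show "AE x in lborel. (\<Sum>b\<in>Basis. D2 b b x * complex_of_real (\<phi> x)) + lam * (u x * complex_of_real (\<phi> x))
        = - (F x * complex_of_real (\<phi> x))"
      using eq
    proof eventually_elim
      case (elim x)
      have "(\<Sum>b\<in>Basis. D2 b b x * complex_of_real (\<phi> x)) = (\<Sum>b\<in>Basis. D2 b b x) * complex_of_real (\<phi> x)"
        by (rule sum_distrib_right[symmetric])
      then show ?case unfolding elim[symmetric] by (simp add: algebra_simps)
    qed
  qed measurable
  finally show ?thesis by simp
qed

text \<open>Test the equation with \<open>ch R\<close> times \<open>v\<close> and let R tend to
  infinity. The commutator of the Laplacian with the cutoff consists of R^{-2} v and R^{-1} times
  first derivatives of \<open>v\<close>, on a ball of radius comparable to R. Paired with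
  \<open>u\<close> this is o(R)/R and disappears.\<close>

lemma green_identity:
  fixes u F :: "'a::euclidean_space \<Rightarrow> complex" and v \<psi> :: "'a \<Rightarrow> real"
  assumes u: "u \<in> Bstar0" and D2: "\<And>b. b \<in> Basis \<Longrightarrow> D2 b b \<in> Bstar0"
    and weak: "\<And>b. b \<in> Basis \<Longrightarrow> weak_deriv [b, b] u (D2 b b)"
    and eq: "AE x in lborel. - (\<Sum>b\<in>Basis. D2 b b x) - complex_of_real lam * u x = F x"
    and F: "integrable lborel F"
    and v: "smooth_fun v" and Cv: "\<And>x. \<bar>v x\<bar> \<le> Cv"
    and gv: "growth v" and gdv: "\<And>b. b \<in> Basis \<Longrightarrow> growth (pd b v)"
    and \<psi>: "\<And>x. - (\<Sum>b\<in>Basis. pds [b, b] v x) - lam * v x = \<psi> x"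
    and u\<psi>: "integrable lborel (\<lambda>x. u x * complex_of_real (\<psi> x))"
  shows "(\<integral>x. u x * complex_of_real (\<psi> x) \<partial>lborel) = (\<integral>x. F x * complex_of_real (v x) \<partial>lborel)"
proof -
  have [measurable]: "u \<in> borel_measurable borel" by (rule Bstar0_measurable[OF u])
  have Fm[measurable]: "F \<in> borel_measurable borel" using F by auto
  have [measurable]: "v \<in> borel_measurable borel" by (rule smooth_fun_measurable[OF v])
  define ch where "ch = (\<lambda>(R::real) (x::'a). cutoff ((1 / R) *\<^sub>R x))"
  have c: "smooth_fun (ch R)" for R unfolding ch_def by (rule smooth_fun_dilate(1)[OF smooth_cutoff])
  have [measurable]: "ch R \<in> borel_measurable borel" for R by (rule smooth_fun_measurable[OF c])
  have p1: "pd b (ch R) = (\<lambda>x. (1 / R) * pd b cutoff ((1 / R) *\<^sub>R x))" for R b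
    unfolding ch_def by (rule smooth_fun_dilate(2)[OF smooth_cutoff])
  have sd: "smooth_fun (pd b cutoff)" if "b \<in> Basis" for b :: 'a by (rule smooth_fun_pd[OF smooth_cutoff that])
  have p2: "pd b (pd b (ch R)) x = (1 / R)\<^sup>2 * pd b (pd b cutoff) ((1 / R) *\<^sub>R x)" if b: "b \<in> Basis" for R b x
  proof -
    have "pd b (\<lambda>x. (1 / R) * pd b cutoff ((1 / R) *\<^sub>R x)) x = 
       pd b (\<lambda>_. 1 / R) x * pd b cutoff ((1 / R) *\<^sub>R x) + (1 / R) * pd b (\<lambda>x. pd b cutoff ((1 / R) *\<^sub>R x)) x"
      by (rule pd_mult) (auto intro: smooth_fun_differentiable smooth_fun_dilate(1)[OF sd[OF b]])
    then show ?thesis unfolding p1 smooth_fun_dilate(2)[OF sd[OF b]]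
      by (simp add: pd_def power2_eq_square)
  qed
  obtain K0 where K0: "\<And>x::'a. \<bar>cutoff x\<bar> \<le> K0"
    using smooth_fun_bounded[OF smooth_cutoff cutoff_outside] by metis
  have "\<forall>b\<in>(Basis::'a set). \<exists>K\<ge>0. \<forall>x. \<bar>pd b cutoff x\<bar> \<le> K \<and> \<bar>pd b (pd b cutoff) x\<bar> \<le> K"
  proof
    fix b :: 'a assume b: "b \<in> Basis"
    have z1: "pd b cutoff x = 0" if "norm x > DIM('a)" for x :: 'a
      using that by (simp add: pd_zero_outside[of "DIM('a)"] cutoff_outside)
    have z2: "pd b (pd b cutoff) x = 0" if "norm x > DIM('a)" for x :: 'a
      using that by (simp add: pd_zero_outside[of "DIM('a)"] z1)
    obtain K1 where K1: "K1 \<ge> 0" "\<And>x. \<bar>pd b cutoff x\<bar> \<le> K1"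
      using smooth_fun_bounded[OF sd[OF b] z1] by metis
    obtain K2 where K2: "K2 \<ge> 0" "\<And>x. \<bar>pd b (pd b cutoff) x\<bar> \<le> K2"
      using smooth_fun_bounded[OF smooth_fun_pd[OF sd[OF b] b] z2] by metis
    show "\<exists>K\<ge>0. \<forall>x. \<bar>pd b cutoff x\<bar> \<le> K \<and> \<bar>pd b (pd b cutoff) x\<bar> \<le> K"
      using K1 K2 by (intro exI[of _ "max K1 K2"]) (auto simp: le_max_iff_disj)
  qed
  from bchoice[OF this] obtain K where
    K': "\<forall>b\<in>(Basis::'a set). 0 \<le> K b \<and> (\<forall>x. \<bar>pd b cutoff x\<bar> \<le> K b \<and> \<bar>pd b (pd b cutoff) x\<bar> \<le> K b)"
    by blast
  then have K: "K b \<ge> 0" "\<bar>pd b cutoff x\<bar> \<le> K b" "\<bar>pd b (pd b cutoff) x\<bar> \<le> K b" if "b \<in> Basis" for b x :: 'a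
    using that by blast+
  have supp: "ch R x = 0" if "R \<ge> 1" "norm x > DIM('a) * R" for R :: real and x
    unfolding ch_def by (rule cutoff_outside) (use that in \<open>simp add: field_simps\<close>)
  have supp1: "pd b (ch R) x = 0" if "R \<ge> 1" "norm x > DIM('a) * R" for R :: real and b x
    using that by (simp add: pd_zero_outside[of "DIM('a) * R"] supp)
  have supp2: "pd b (pd b (ch R)) x = 0" if "R \<ge> 1" "norm x > DIM('a) * R" for R :: real and b x
    using that by (simp add: pd_zero_outside[of "DIM('a) * R"] supp1)
  \<comment> \<open>The commutator of the Laplacian with \<open>ch R\<close>, applied to
    \<open>v\<close>.\<close>
  define E where "E = (\<lambda>R x. \<Sum>b\<in>Basis. pd b (pd b (ch R)) x * v x + 2 * pd b (ch R) x * pd b v x)"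
  have dv: "smooth_fun (pd b v)" if "b \<in> Basis" for b by (rule smooth_fun_pd[OF v that])
  have dc: "smooth_fun (pd b (ch R))" if "b \<in> Basis" for b R by (rule smooth_fun_pd[OF c that])
  have Em[measurable]: "E R \<in> borel_measurable borel" for R
    unfolding E_def
    by (intro borel_measurable_sum borel_measurable_add borel_measurable_times borel_measurable_const
        smooth_fun_measurable v dv smooth_fun_pd dc) auto
  have \<psi>m[measurable]: "\<psi> \<in> borel_measurable borel"
  proof -
    have "(\<lambda>x. - (\<Sum>b\<in>Basis. pds [b, b] v x) - lam * v x) \<in> borel_measurable borel"
      by (intro borel_measurable_diff borel_measurable_uminus borel_measurable_sum borel_measurable_times
          borel_measurable_const smooth_fun_measurable v) (auto intro: smooth_fun_pd v)
    then show ?thesis by (simp only: \<psi>)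
  qed
  have lap: "(\<Sum>b\<in>Basis. pds [b, b] (\<lambda>x. ch R x * v x) x) + lam * (ch R x * v x) = E R x - ch R x * \<psi> x" for R x
  proof -
    have "pds [b, b] (\<lambda>x. ch R x * v x) x = pd b (pd b (ch R)) x * v x + 2 * pd b (ch R) x * pd b v x + ch R x * pds [b, b] v x"
      if b: "b \<in> Basis" for b
    proof -
      have "pd b (\<lambda>x. ch R x * v x) = (\<lambda>x. pd b (ch R) x * v x + ch R x * pd b v x)"
        by (rule ext, rule pd_mult) (auto intro: smooth_fun_differentiable c v)
      moreover have "pd b (\<lambda>x. pd b (ch R) x * v x + ch R x * pd b v x) x =
          pd b (\<lambda>x. pd b (ch R) x * v x) x + pd b (\<lambda>x. ch R x * pd b v x) x"
        by (rule pd_add) (auto intro!: smooth_fun_differentiable smooth_fun_mult c v dv[OF b] dc[OF b])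
      moreover have "pd b (\<lambda>x. pd b (ch R) x * v x) x = pd b (pd b (ch R)) x * v x + pd b (ch R) x * pd b v x"
        by (rule pd_mult) (auto intro: smooth_fun_differentiable v dc[OF b])
      moreover have "pd b (\<lambda>x. ch R x * pd b v x) x = pd b (ch R) x * pd b v x + ch R x * pd b (pd b v) x"
        by (rule pd_mult) (auto intro: smooth_fun_differentiable c dv[OF b])
      ultimately show ?thesis by simp
    qed
    then have "(\<Sum>b\<in>Basis. pds [b, b] (\<lambda>x. ch R x * v x) x) = E R x + ch R x * (\<Sum>b\<in>Basis. pds [b, b] v x)"
      by (simp add: E_def sum.distrib sum_distrib_left del: pds.simps)
    then show ?thesis unfolding \<psi>[symmetric] by (simp add: algebra_simps del: pds.simps)
  qed
  have cb: "\<bar>ch R x\<bar> \<le> K0" for R x unfolding ch_def by (rule K0)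
  have K00: "K0 \<ge> 0" using K0[of 0] by linarith
  have iuc: "integrable lborel (\<lambda>x. u x * complex_of_real (ch R x * \<psi> x))" for R
    by (rule Bochner_Integration.integrable_bound[OF integrable_mult_right[OF u\<psi>, of K0]])
      (use cb[of R] K00 in \<open>auto intro!: AE_I2 mult_right_mono simp: norm_mult mult.left_commute[of _ "\<bar>ch R _\<bar>"]\<close>)
  have lim1: "((\<lambda>R. \<integral>x. u x * complex_of_real (ch R x * \<psi> x) \<partial>lborel) \<longlongrightarrow> (\<integral>x. u x * complex_of_real (\<psi> x) \<partial>lborel)) at_top"
    and lim2: "((\<lambda>R. \<integral>x. F x * complex_of_real (ch R x * v x) \<partial>lborel) \<longlongrightarrow> (\<integral>x. F x * complex_of_real (v x) \<partial>lborel)) at_top"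
  proof -
    have ct: "((\<lambda>R. ch R x) \<longlongrightarrow> 1) at_top" for x
    proof -
      have "((\<lambda>R::real. (1 / R) *\<^sub>R x) \<longlongrightarrow> 0 *\<^sub>R x) at_top"
        by (intro tendsto_scaleR tendsto_const) real_asymp
      moreover have "isCont (cutoff :: 'a \<Rightarrow> real) 0"
        by (rule differentiable_imp_continuous_within[OF smooth_fun_differentiable[OF smooth_cutoff]])
      ultimately show ?thesis
        unfolding ch_def using isCont_tendsto_compose[of 0 "cutoff :: 'a \<Rightarrow> real"] cutoff_0[where 'a = 'a] by force
    qed
    have gen: "((\<lambda>R. \<integral>x. g x * complex_of_real (ch R x * w x) \<partial>lborel) \<longlongrightarrow> (\<integral>x. g x * complex_of_real (w x) \<partial>lborel)) at_top"
      if i: "integrable lborel (\<lambda>x. g x * complex_of_real (w x))"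
        and [measurable]: "g \<in> borel_measurable borel" "w \<in> borel_measurable borel" for g w
    proof (rule integral_dominated_convergence_at_top[where w = "\<lambda>x. K0 * norm (g x * complex_of_real (w x))"])
      show "integrable lborel (\<lambda>x. K0 * norm (g x * complex_of_real (w x)))"
        using i by (intro integrable_mult_right integrable_norm)
      show "\<forall>\<^sub>F R in at_top. AE x in lborel. norm (g x * complex_of_real (ch R x * w x)) \<le> K0 * norm (g x * complex_of_real (w x))"
        using cb by (intro always_eventually allI AE_I2)
          (auto simp: norm_mult abs_mult mult.left_commute[of _ "\<bar>ch _ _\<bar>"] intro!: mult_right_mono)
      have "((\<lambda>R. g x * complex_of_real (ch R x * w x)) \<longlongrightarrow> g x * complex_of_real (1 * w x)) at_top" for x
        by (intro tendsto_mult tendsto_const tendsto_of_real ct)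
      then show "AE x in lborel. ((\<lambda>R. g x * complex_of_real (ch R x * w x)) \<longlongrightarrow> g x * complex_of_real (w x)) at_top"
        by simp
    qed measurable
    show "((\<lambda>R. \<integral>x. u x * complex_of_real (ch R x * \<psi> x) \<partial>lborel) \<longlongrightarrow> (\<integral>x. u x * complex_of_real (\<psi> x) \<partial>lborel)) at_top"
      by (rule gen[OF u\<psi>]) auto
    have "integrable lborel (\<lambda>x. F x * complex_of_real (v x))"
      by (rule Bochner_Integration.integrable_bound[OF integrable_mult_right[OF F, of Cv]])
        (use Cv in \<open>auto intro!: AE_I2 simp: norm_mult mult.commute[of "norm (F _)"] intro!: mult_right_mono order_trans[OF Cv]\<close>)
    then show "((\<lambda>R. \<integral>x. F x * complex_of_real (ch R x * v x) \<partial>lborel) \<longlongrightarrow> (\<integral>x. F x * complex_of_real (v x) \<partial>lborel)) at_top"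
      by (rule gen) auto
  qed
  define P where "P = (\<lambda>w R. (\<integral>x. indicator (ball 0 (real (DIM('a) + 1) * R)) x * (norm (u x) * \<bar>w x\<bar>) \<partial>lborel))"
  have Ebd: "norm (u x * complex_of_real (E R x)) \<le>
     (\<Sum>b\<in>Basis. (2 * K b / R) * (indicator (ball 0 (real (DIM('a) + 1) * R)) x * (norm (u x) * \<bar>v x\<bar>)
        + indicator (ball 0 (real (DIM('a) + 1) * R)) x * (norm (u x) * \<bar>pd b v x\<bar>)))" if R: "R \<ge> 1" for R x
  proof (cases "norm x > DIM('a) * R")
    case True
    then have "E R x = 0" using R by (simp add: E_def supp1 supp2)
    then show ?thesis using R K(1) by (auto intro!: sum_nonneg)
  next
    case False
    \<comment> \<open>One extra R turns the weak inequality into the strict one required by an open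
      ball.\<close>
    then have "norm x < real (DIM('a) + 1) * R" using R by (simp add: algebra_simps)
    then have ind: "indicator (ball 0 (real (DIM('a) + 1) * R)) x = (1::real)" by simp
    have "\<bar>E R x\<bar> \<le> (\<Sum>b\<in>Basis. (2 * K b / R) * (\<bar>v x\<bar> + \<bar>pd b v x\<bar>))"
      unfolding E_def
    proof (rule order_trans[OF sum_abs], rule sum_mono)
      fix b :: 'a assume b: "b \<in> Basis"
      have a1: "\<bar>pd b (ch R) x\<bar> \<le> K b / R"
        using R K(2)[OF b, of "(1 / R) *\<^sub>R x"] by (simp add: p1 abs_mult divide_right_mono)
      have "\<bar>pd b (pd b (ch R)) x\<bar> \<le> (1 / R)\<^sup>2 * K b"
        unfolding p2[OF b] abs_mult using K(3)[OF b] by (auto intro!: mult_mono)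
      \<comment> \<open>As R \<ge> 1, the term of order R^{-2} may be weakened to R^{-1}, so both
        error terms are treated alike.\<close>
      also have "\<dots> \<le> (1 / R) * K b"
        using R K(1)[OF b] by (intro mult_right_mono) (simp_all add: power2_eq_square field_simps)
      finally have a2: "\<bar>pd b (pd b (ch R)) x\<bar> \<le> 2 * (K b / R)"
        using R K(1)[OF b] by simp
      have "\<bar>pd b (pd b (ch R)) x * v x + 2 * pd b (ch R) x * pd b v x\<bar>
         \<le> \<bar>pd b (pd b (ch R)) x\<bar> * \<bar>v x\<bar> + 2 * \<bar>pd b (ch R) x\<bar> * \<bar>pd b v x\<bar>"
        by (rule order_trans[OF abs_triangle_ineq]) (simp add: abs_mult)
      also have "\<dots> \<le> 2 * (K b / R) * \<bar>v x\<bar> + 2 * (K b / R) * \<bar>pd b v x\<bar>"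
        using a1 a2 by (intro add_mono mult_right_mono) auto
      finally show "\<bar>pd b (pd b (ch R)) x * v x + 2 * pd b (ch R) x * pd b v x\<bar> \<le> (2 * K b / R) * (\<bar>v x\<bar> + \<bar>pd b v x\<bar>)"
        by (simp add: distrib_left)
    qed
    then have "norm (u x) * \<bar>E R x\<bar> \<le> norm (u x) * (\<Sum>b\<in>Basis. (2 * K b / R) * (\<bar>v x\<bar> + \<bar>pd b v x\<bar>))"
      by (rule mult_left_mono) simp
    then show ?thesis unfolding ind by (simp add: norm_mult sum_distrib_left algebra_simps)
  qed
  have c1: "real (DIM('a) + 1) \<ge> 1" by simp
  note pair = Bstar0_pairing[OF u _ c1]
  have ibd: "integrable lborel (\<lambda>x. \<Sum>b\<in>Basis. (2 * K b / R) * (indicator (ball 0 (real (DIM('a) + 1) * R)) x * (norm (u x) * \<bar>v x\<bar>)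
        + indicator (ball 0 (real (DIM('a) + 1) * R)) x * (norm (u x) * \<bar>pd b v x\<bar>)))" if "R \<ge> 1" for R
    by (intro Bochner_Integration.integrable_sum integrable_mult_right Bochner_Integration.integrable_add pair(1) gv gdv that)
  have iE: "integrable lborel (\<lambda>x. u x * complex_of_real (E R x))" if "R \<ge> 1" for R
    by (rule Bochner_Integration.integrable_bound[OF ibd[OF that]])
      (use Ebd[OF that] in \<open>auto intro!: AE_I2 intro: order_trans[OF _ abs_ge_self]\<close>)
  have lim3: "((\<lambda>R. \<integral>x. u x * complex_of_real (E R x) \<partial>lborel) \<longlongrightarrow> 0) at_top"
  proof (rule Lim_null_comparison)
    show "\<forall>\<^sub>F R in at_top. norm (\<integral>x. u x * complex_of_real (E R x) \<partial>lborel) \<le>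
       (\<Sum>b\<in>Basis. 2 * K b * (P v R / R + P (pd b v) R / R))"
      using eventually_ge_at_top[of "1::real"]
    proof eventually_elim
      case (elim R)
      have "norm (\<integral>x. u x * complex_of_real (E R x) \<partial>lborel) \<le>
        (\<integral>x. (\<Sum>b\<in>Basis. (2 * K b / R) * (indicator (ball 0 (real (DIM('a) + 1) * R)) x * (norm (u x) * \<bar>v x\<bar>)
        + indicator (ball 0 (real (DIM('a) + 1) * R)) x * (norm (u x) * \<bar>pd b v x\<bar>))) \<partial>lborel)"
        by (rule norm_integral_le[OF ibd[OF elim] Ebd[OF elim]])
      also have "\<dots> = (\<Sum>b\<in>Basis. (2 * K b / R) * (P v R + P (pd b v) R))"
        unfolding P_def using pair(1)[OF gv elim] pair(1)[OF gdv elim] 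
        by (subst Bochner_Integration.integral_sum) (auto intro!: sum.cong simp: Bochner_Integration.integral_add)
      also have "\<dots> = (\<Sum>b\<in>Basis. 2 * K b * (P v R / R + P (pd b v) R / R))"
        by (intro sum.cong) (auto simp: add_divide_distrib distrib_left)
      finally show ?case .
    qed
    have "((\<lambda>R. \<Sum>b\<in>Basis. 2 * K b * (P v R / R + P (pd b v) R / R)) \<longlongrightarrow> (\<Sum>b\<in>(Basis::'a set). 2 * K b * (0 + 0))) at_top"
      unfolding P_def by (intro tendsto_sum tendsto_mult tendsto_const tendsto_add pair(2) gv gdv)
    then show "((\<lambda>R. \<Sum>b\<in>Basis. 2 * K b * (P v R / R + P (pd b v) R / R)) \<longlongrightarrow> 0) at_top" by simp
  qed
  have "\<forall>\<^sub>F R in at_top. (\<integral>x. F x * complex_of_real (ch R x * v x) \<partial>lborel) =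
     (\<integral>x. u x * complex_of_real (ch R x * \<psi> x) \<partial>lborel) - (\<integral>x. u x * complex_of_real (E R x) \<partial>lborel)"
    using eventually_ge_at_top[of "1::real"]
  proof eventually_elim
    case (elim R)
    have "(\<integral>x. u x * complex_of_real (E R x - ch R x * \<psi> x) \<partial>lborel) = - (\<integral>x. F x * complex_of_real (ch R x * v x) \<partial>lborel)"
      unfolding lap[symmetric]
      by (rule helmholtz_weak[where ?D2.0 = D2 and N = "DIM('a) * R"])
        (use u D2 weak eq Fm smooth_fun_mult[OF c v] supp[OF elim] in auto)
    moreover have "(\<integral>x. u x * complex_of_real (E R x - ch R x * \<psi> x) \<partial>lborel) =
       (\<integral>x. u x * complex_of_real (E R x) \<partial>lborel) - (\<integral>x. u x * complex_of_real (ch R x * \<psi> x) \<partial>lborel)"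
      using iE[OF elim] iuc[of R] by (simp add: right_diff_distrib)
    ultimately show ?case by (simp add: algebra_simps)
  qed
  then have "((\<lambda>R. \<integral>x. F x * complex_of_real (ch R x * v x) \<partial>lborel) \<longlongrightarrow>
     (\<integral>x. u x * complex_of_real (\<psi> x) \<partial>lborel) - 0) at_top"
    using tendsto_diff[OF lim1 lim3] by (subst tendsto_cong) auto
  with lim2 show ?thesis using tendsto_unique[OF _ lim2] by fastforce
qed

section \<open>Superpositions of plane waves as admissible test functions\<close>

lemma slice_growth:
  fixes V :: "'a::euclidean_space \<times> real \<Rightarrow> complex"
  assumes V[measurable]: "V \<in> borel_measurable borel"
    and A: "\<And>t. integrable lborel (A t)"
    and VA: "\<And>y t. V (y, t) = (\<integral>\<xi>. A t \<xi> * iexp (y \<bullet> \<xi>) \<partial>lborel)"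
    and C0: "\<And>t. (\<integral>\<^sup>+\<xi>. ennreal ((norm (A t \<xi>))\<^sup>2) \<partial>lborel) \<le> ennreal C" and C: "C \<ge> 0"
    and w: "w \<in> borel_measurable borel" "\<And>x. \<bar>w x\<bar> \<le> norm (V x)"
  shows "growth w"
proof -
  \<comment> \<open>For s = 1/R^2 the Gaussian weight is at least exp(-1/2) on the ball of radius R,
    and exp(1/2) undoes this loss. The remaining factor is the Bessel bound of one slice;
    integrating over -R \<le> t \<le> R supplies 2 R.\<close>
  define K where "K = exp (1 / 2) * ((2 * pi) ^ DIM('a) * C)"
  have K: "K \<ge> 0" using C by (simp add: K_def)
  have "(\<integral>\<^sup>+ x \<in> ball 0 R. ennreal ((w x)\<^sup>2) \<partial>lborel) \<le> ennreal (2 * K * R)" if R: "R \<ge> 1" for R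
  proof -
    let ?h = "\<lambda>p::'a \<times> real. (ennreal (exp (1 / 2)) * ennreal (gss (1 / R\<^sup>2) (fst p) * (norm (V p))\<^sup>2)) * indicator {-R..R} (snd p)"
    have [measurable]: "V \<in> borel_measurable (lborel \<Otimes>\<^sub>M lborel)"
      using V by (simp add: lborel_prod)
    have "(\<integral>\<^sup>+ x \<in> ball 0 R. ennreal ((w x)\<^sup>2) \<partial>lborel) \<le> (\<integral>\<^sup>+ p. ?h p \<partial>(lborel :: ('a \<times> real) measure))"
    proof (rule nn_integral_mono)
      fix p :: "'a \<times> real"
      show "ennreal ((w p)\<^sup>2) * indicator (ball 0 R) p \<le> ?h p"
      proof (cases "norm p < R")
        case True
        have "norm (fst p) \<le> R" "\<bar>snd p\<bar> \<le> R"
          using True norm_fst_le[of "fst p" "snd p"] norm_snd_le[of "snd p" "fst p"] by auto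
        then have "(norm (fst p))\<^sup>2 \<le> R\<^sup>2" by (intro power_mono) auto
        then have "1 / R\<^sup>2 * (norm (fst p))\<^sup>2 / 2 \<le> 1 / 2" using R by (simp add: field_simps)
        then have "exp (1 / 2) * gss (1 / R\<^sup>2) (fst p) \<ge> 1"
          by (simp add: gss_def flip: exp_add)
        moreover have "(w p)\<^sup>2 \<le> (norm (V p))\<^sup>2" using w(2)[of p] by (simp add: abs_le_square_iff[symmetric])
        ultimately have "1 * (w p)\<^sup>2 \<le> (exp (1 / 2) * gss (1 / R\<^sup>2) (fst p)) * (norm (V p))\<^sup>2"
          by (intro mult_mono) auto
        then have "ennreal ((w p)\<^sup>2) \<le> ennreal (exp (1 / 2) * (gss (1 / R\<^sup>2) (fst p) * (norm (V p))\<^sup>2))"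
          by (intro ennreal_leI) (simp add: mult.assoc)
        also have "\<dots> = ennreal (exp (1 / 2)) * ennreal (gss (1 / R\<^sup>2) (fst p) * (norm (V p))\<^sup>2)"
          by (rule ennreal_mult) auto
        finally show ?thesis using True \<open>\<bar>snd p\<bar> \<le> R\<close> by (simp add: abs_le_iff)
      qed simp
    qed
    also have "\<dots> = (\<integral>\<^sup>+t. \<integral>\<^sup>+y. ?h (y, t) \<partial>lborel \<partial>lborel)"
      unfolding lborel_prod[symmetric]
      by (rule lborel_pair.nn_integral_snd[symmetric]) measurable
    also have "\<dots> \<le> (\<integral>\<^sup>+t. ennreal K * indicator {-R..R} t \<partial>lborel)"
    proof (rule nn_integral_mono)
      fix t :: real
      have [measurable]: "(\<lambda>y. V (y, t)) \<in> borel_measurable borel" by measurable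
      have "(\<integral>\<^sup>+y. ?h (y, t) \<partial>lborel) =
         ennreal (exp (1 / 2)) * (\<integral>\<^sup>+y. ennreal (gss (1 / R\<^sup>2) y * (norm (V (y, t)))\<^sup>2) \<partial>lborel) * indicator {-R..R} t"
        by (simp add: nn_integral_cmult nn_integral_multc)
      also have "(\<integral>\<^sup>+y. ennreal (gss (1 / R\<^sup>2) y * (norm (V (y, t)))\<^sup>2) \<partial>lborel) \<le> 
          ennreal ((2 * pi) ^ DIM('a)) * (\<integral>\<^sup>+\<xi>. ennreal ((norm (A t \<xi>))\<^sup>2) \<partial>lborel)"
        unfolding VA by (rule gauss_bessel[OF _ A]) (use R in simp)
      also have "\<dots> \<le> ennreal ((2 * pi) ^ DIM('a)) * ennreal C"
        by (intro mult_left_mono C0) simp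
      also have "ennreal (exp (1 / 2)) * (ennreal ((2 * pi) ^ DIM('a)) * ennreal C) = ennreal K"
        unfolding K_def using C by (simp add: ennreal_mult)
      finally show "(\<integral>\<^sup>+y. ?h (y, t) \<partial>lborel) \<le> ennreal K * indicator {-R..R} t"
        by (simp add: mult_left_mono mult_right_mono)
    qed
    also have "\<dots> = ennreal K * ennreal (2 * R)"
      using R by (simp add: nn_integral_cmult)
    also have "\<dots> = ennreal (2 * K * R)"
      using K R by (simp add: mult_ac flip: ennreal_mult)
    finally show ?thesis .
  qed
  then show ?thesis unfolding growth_def using w(1) K by (intro conjI exI[of _ "2 * K"]) auto
qed

text \<open>The product type separates the tangential variable from the normal variable t.
  \<open>F_exp\<close> takes real exponents: the oscillating factor has modulus 1, and \<gamma> has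
  absorbed the 2 pi from the definition of e(t).\<close>

locale helmholtz =
  fixes u F :: "'a::euclidean_space \<times> real \<Rightarrow> complex"
    and D2 :: "'a \<times> real \<Rightarrow> 'a \<times> real \<Rightarrow> 'a \<times> real \<Rightarrow> complex" and lam \<gamma> :: real
  assumes lam: "lam > 0"
    and u: "u \<in> Bstar0" and D2: "\<And>b. b \<in> Basis \<Longrightarrow> D2 b b \<in> Bstar0"
    and weak: "\<And>b. b \<in> Basis \<Longrightarrow> weak_deriv [b, b] u (D2 b b)"
    and eq: "AE x in lborel. - (\<Sum>b\<in>Basis. D2 b b x) - complex_of_real lam * u x = F x"
    and F_meas[measurable]: "F \<in> borel_measurable borel"
    and F_supp: "\<And>y t. t < 0 \<Longrightarrow> F (y, t) = 0"
    and gam: "\<gamma> > 0"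
    and F_exp: "\<And>\<eta>. norm \<eta> < \<gamma> \<Longrightarrow> integrable lborel (\<lambda>x. (1 + (norm x)\<^sup>2) * norm (F x) * exp (x \<bullet> \<eta>))"
begin

lemma u_meas[measurable]: "u \<in> borel_measurable borel"
  by (rule Bstar0_measurable[OF u])

lemma F_int: "integrable lborel F"
proof (rule Bochner_Integration.integrable_bound)
  show "integrable lborel (\<lambda>x. (1 + (norm x)\<^sup>2) * norm (F x))" using F_exp[of 0] gam by simp
  show "AE x in lborel. norm (F x) \<le> norm ((1 + (norm x)\<^sup>2) * norm (F x))"
    by (intro AE_I2) (simp add: abs_mult mult_le_cancel_right1)
qed simp

text \<open>The real and imaginary parts of the superposition go through
  \<open>green_identity\<close> separately and are recombined at the end. For this reason
  \<open>gro\<close> speaks of every \<open>w\<close> dominated by the modulus of the superposition: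
  it covers both parts.\<close>

lemma green_family:
  fixes \<Phi> :: "('a \<times> real) list \<Rightarrow> 'a \<times> real \<Rightarrow> 'p \<Rightarrow> complex"
  assumes int: "\<And>bs x. set bs \<subseteq> Basis \<Longrightarrow> integrable M (\<Phi> bs x)"
    and der: "\<And>bs x p. set bs \<subseteq> Basis \<Longrightarrow> p \<in> space M \<Longrightarrow>
      ((\<lambda>x. \<Phi> bs x p) has_derivative (\<lambda>h. \<Sum>b\<in>Basis. (h \<bullet> b) *\<^sub>R \<Phi> (b # bs) x p)) (at x)"
    and bd: "\<And>bs x p. set bs \<subseteq> Basis \<Longrightarrow> p \<in> space M \<Longrightarrow> norm (\<Phi> bs x p) \<le> B bs p"
    and B: "\<And>bs. set bs \<subseteq> Basis \<Longrightarrow> integrable M (B bs)"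
    and gro: "\<And>bs w. set bs \<subseteq> Basis \<Longrightarrow> length bs \<le> 1 \<Longrightarrow> (\<lambda>x. \<integral>p. \<Phi> bs x p \<partial>M) \<in> borel_measurable borel \<Longrightarrow>
      w \<in> borel_measurable borel \<Longrightarrow> (\<And>x. \<bar>w x\<bar> \<le> norm (\<integral>p. \<Phi> bs x p \<partial>M)) \<Longrightarrow> growth w"
    and \<psi>: "\<And>x. - (\<Sum>b\<in>Basis. (\<integral>p. \<Phi> [b, b] x p \<partial>M)) - lam * (\<integral>p. \<Phi> [] x p \<partial>M) = \<psi> x"
    and i\<psi>: "integrable lborel (\<lambda>x. norm (u x) * norm (\<psi> x))"
  shows "(\<integral>x. u x * \<psi> x \<partial>lborel) = (\<integral>x. F x * (\<integral>p. \<Phi> [] x p \<partial>M) \<partial>lborel)"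
proof -
  define V where "V = (\<lambda>bs x. \<integral>p. \<Phi> bs x p \<partial>M)"
  have sm: "smooth_fun (\<lambda>x. L (V [] x))" if "bounded_linear L" for L :: "complex \<Rightarrow> real"
    unfolding V_def by (rule pds_integral(1)[where M = M and \<Phi> = \<Phi> and B = B]) (use int der bd B that in auto)
  have pd: "pds bs (\<lambda>x. L (V [] x)) = (\<lambda>x. L (V bs x))" if "bounded_linear L" "set bs \<subseteq> Basis" for L :: "complex \<Rightarrow> real" and bs
    unfolding V_def by (rule pds_integral(2)[where M = M and \<Phi> = \<Phi> and B = B]) (use int der bd B that in auto)
  have smV: "smooth_fun (\<lambda>x. L (V bs x))" if L: "bounded_linear L" and "set bs \<subseteq> Basis" for L :: "complex \<Rightarrow> real" and bs
    using that(2)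
  proof (induction bs)
    case Nil show ?case by (rule sm[OF L])
  next
    case (Cons b bs)
    then have "smooth_fun (pd b (\<lambda>x. L (V bs x)))" by (intro smooth_fun_pd) auto
    moreover have "pd b (\<lambda>x. L (V bs x)) = (\<lambda>x. L (V (b # bs) x))"
      using pd[OF L, of bs] pd[OF L, of "b # bs"] Cons.prems by simp
    ultimately show ?case by simp
  qed
  have mL: "(\<lambda>x. L (V bs x)) \<in> borel_measurable borel" if "bounded_linear L" "set bs \<subseteq> Basis" for L :: "complex \<Rightarrow> real" and bs
    by (rule smooth_fun_measurable[OF smV[OF that]])
  have mV: "V bs \<in> borel_measurable borel" if "set bs \<subseteq> Basis" for bs
    using mL[OF bounded_linear_Re that] mL[OF bounded_linear_Im that] by (subst borel_measurable_complex_iff) simp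
  have \<psi>m[measurable]: "\<psi> \<in> borel_measurable borel"
  proof -
    have "(\<lambda>x. - (\<Sum>b\<in>Basis. V [b, b] x) - lam * V [] x) \<in> borel_measurable borel"
      by (intro borel_measurable_diff borel_measurable_uminus borel_measurable_sum borel_measurable_times
          borel_measurable_const mV) auto
    then show ?thesis using \<psi> by (simp add: V_def)
  qed
  have main: "integrable lborel (\<lambda>x. u x * complex_of_real (L (\<psi> x)))"
    "integrable lborel (\<lambda>x. F x * complex_of_real (L (V [] x)))"
    "(\<integral>x. u x * complex_of_real (L (\<psi> x)) \<partial>lborel) = (\<integral>x. F x * complex_of_real (L (V [] x)) \<partial>lborel)"
    if L: "bounded_linear L" and L1: "\<And>z. \<bar>L z\<bar> \<le> norm z" for L :: "complex \<Rightarrow> real"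
  proof -
    interpret L: bounded_linear L by (rule L)
    have [measurable]: "L \<in> borel_measurable borel"
      by (intro borel_measurable_continuous_onI linear_continuous_on L)
    show i1: "integrable lborel (\<lambda>x. u x * complex_of_real (L (\<psi> x)))"
      by (rule Bochner_Integration.integrable_bound[OF i\<psi>])
        (use L1 in \<open>auto intro!: AE_I2 mult_left_mono simp: norm_mult\<close>)
    have bv: "norm (V [] x) \<le> (\<integral>p. B [] p \<partial>M)" for x
      unfolding V_def by (rule norm_integral_le) (use B bd in auto)
    have [measurable]: "V [] \<in> borel_measurable borel" by (rule mV) simp
    show i2: "integrable lborel (\<lambda>x. F x * complex_of_real (L (V [] x)))"
    proof (rule Bochner_Integration.integrable_bound)
      show "integrable lborel (\<lambda>x. norm (F x) * (\<integral>p. B [] p \<partial>M))" using F_int by simp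
      show "AE x in lborel. norm (F x * complex_of_real (L (V [] x))) \<le> norm (norm (F x) * (\<integral>p. B [] p \<partial>M))"
      proof (rule AE_I2)
        fix x
        have "\<bar>L (V [] x)\<bar> \<le> \<bar>\<integral>p. B [] p \<partial>M\<bar>" using order_trans[OF L1 bv, of x] by linarith
        then show "norm (F x * complex_of_real (L (V [] x))) \<le> norm (norm (F x) * (\<integral>p. B [] p \<partial>M))"
          by (simp add: norm_mult abs_mult mult_left_mono)
      qed
    qed measurable
    have gr: "growth (\<lambda>x. L (V bs x))" if "set bs \<subseteq> Basis" "length bs \<le> 1" for bs
      by (rule gro[OF that]) (use mV[OF that(1)] mL[OF L that(1)] L1 in \<open>auto simp: V_def\<close>)
    show "(\<integral>x. u x * complex_of_real (L (\<psi> x)) \<partial>lborel) = (\<integral>x. F x * complex_of_real (L (V [] x)) \<partial>lborel)"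
    proof (rule green_identity[where ?D2.0 = D2 and lam = lam and Cv = "\<integral>p. B [] p \<partial>M"])
      show "\<bar>L (V [] x)\<bar> \<le> (\<integral>p. B [] p \<partial>M)" for x using order_trans[OF L1 bv] .
      show "growth (pd b (\<lambda>x. L (V [] x)))" if "b \<in> Basis" for b
        using gr[of "[b]"] pd[OF L, of "[b]"] that by simp
      show "- (\<Sum>b\<in>Basis. pds [b, b] (\<lambda>x. L (V [] x)) x) - lam * L (V [] x) = L (\<psi> x)" for x
      proof -
        have "lam * V [] x = lam *\<^sub>R V [] x" by (simp add: scaleR_conv_of_real)
        then have "L (\<psi> x) = - (\<Sum>b\<in>Basis. L (V [b, b] x)) - lam * L (V [] x)"
          unfolding \<psi>[symmetric] by (simp add: V_def L.diff L.neg L.sum L.scaleR)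
        moreover have "pds [b, b] (\<lambda>x. L (V [] x)) x = L (V [b, b] x)" if "b \<in> Basis" for b
          using pd[OF L, of "[b, b]"] that by simp
        ultimately show ?thesis by (simp del: pds.simps)
      qed
    qed (use u D2 weak eq F_int sm[OF L] gr[of "[]"] i1 in auto)
  qed
  note R = main[of Re, OF bounded_linear_Re abs_Re_le_cmod] and I = main[of Im, OF bounded_linear_Im abs_Im_le_cmod]
  have "(\<integral>x. u x * \<psi> x \<partial>lborel) = (\<integral>x. u x * complex_of_real (Re (\<psi> x)) + \<i> * (u x * complex_of_real (Im (\<psi> x))) \<partial>lborel)"
    by (rule Bochner_Integration.integral_cong) (auto simp: complex_eq_iff algebra_simps)
  also have "\<dots> = (\<integral>x. u x * complex_of_real (Re (\<psi> x)) \<partial>lborel) + \<i> * (\<integral>x. u x * complex_of_real (Im (\<psi> x)) \<partial>lborel)"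
    using R(1) I(1) by simp
  also have "\<dots> = (\<integral>x. F x * complex_of_real (Re (V [] x)) + \<i> * (F x * complex_of_real (Im (V [] x))) \<partial>lborel)"
    using R I by simp
  also have "\<dots> = (\<integral>x. F x * V [] x \<partial>lborel)"
    by (rule Bochner_Integration.integral_cong) (auto simp: complex_eq_iff algebra_simps)
  finally show ?thesis by (simp add: V_def)
qed

end

text \<open>The Fourier multiplier of the tangential derivatives in \<open>bs\<close>. Basis vectors
  of the product are (e, 0) or (0, 1), told apart by \<open>snd\<close>. Normal derivatives
  contribute 1 here, since they act on the profile and are counted by \<open>tcount\<close>.\<close>

definition monom_of :: "('a::euclidean_space \<times> real) list \<Rightarrow> 'a \<Rightarrow> complex" where
  "monom_of bs \<xi> = (\<Prod>b\<leftarrow>bs. if snd b = 0 then \<i> * complex_of_real (fst b \<bullet> \<xi>) else 1)"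

definition tcount :: "('a \<times> real) list \<Rightarrow> nat" where
  "tcount bs = length (filter (\<lambda>b. snd b \<noteq> 0) bs)"

lemma measurable_monom_of[measurable]: "monom_of bs \<in> borel_measurable borel"
proof (induction bs)
  case Nil
  have "monom_of [] = (\<lambda>_::'a. 1)" by (auto simp: monom_of_def)
  then show ?case by simp
next
  case (Cons b bs)
  have "monom_of (b # bs) = (\<lambda>\<xi>. (if snd b = 0 then \<i> * complex_of_real (fst b \<bullet> \<xi>) else 1) * monom_of bs \<xi>)"
    by (auto simp: monom_of_def)
  then show ?case using Cons by simp
qed

lemma norm_monom_of: "set bs \<subseteq> Basis \<Longrightarrow> norm (monom_of bs \<xi>) \<le> (1 + norm \<xi>) ^ length bs"
proof (induction bs)
  case Nil then show ?case by (simp add: monom_of_def)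
next
  case (Cons b bs)
  have "norm b = 1" using Cons.prems by auto
  then have "norm (fst b) \<le> 1" using norm_fst_le[of "fst b" "snd b"] by simp
  then have "\<bar>fst b \<bullet> \<xi>\<bar> \<le> norm \<xi>"
    using Cauchy_Schwarz_ineq2[of "fst b" \<xi>] mult_right_mono[of "norm (fst b)" 1 "norm \<xi>"] by simp
  then have "norm (if snd b = 0 then \<i> * complex_of_real (fst b \<bullet> \<xi>) else 1) \<le> 1 + norm \<xi>"
    by (auto simp: norm_mult)
  then have "norm (if snd b = 0 then \<i> * complex_of_real (fst b \<bullet> \<xi>) else 1) * norm (monom_of bs \<xi>)
     \<le> (1 + norm \<xi>) * (1 + norm \<xi>) ^ length bs"
    using Cons by (intro mult_mono) auto
  then show ?case by (simp add: monom_of_def norm_mult)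
qed

context helmholtz begin

text \<open>The test function is the superposition with amplitude \<open>a\<close> of plane waves in \<open>y\<close> with profile \<open>W 0 \<xi>\<close>
  in \<open>t\<close>. By Bessel's inequality on each slice, boundedness of the profiles suffices for it to be
  paired with \<open>u\<close>.\<close>

lemma green_slices:
  fixes a :: "'a \<Rightarrow> complex" and W :: "nat \<Rightarrow> 'a \<Rightarrow> real \<Rightarrow> complex" and h :: "real \<Rightarrow> complex"
  defines "g \<equiv> \<lambda>y. \<integral>\<xi>. a \<xi> * iexp (y \<bullet> \<xi>) \<partial>lborel"
  assumes a_meas[measurable]: "a \<in> borel_measurable borel" and a_bd: "\<And>\<xi>. norm (a \<xi>) \<le> A"
    and a_int: "\<And>N. integrable lborel (\<lambda>\<xi>. (1 + norm \<xi>) ^ N * norm (a \<xi>))"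
    and W_der: "\<And>j \<xi> t. (W j \<xi> has_vector_derivative W (Suc j) \<xi> t) (at t)"
    and W_bd: "\<And>j \<xi> t. norm (W j \<xi> t) \<le> c j"
    and W_meas: "\<And>j. (\<lambda>p. W j (fst p) (snd p)) \<in> borel_measurable (borel \<Otimes>\<^sub>M borel)"
    and W_ode: "\<And>\<xi> t. W 2 \<xi> t = complex_of_real ((norm \<xi>)\<^sup>2 - lam) * W 0 \<xi> t - h t"
    and int: "integrable lborel (\<lambda>x. norm (u x) * norm (g (fst x) * h (snd x)))"
  shows "(\<integral>x. u x * (g (fst x) * h (snd x)) \<partial>lborel) =
    (\<integral>\<xi>. a \<xi> * (\<integral>x. F x * (iexp (fst x \<bullet> \<xi>) * W 0 \<xi> (snd x)) \<partial>lborel) \<partial>lborel)"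
proof -
  \<comment> \<open>The plane wave differentiated along \<open>bs\<close>: each tangential
    derivative multiplies by its symbol, each normal one raises the index of
    \<open>W\<close>.\<close>
  define \<Phi> where "\<Phi> = (\<lambda>bs (x::'a \<times> real) \<xi>. a \<xi> * monom_of bs \<xi> * W (tcount bs) \<xi> (snd x) * iexp (fst x \<bullet> \<xi>))"
  define B where "B = (\<lambda>(bs :: ('a \<times> real) list) \<xi>. c (tcount bs) * ((1 + norm \<xi>) ^ length bs * norm (a \<xi>)))"
  have [measurable]: "(\<lambda>\<xi>. W j \<xi> t) \<in> borel_measurable borel" for j t
    using measurable_compose[OF _ W_meas[of j], of "\<lambda>\<xi>. (\<xi>, t)" borel] by simp
  note W_meas[measurable]
  have c0: "c j \<ge> 0" for j using order_trans[OF norm_ge_zero W_bd] .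
  have amp: "norm (a \<xi> * monom_of bs \<xi> * W (tcount bs) \<xi> t) \<le> B bs \<xi>" if "set bs \<subseteq> Basis" for bs \<xi> t
  proof -
    have "norm (monom_of bs \<xi>) * norm (W (tcount bs) \<xi> t) \<le> (1 + norm \<xi>) ^ length bs * c (tcount bs)"
      by (intro mult_mono norm_monom_of W_bd that) auto
    then have "norm (a \<xi>) * (norm (monom_of bs \<xi>) * norm (W (tcount bs) \<xi> t)) \<le> norm (a \<xi>) * ((1 + norm \<xi>) ^ length bs * c (tcount bs))"
      by (rule mult_left_mono) simp
    then show ?thesis by (simp add: B_def norm_mult mult_ac)
  qed
  have Bint: "integrable lborel (B bs)" for bs
    unfolding B_def by (intro integrable_mult_right a_int)
  have ampint: "integrable lborel (\<lambda>\<xi>. a \<xi> * monom_of bs \<xi> * W (tcount bs) \<xi> t)" if "set bs \<subseteq> Basis" for bs t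
    by (rule Bochner_Integration.integrable_bound[OF Bint[of bs]])
      (use amp[OF that] in \<open>auto intro!: AE_I2 intro: order_trans[OF _ abs_ge_self]\<close>)
  have bd: "norm (\<Phi> bs x \<xi>) \<le> B bs \<xi>" if "set bs \<subseteq> Basis" for bs x \<xi>
    using amp[OF that, of \<xi> "snd x"] by (simp add: \<Phi>_def norm_mult)
  have \<Phi>int: "integrable lborel (\<Phi> bs x)" if "set bs \<subseteq> Basis" for bs x
  proof (rule Bochner_Integration.integrable_bound[OF Bint[of bs]])
    show "\<Phi> bs x \<in> borel_measurable lborel" unfolding \<Phi>_def by measurable
    show "AE \<xi> in lborel. norm (\<Phi> bs x \<xi>) \<le> norm (B bs \<xi>)"
      unfolding real_norm_def by (intro AE_I2 order_trans[OF bd[OF that] abs_ge_self])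
  qed
  have sumB: "(\<Sum>b\<in>Basis. s b) = (\<Sum>e\<in>Basis. s (e, 0)) + s (0, 1)" for s :: "'a \<times> real \<Rightarrow> complex"
  proof -
    have "(\<Sum>b\<in>(\<lambda>e::'a. (e, 0::real)) ` Basis. s b) = (\<Sum>e\<in>Basis. s (e, 0))"
      by (subst sum.reindex) (auto simp: inj_on_def)
    moreover have "(\<Sum>b\<in>(\<lambda>e::'a. (e, 0::real)) ` Basis \<union> {(0, 1)}. s b) = (\<Sum>b\<in>(\<lambda>e::'a. (e, 0::real)) ` Basis. s b) + s (0, 1)"
      by (subst sum.union_disjoint) auto
    ultimately show ?thesis by (simp add: Basis_prod_def)
  qed
  have \<Phi>e: "\<Phi> ((e, 0) # bs) x \<xi> = \<i> * complex_of_real (e \<bullet> \<xi>) * \<Phi> bs x \<xi>" for e bs x \<xi>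
    by (simp add: \<Phi>_def monom_of_def tcount_def)
  have \<Phi>t: "\<Phi> ((0, 1) # bs) x \<xi> = a \<xi> * monom_of bs \<xi> * W (Suc (tcount bs)) \<xi> (snd x) * iexp (fst x \<bullet> \<xi>)" for bs x \<xi>
    by (simp add: \<Phi>_def monom_of_def tcount_def)
  have der: "((\<lambda>x. \<Phi> bs x \<xi>) has_derivative (\<lambda>h. \<Sum>b\<in>Basis. (h \<bullet> b) *\<^sub>R \<Phi> (b # bs) x \<xi>)) (at x)" for bs x \<xi>
  proof -
    have d1: "((\<lambda>x::'a \<times> real. iexp (fst x \<bullet> \<xi>)) has_derivative (\<lambda>h. (\<i> * complex_of_real (fst h \<bullet> \<xi>)) * iexp (fst x \<bullet> \<xi>))) (at x)"
    proof -
      have "((\<lambda>x::'a \<times> real. \<i> * complex_of_real (fst x \<bullet> \<xi>)) has_derivative (\<lambda>h. \<i> * complex_of_real (fst h \<bullet> \<xi>))) (at x)"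
        by (auto intro!: derivative_eq_intros)
      from has_derivative_compose[OF this DERIV_exp[unfolded has_field_derivative_def]]
      show ?thesis by (simp add: mult.commute)
    qed
    have d2: "((\<lambda>x::'a \<times> real. W (tcount bs) \<xi> (snd x)) has_derivative (\<lambda>h. snd h *\<^sub>R W (Suc (tcount bs)) \<xi> (snd x))) (at x)"
      by (rule has_derivative_compose[OF _ W_der[unfolded has_vector_derivative_def]]) (auto intro!: derivative_eq_intros)
    have "((\<lambda>x. (a \<xi> * monom_of bs \<xi>) * (W (tcount bs) \<xi> (snd x) * iexp (fst x \<bullet> \<xi>))) has_derivative
       (\<lambda>h. (a \<xi> * monom_of bs \<xi>) * (W (tcount bs) \<xi> (snd x) * ((\<i> * complex_of_real (fst h \<bullet> \<xi>)) * iexp (fst x \<bullet> \<xi>))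
          + snd h *\<^sub>R W (Suc (tcount bs)) \<xi> (snd x) * iexp (fst x \<bullet> \<xi>)))) (at x)"
      by (intro has_derivative_mult_right has_derivative_mult d1 d2)
    moreover have "(\<Sum>b\<in>Basis. (h \<bullet> b) *\<^sub>R \<Phi> (b # bs) x \<xi>) = 
        (a \<xi> * monom_of bs \<xi>) * (W (tcount bs) \<xi> (snd x) * ((\<i> * complex_of_real (fst h \<bullet> \<xi>)) * iexp (fst x \<bullet> \<xi>))
          + snd h *\<^sub>R W (Suc (tcount bs)) \<xi> (snd x) * iexp (fst x \<bullet> \<xi>))" for h
    proof -
      have "(\<Sum>e\<in>Basis. (h \<bullet> (e, 0)) *\<^sub>R \<Phi> ((e, 0) # bs) x \<xi>) = (\<Sum>e\<in>Basis. complex_of_real ((fst h \<bullet> e) * (\<xi> \<bullet> e)) * (\<i> * \<Phi> bs x \<xi>))"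
        unfolding \<Phi>e by (intro sum.cong) (auto simp: inner_prod_def scaleR_conv_of_real inner_commute)
      also have "\<dots> = complex_of_real (fst h \<bullet> \<xi>) * (\<i> * \<Phi> bs x \<xi>)"
        by (simp only: sum_distrib_right[symmetric] of_real_sum[symmetric] euclidean_inner[of "fst h" \<xi>])
      finally show ?thesis
        unfolding sumB \<Phi>t by (simp add: inner_prod_def \<Phi>_def scaleR_conv_of_real algebra_simps)
    qed
    ultimately show ?thesis by (simp add: \<Phi>_def mult.assoc)
  qed
  have gr: "growth w" if bs: "set bs \<subseteq> Basis" "length bs \<le> 1" and V: "(\<lambda>x. \<integral>\<xi>. \<Phi> bs x \<xi> \<partial>lborel) \<in> borel_measurable borel"
    and w: "w \<in> borel_measurable borel" "\<And>x. \<bar>w x\<bar> \<le> norm (\<integral>\<xi>. \<Phi> bs x \<xi> \<partial>lborel)" for bs w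
  proof (rule slice_growth[OF V, where A = "\<lambda>t \<xi>. a \<xi> * monom_of bs \<xi> * W (tcount bs) \<xi> t"
        and C = "\<integral>\<xi>. (c (tcount bs))\<^sup>2 * A * ((1 + norm \<xi>) ^ (2 * length bs) * norm (a \<xi>)) \<partial>lborel"])
    have A0: "A \<ge> 0" using order_trans[OF norm_ge_zero a_bd] .
    have ii: "integrable lborel (\<lambda>\<xi>. (c (tcount bs))\<^sup>2 * A * ((1 + norm \<xi>) ^ (2 * length bs) * norm (a \<xi>)))"
      by (intro integrable_mult_right a_int)
    show "(\<integral>\<^sup>+\<xi>. ennreal ((norm (a \<xi> * monom_of bs \<xi> * W (tcount bs) \<xi> t))\<^sup>2) \<partial>lborel)
       \<le> ennreal (\<integral>\<xi>. (c (tcount bs))\<^sup>2 * A * ((1 + norm \<xi>) ^ (2 * length bs) * norm (a \<xi>)) \<partial>lborel)" for t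
      unfolding nn_integral_eq_integral[OF ii AE_I2, symmetric, OF mult_nonneg_nonneg, OF mult_nonneg_nonneg, OF zero_le_power2 A0 mult_nonneg_nonneg, OF zero_le_power norm_ge_zero, OF add_nonneg_nonneg, OF zero_le_one norm_ge_zero]
    proof (rule nn_integral_mono, rule ennreal_leI)
      fix \<xi>
      \<comment> \<open>Bessel needs square integrable amplitudes while only L^1 moments are given;
        one factor |a| is traded for its supremum \<open>A\<close>.\<close>
      have "(norm (a \<xi> * monom_of bs \<xi> * W (tcount bs) \<xi> t))\<^sup>2 \<le> (B bs \<xi>)\<^sup>2"
        by (intro power_mono amp bs) auto
      also have "\<dots> = (c (tcount bs))\<^sup>2 * (1 + norm \<xi>) ^ (2 * length bs) * norm (a \<xi>) * norm (a \<xi>)"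
        by (simp add: B_def power_mult_distrib power_mult[symmetric] mult.commute[of 2] power2_eq_square[of "norm (a \<xi>)"])
      also have "\<dots> \<le> (c (tcount bs))\<^sup>2 * (1 + norm \<xi>) ^ (2 * length bs) * norm (a \<xi>) * A"
        by (intro mult_left_mono a_bd) simp
      finally show "(norm (a \<xi> * monom_of bs \<xi> * W (tcount bs) \<xi> t))\<^sup>2 \<le> (c (tcount bs))\<^sup>2 * A * ((1 + norm \<xi>) ^ (2 * length bs) * norm (a \<xi>))"
        by (simp add: mult_ac)
    qed
    show "0 \<le> (\<integral>\<xi>. (c (tcount bs))\<^sup>2 * A * ((1 + norm \<xi>) ^ (2 * length bs) * norm (a \<xi>)) \<partial>lborel)"
      using A0 by (intro Bochner_Integration.integral_nonneg) simp
    show "(\<integral>\<xi>. \<Phi> bs (y, t) \<xi> \<partial>lborel) = (\<integral>\<xi>. a \<xi> * monom_of bs \<xi> * W (tcount bs) \<xi> t * iexp (y \<bullet> \<xi>) \<partial>lborel)" for y t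
      by (simp add: \<Phi>_def)
  qed (use ampint[OF bs(1)] w in auto)
  have pde: "- (\<Sum>b\<in>Basis. (\<integral>\<xi>. \<Phi> [b, b] x \<xi> \<partial>lborel)) - lam * (\<integral>\<xi>. \<Phi> [] x \<xi> \<partial>lborel) = g (fst x) * h (snd x)" for x
  proof -
    have i2: "integrable lborel (\<Phi> [b, b] x)" if "b \<in> Basis" for b by (rule \<Phi>int) (use that in auto)
    have i0: "integrable lborel (\<Phi> [] x)" by (rule \<Phi>int) auto
    have "- (\<Sum>b\<in>Basis. (\<integral>\<xi>. \<Phi> [b, b] x \<xi> \<partial>lborel)) - lam * (\<integral>\<xi>. \<Phi> [] x \<xi> \<partial>lborel)
       = (\<integral>\<xi>. - (\<Sum>b\<in>Basis. \<Phi> [b, b] x \<xi>) - lam * \<Phi> [] x \<xi> \<partial>lborel)"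
      using i2 i0 by (subst Bochner_Integration.integral_diff) (auto simp: Bochner_Integration.integral_sum)
    also have "\<dots> = (\<integral>\<xi>. a \<xi> * iexp (fst x \<bullet> \<xi>) * h (snd x) \<partial>lborel)"
    proof (rule Bochner_Integration.integral_cong[OF refl])
      fix \<xi>
      have "(\<Sum>e\<in>Basis. \<Phi> [(e, 0), (e, 0)] x \<xi>) = (\<Sum>e\<in>Basis. complex_of_real ((\<xi> \<bullet> e) * (\<xi> \<bullet> e)) * (- \<Phi> [] x \<xi>))"
      proof (intro sum.cong refl)
        fix e :: 'a
        have "\<i> * c * (\<i> * c * P) = (\<i> * \<i>) * (c * c * P)" for c P by (simp only: mult_ac)
        then show "\<Phi> [(e, 0), (e, 0)] x \<xi> = complex_of_real ((\<xi> \<bullet> e) * (\<xi> \<bullet> e)) * (- \<Phi> [] x \<xi>)"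
          unfolding \<Phi>e by (simp add: inner_commute)
      qed
      also have "\<dots> = complex_of_real ((norm \<xi>)\<^sup>2) * (- \<Phi> [] x \<xi>)"
        by (simp only: sum_distrib_right[symmetric] of_real_sum[symmetric] euclidean_inner[of \<xi> \<xi>, symmetric] power2_norm_eq_inner)
      finally have s: "(\<Sum>e\<in>Basis. \<Phi> [(e, 0), (e, 0)] x \<xi>) = complex_of_real ((norm \<xi>)\<^sup>2) * (- \<Phi> [] x \<xi>)" .
      have t: "\<Phi> [(0, 1), (0, 1)] x \<xi> = a \<xi> * W 2 \<xi> (snd x) * iexp (fst x \<bullet> \<xi>)"
        by (simp add: \<Phi>_def monom_of_def tcount_def numeral_2_eq_2)
      show "- (\<Sum>b\<in>Basis. \<Phi> [b, b] x \<xi>) - lam * \<Phi> [] x \<xi> = a \<xi> * iexp (fst x \<bullet> \<xi>) * h (snd x)"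
        unfolding sumB s t W_ode by (simp add: \<Phi>_def monom_of_def tcount_def algebra_simps)
    qed
    finally show ?thesis by (simp add: g_def)
  qed
  have "(\<integral>x. u x * (g (fst x) * h (snd x)) \<partial>lborel) = (\<integral>x. F x * (\<integral>\<xi>. \<Phi> [] x \<xi> \<partial>lborel) \<partial>lborel)"
    by (rule green_family[where M = lborel and \<Phi> = \<Phi> and B = B, OF \<Phi>int der bd Bint gr pde int]) auto
  also have "\<dots> = (\<integral>x. \<integral>\<xi>. a \<xi> * (F x * (iexp (fst x \<bullet> \<xi>) * W 0 \<xi> (snd x))) \<partial>lborel \<partial>lborel)"
    by (simp add: \<Phi>_def monom_of_def tcount_def mult_ac flip: integral_mult_right_zero)
  also have "\<dots> = (\<integral>\<xi>. \<integral>x. a \<xi> * (F x * (iexp (fst x \<bullet> \<xi>) * W 0 \<xi> (snd x))) \<partial>lborel \<partial>lborel)"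
  proof (rule integral_swap_dominated(2))
    show "integrable lborel (\<lambda>x. norm (F x))" using F_int by simp
    show "integrable lborel (\<lambda>\<xi>. c 0 * norm (a \<xi>))" using a_int[of 0] by simp
    show "norm (a \<xi> * (F x * (iexp (fst x \<bullet> \<xi>) * W 0 \<xi> (snd x)))) \<le> norm (F x) * (c 0 * norm (a \<xi>))" for x \<xi>
      using mult_left_mono[OF W_bd[of 0 \<xi> "snd x"], of "norm (F x) * norm (a \<xi>)"] by (simp add: norm_mult mult_ac)
    have f1: "(\<lambda>p. fst p) \<in> (borel :: ('a \<times> real) measure) \<Otimes>\<^sub>M (borel :: 'a measure) \<rightarrow>\<^sub>M borel" by (rule measurable_fst)
    have [measurable]: "(\<lambda>p::('a \<times> real) \<times> 'a. snd (fst p)) \<in> borel \<Otimes>\<^sub>M borel \<rightarrow>\<^sub>M borel"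
      by (rule measurable_compose[OF f1]) (intro borel_measurable_continuous_onI continuous_intros)
    have [measurable]: "(\<lambda>p::('a \<times> real) \<times> 'a. fst (fst p)) \<in> borel \<Otimes>\<^sub>M borel \<rightarrow>\<^sub>M borel"
      by (rule measurable_compose[OF f1]) (intro borel_measurable_continuous_onI continuous_intros)
    have [measurable]: "(\<lambda>p::('a \<times> real) \<times> 'a. W 0 (snd p) (snd (fst p))) \<in> borel_measurable (borel \<Otimes>\<^sub>M borel)"
    proof -
      have "(\<lambda>p::('a \<times> real) \<times> 'a. (snd p, snd (fst p))) \<in> borel \<Otimes>\<^sub>M borel \<rightarrow>\<^sub>M borel \<Otimes>\<^sub>M borel"
        by measurable
      from measurable_compose[OF this W_meas[of 0]] show ?thesis by simp
    qed
    show "(\<lambda>p. a (snd p) * (F (fst p) * (iexp (fst (fst p) \<bullet> snd p) * W 0 (snd p) (snd (fst p))))) \<in> borel_measurable (lborel \<Otimes>\<^sub>M lborel)"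
      by measurable
  qed
  finally show ?thesis by simp
qed

end

subsection \<open>A bounded profile in the normal variable\<close>

text \<open>The kernel \<open>sgn r * exp (- \<mu> * \<bar>r\<bar>) / 2\<close> stays bounded as \<open>\<mu> \<rightarrow> 0\<close>, unlike the
  fundamental solution \<open>exp (- \<mu> * \<bar>r\<bar>) / (2 * \<mu>)\<close> whose derivative it is.\<close>

locale profile =
  fixes D :: "nat \<Rightarrow> real \<Rightarrow> real" and L :: real
  assumes D_der: "\<And>j t. (D j has_real_derivative D (Suc j) t) (at t)"
    and D_supp: "\<And>j t. \<bar>t\<bar> > L \<Longrightarrow> D j t = 0"
    and L: "L > 0"
begin

text \<open>The convolution of \<open>D j\<close> with sgn(r) e^{-\<mu>|r|} / 2, folded onto r \<ge>
  0.\<close>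

definition prof :: "complex \<Rightarrow> nat \<Rightarrow> real \<Rightarrow> complex" where
  "prof \<mu> j t = (\<integral>r. indicator {0..} r *\<^sub>R (exp (- \<mu> * r) * complex_of_real ((D j (t - r) - D j (t + r)) / 2)) \<partial>lborel)"

lemma D_cont: "continuous_on S (D j)"
  using D_der by (meson DERIV_continuous continuous_at_imp_continuous_on)

lemma D_meas[measurable]: "D j \<in> borel_measurable borel"
  by (intro borel_measurable_continuous_onI D_cont)

lemma D_bound: "\<exists>C\<ge>0. \<forall>t. \<bar>D j t\<bar> \<le> C"
proof -
  have "compact (D j ` {-L..L})" by (intro compact_continuous_image D_cont) auto
  then obtain C where C: "\<forall>y\<in>D j ` {-L..L}. \<bar>y\<bar> \<le> C"
    using compact_imp_bounded bounded_iff real_norm_def by metis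
  have "\<bar>D j t\<bar> \<le> max 0 C" for t
    using C D_supp[of t j] by (cases "\<bar>t\<bar> \<le> L") (auto simp: le_max_iff_disj abs_le_iff)
  then show ?thesis by (intro exI[of _ "max 0 C"]) simp
qed

lemma D_int: "integrable lborel (D j)"
proof -
  obtain C where C: "C \<ge> 0" "\<And>t. \<bar>D j t\<bar> \<le> C" using D_bound by blast
  show ?thesis
  proof (rule Bochner_Integration.integrable_bound)
    show "integrable lborel (\<lambda>t. C * indicat_real {-L..L} t)"
      by (intro integrable_mult_right integrable_real_indicator) (auto simp: emeasure_lborel_Icc_eq)
    show "AE t in lborel. norm (D j t) \<le> norm (C * indicat_real {-L..L} t)"
      using C D_supp by (intro AE_I2) (auto split: split_indicator simp: abs_le_iff not_le)
  qed simp
qed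

lemma D_translate:
  shows "integrable lborel (\<lambda>r. D j (t - r))" "(\<integral>r. \<bar>D j (t - r)\<bar> \<partial>lborel) = (\<integral>r. \<bar>D j r\<bar> \<partial>lborel)"
    and "integrable lborel (\<lambda>r. D j (t + r))" "(\<integral>r. \<bar>D j (t + r)\<bar> \<partial>lborel) = (\<integral>r. \<bar>D j r\<bar> \<partial>lborel)"
  using lborel_integrable_real_affine[OF D_int, of "-1" j t] lborel_integrable_real_affine[OF D_int, of 1 j t]
    lborel_integral_real_affine[of "-1" "\<lambda>r. \<bar>D j r\<bar>" t] lborel_integral_real_affine[of 1 "\<lambda>r. \<bar>D j r\<bar>" t]
  by simp_all

lemma norm_kernel: "Re \<mu> \<ge> 0 \<Longrightarrow> 0 \<le> r \<Longrightarrow> norm (exp (- \<mu> * complex_of_real r)) \<le> 1"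
  by simp

lemma kernel_le:
  fixes r s :: real
  shows "Re \<mu> \<ge> 0 \<Longrightarrow> norm (indicator {0..} r *\<^sub>R (exp (- \<mu> * r) * complex_of_real s)) \<le> \<bar>s\<bar>"
  using norm_kernel[of \<mu> r] mult_right_mono[of "norm (exp (- \<mu> * complex_of_real r))" 1 "\<bar>s\<bar>"]
  by (auto simp: norm_mult split: split_indicator)

lemma half_int:
  assumes "Re \<mu> \<ge> 0"
  shows "integrable lborel (\<lambda>r. indicator {0..} r *\<^sub>R (exp (- \<mu> * r) * complex_of_real (D j (t - r))))"
    and "integrable lborel (\<lambda>r. indicator {0..} r *\<^sub>R (exp (- \<mu> * r) * complex_of_real (D j (t + r))))"
    and "integrable lborel (\<lambda>r. indicator {0..} r *\<^sub>R (exp (- \<mu> * r) * complex_of_real ((D j (t - r) - D j (t + r)) / 2)))"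
proof -
  show i1: "integrable lborel (\<lambda>r. indicator {0..} r *\<^sub>R (exp (- \<mu> * r) * complex_of_real (D j (t - r))))"
    by (rule Bochner_Integration.integrable_bound[OF integrable_norm[OF D_translate(1)[of j t]]])
      (use kernel_le[OF assms] in auto)
  show i2: "integrable lborel (\<lambda>r. indicator {0..} r *\<^sub>R (exp (- \<mu> * r) * complex_of_real (D j (t + r))))"
    by (rule Bochner_Integration.integrable_bound[OF integrable_norm[OF D_translate(3)[of j t]]])
      (use kernel_le[OF assms] in auto)
  have "integrable lborel (\<lambda>r. (1 / 2) * (indicator {0..} r *\<^sub>R (exp (- \<mu> * r) * complex_of_real (D j (t - r))) -
     indicator {0..} r *\<^sub>R (exp (- \<mu> * r) * complex_of_real (D j (t + r)))))"
    by (intro integrable_mult_right Bochner_Integration.integrable_diff i1 i2)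
  then show "integrable lborel (\<lambda>r. indicator {0..} r *\<^sub>R (exp (- \<mu> * r) * complex_of_real ((D j (t - r) - D j (t + r)) / 2)))"
    by (rule back_subst[of "integrable lborel"]) (auto simp: algebra_simps diff_divide_distrib split: split_indicator)
qed

text \<open>The kernel is at most 1/2 in modulus as long as Re \<mu> \<ge> 0. The bound therefore
  does not see \<mu>, and this is the uniformity in \<xi> demanded of profiles in
  \<open>green_slices\<close>.\<close>

lemma prof_bound:
  assumes "Re \<mu> \<ge> 0"
  shows "norm (prof \<mu> j t) \<le> (\<integral>r. \<bar>D j r\<bar> \<partial>lborel)"
proof -
  have "norm (prof \<mu> j t) \<le> (\<integral>r. (\<bar>D j (t - r)\<bar> + \<bar>D j (t + r)\<bar>) / 2 \<partial>lborel)"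
    unfolding prof_def
  proof (rule norm_integral_le)
    show "integrable lborel (\<lambda>r. (\<bar>D j (t - r)\<bar> + \<bar>D j (t + r)\<bar>) / 2)"
      using D_translate(1,3)[of j t] by auto
    show "norm (indicator {0..} r *\<^sub>R (exp (- \<mu> * r) * complex_of_real ((D j (t - r) - D j (t + r)) / 2)))
      \<le> (\<bar>D j (t - r)\<bar> + \<bar>D j (t + r)\<bar>) / 2" for r
      by (rule order_trans[OF kernel_le[OF assms]]) (use abs_triangle_ineq4[of "D j (t - r)" "D j (t + r)"] in simp)
  qed
  also have "\<dots> = (\<integral>r. \<bar>D j r\<bar> \<partial>lborel)"
    using D_translate[of j t] by simp
  finally show ?thesis .
qed

lemma prof_der:
  assumes \<mu>: "Re \<mu> \<ge> 0"
  shows "(prof \<mu> j has_vector_derivative prof \<mu> (Suc j) t) (at t)"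
proof -
  obtain C where C: "C \<ge> 0" "\<And>t. \<bar>D (Suc j) t\<bar> \<le> C" using D_bound by blast
  \<comment> \<open>For x within distance 1 of t, both x - r and x + r lie outside the support of
    \<open>D\<close> once |r| exceeds this value.\<close>
  define T where "T = L + \<bar>t\<bar> + 1"
  let ?f = "\<lambda>j t r. indicator {0..} r *\<^sub>R (exp (- \<mu> * r) * complex_of_real ((D j (t - r) - D j (t + r)) / 2))"
  have "((\<lambda>t. \<integral>r. ?f j t r \<partial>lborel) has_derivative (\<lambda>h. \<integral>r. h *\<^sub>R ?f (Suc j) t r \<partial>lborel)) (at t)"
  proof (rule has_derivative_integral[where e = 1 and f' = "\<lambda>t r h. h *\<^sub>R ?f (Suc j) t r" and B = "\<lambda>r. C * indicat_real {-T..T} r"])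
    fix x r :: real
    have d: "((\<lambda>x. (D j (x - r) - D j (x + r)) / 2) has_real_derivative (D (Suc j) (x - r) - D (Suc j) (x + r)) / 2) (at x)"
      by (auto intro!: derivative_eq_intros DERIV_chain'[OF _ D_der])
    have "((\<lambda>x. complex_of_real ((D j (x - r) - D j (x + r)) / 2)) has_derivative
       (\<lambda>h. complex_of_real ((D (Suc j) (x - r) - D (Suc j) (x + r)) / 2 * h))) (at x)"
      by (rule bounded_linear.has_derivative[OF bounded_linear_of_real d[unfolded has_field_derivative_def]])
    then have "((\<lambda>x. ?f j x r) has_derivative (\<lambda>h. indicator {0..} r *\<^sub>R (exp (- \<mu> * r) * complex_of_real ((D (Suc j) (x - r) - D (Suc j) (x + r)) / 2 * h)))) (at x)"
      by (intro has_derivative_scaleR_right has_derivative_mult_right)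
    then show "((\<lambda>x. ?f j x r) has_derivative (\<lambda>h. h *\<^sub>R ?f (Suc j) x r)) (at x)"
      by (simp add: scaleR_conv_of_real mult_ac)
  next
    fix x r h :: real assume x: "x \<in> ball t 1"
    have "norm (?f (Suc j) x r) \<le> C * indicat_real {-T..T} r"
    proof (cases "\<bar>r\<bar> \<le> T")
      case True
      have "\<bar>(D (Suc j) (x - r) - D (Suc j) (x + r)) / 2\<bar> \<le> C"
        using C(2)[of "x - r"] C(2)[of "x + r"] by (simp add: abs_le_iff)
      then show ?thesis using kernel_le[OF \<mu>, of r "(D (Suc j) (x - r) - D (Suc j) (x + r)) / 2"] True
        by (auto simp: abs_le_iff)
    next
      case False
      then have "\<bar>x - r\<bar> > L" "\<bar>x + r\<bar> > L" using x by (auto simp: T_def dist_real_def)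
      then show ?thesis using D_supp C by simp
    qed
    then have "norm (?f (Suc j) x r) * \<bar>h\<bar> \<le> C * indicat_real {-T..T} r * \<bar>h\<bar>" by (rule mult_right_mono) simp
    then show "norm (h *\<^sub>R ?f (Suc j) x r) \<le> C * indicat_real {-T..T} r * norm h"
      unfolding norm_scaleR real_norm_def by (simp only: mult.commute)
  next
    show "integrable lborel (\<lambda>r. C * indicat_real {-T..T} r)"
      by (intro integrable_mult_right integrable_real_indicator) (auto simp: emeasure_lborel_Icc_eq)
  qed (use C half_int(3)[OF \<mu>] in \<open>auto simp del: of_real_divide of_real_diff\<close>)
  then show ?thesis
    unfolding has_vector_derivative_def prof_def[abs_def] by (simp only: integral_scaleR_right)
qed

lemma half_parts:
  shows "(\<integral>r. indicator {0..} r *\<^sub>R (exp (- \<mu> * r) * complex_of_real (D (Suc j) (t - r))) \<partial>lborel)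
    = D j t - \<mu> * (\<integral>r. indicator {0..} r *\<^sub>R (exp (- \<mu> * r) * complex_of_real (D j (t - r))) \<partial>lborel)" (is ?A)
   and "(\<integral>r. indicator {0..} r *\<^sub>R (exp (- \<mu> * r) * complex_of_real (D (Suc j) (t + r))) \<partial>lborel)
    = - D j t + \<mu> * (\<integral>r. indicator {0..} r *\<^sub>R (exp (- \<mu> * r) * complex_of_real (D j (t + r))) \<partial>lborel)" (is ?B)
proof -
  define T where "T = L + \<bar>t\<bar> + 1"
  have T: "T \<ge> 0" using L by (simp add: T_def)
  \<comment> \<open>The sign s = 1 or s = -1 treats both half-line integrals at once; beyond
    \<open>T\<close> the integrand vanishes, so the integration by parts takes place on a compact
    interval.\<close>
  have gen: "(\<integral>r. indicator {0..} r *\<^sub>R (exp (- \<mu> * r) * complex_of_real (D (Suc j) (t + s * r))) \<partial>lborel)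
    = - s * D j t + s * \<mu> * (\<integral>r. indicator {0..} r *\<^sub>R (exp (- \<mu> * r) * complex_of_real (D j (t + s * r))) \<partial>lborel)"
    if s: "s = 1 \<or> s = -1" for s :: real
  proof -
    let ?g = "\<lambda>j r. exp (- \<mu> * complex_of_real r) * complex_of_real (D j (t + s * r))"
    have far: "D i (t + s * r) = 0" if "r > T \<or> r = T" for i r
      by (rule D_supp) (use that s L in \<open>auto simp: T_def\<close>)
    have ind: "(\<integral>r. indicator {0..} r *\<^sub>R ?g i r \<partial>lborel) = (\<integral>r. indicator {0..T} r *\<^sub>R ?g i r \<partial>lborel)" for i
      by (rule Bochner_Integration.integral_cong) (use far in \<open>auto split: split_indicator simp: not_le\<close>)
    have c: "continuous_on {0..T} (\<lambda>r. ?g i r)" for i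
      by (intro continuous_intros continuous_on_compose2[OF D_cont[of UNIV]]) auto
    have i: "integrable lborel (\<lambda>r. indicator {0..T} r *\<^sub>R ?g i r)" for i
      using borel_integrable_atLeastAtMost'[OF c[of i]] by (simp add: set_integrable_def)
    have "(\<integral>r. indicator {0..T} r *\<^sub>R (- \<mu> * ?g j r + s * ?g (Suc j) r) \<partial>lborel) = ?g j T - ?g j 0"
    proof (rule integral_FTC_Icc[OF T])
      fix r
      have 1: "((\<lambda>r. complex_of_real (D j (t + s * r))) has_vector_derivative complex_of_real (s * D (Suc j) (t + s * r))) (at r within {0..T})"
      proof -
        have "((\<lambda>r. D j (t + s * r)) has_real_derivative s * D (Suc j) (t + s * r)) (at r within {0..T})"
        proof -
          have "((\<lambda>r. t + s * r) has_real_derivative s) (at r within {0..T})"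
            by (auto intro!: derivative_eq_intros)
          from DERIV_chain'[OF this D_der] show ?thesis by (simp add: mult.commute)
        qed
        from bounded_linear.has_vector_derivative[OF bounded_linear_of_real this[unfolded has_real_derivative_iff_has_vector_derivative]]
        show ?thesis .
      qed
      have 2: "((\<lambda>r. exp (- \<mu> * complex_of_real r)) has_vector_derivative - \<mu> * exp (- \<mu> * complex_of_real r)) (at r within {0..T})"
        by (rule has_vector_derivative_real_field) (auto intro!: derivative_eq_intros)
      have "(?g j has_vector_derivative exp (- \<mu> * complex_of_real r) * complex_of_real (s * D (Suc j) (t + s * r)) + (- \<mu> * exp (- \<mu> * complex_of_real r)) * complex_of_real (D j (t + s * r))) (at r within {0..T})"
        by (rule has_vector_derivative_mult[OF 2 1])
      then show "(?g j has_vector_derivative - \<mu> * ?g j r + s * ?g (Suc j) r) (at r within {0..T})"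
        by (simp add: algebra_simps)
    qed (intro continuous_intros c)
    moreover have "(\<integral>r. indicator {0..T} r *\<^sub>R (- \<mu> * ?g j r + s * ?g (Suc j) r) \<partial>lborel) =
       - \<mu> * (\<integral>r. indicator {0..T} r *\<^sub>R ?g j r \<partial>lborel) + s * (\<integral>r. indicator {0..T} r *\<^sub>R ?g (Suc j) r \<partial>lborel)"
    proof -
      have "(\<lambda>r. indicator {0..T} r *\<^sub>R (- \<mu> * ?g j r + s * ?g (Suc j) r)) =
        (\<lambda>r. - \<mu> * (indicator {0..T} r *\<^sub>R ?g j r) + s * (indicator {0..T} r *\<^sub>R ?g (Suc j) r))"
        by (auto split: split_indicator)
      then show ?thesis using i by (simp only: Bochner_Integration.integral_add[OF integrable_mult_right[OF i] integrable_mult_right[OF i]] integral_mult_right_zero)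
    qed
    ultimately have "- \<mu> * (\<integral>r. indicator {0..T} r *\<^sub>R ?g j r \<partial>lborel) + s * (\<integral>r. indicator {0..T} r *\<^sub>R ?g (Suc j) r \<partial>lborel) = - D j t"
      using far[of T j] by simp
    moreover have "c * (c * I) = c * (d + \<mu> * J)" if "- \<mu> * J + c * I = d" for c d I J :: complex
      unfolding that[symmetric] by (simp add: algebra_simps)
    ultimately have "s * (s * (\<integral>r. indicator {0..T} r *\<^sub>R ?g (Suc j) r \<partial>lborel)) = s * (- D j t + \<mu> * (\<integral>r. indicator {0..T} r *\<^sub>R ?g j r \<partial>lborel))"
      by blast
    moreover have "complex_of_real s * (complex_of_real s * I) = I" for I using s by auto
    ultimately have "(\<integral>r. indicator {0..T} r *\<^sub>R ?g (Suc j) r \<partial>lborel) = s * (- D j t + \<mu> * (\<integral>r. indicator {0..T} r *\<^sub>R ?g j r \<partial>lborel))"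
      by (simp only:)
    then show ?thesis unfolding ind by (simp add: algebra_simps)
  qed
  show ?A using gen[of "-1"] by simp
  show ?B using gen[of 1] by simp
qed

text \<open>The kernel k satisfies k'' = \<mu>^2 k + \<delta>' with the Dirac mass \<delta>. In the
  two half-line integrals the boundary values of \<open>D 0\<close> cancel after two integrations by
  parts, while those of \<open>D 1\<close> add up.\<close>

lemma prof_ode:
  assumes \<mu>: "Re \<mu> \<ge> 0"
  shows "prof \<mu> 2 t = \<mu>\<^sup>2 * prof \<mu> 0 t + D 1 t"
proof -
  let ?P = "\<lambda>j. (\<integral>r. indicator {0..} r *\<^sub>R (exp (- \<mu> * r) * complex_of_real (D j (t - r))) \<partial>lborel)"
  let ?Q = "\<lambda>j. (\<integral>r. indicator {0..} r *\<^sub>R (exp (- \<mu> * r) * complex_of_real (D j (t + r))) \<partial>lborel)"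
  have p: "prof \<mu> j t = (?P j - ?Q j) / 2" for j
  proof -
    have "prof \<mu> j t = (\<integral>r. (1 / 2) * (indicator {0..} r *\<^sub>R (exp (- \<mu> * r) * complex_of_real (D j (t - r))) -
     indicator {0..} r *\<^sub>R (exp (- \<mu> * r) * complex_of_real (D j (t + r)))) \<partial>lborel)"
      unfolding prof_def
      by (rule Bochner_Integration.integral_cong) (auto simp: algebra_simps diff_divide_distrib split: split_indicator)
    also have "\<dots> = (1 / 2) * (?P j - ?Q j)"
      using half_int(1,2)[OF \<mu>, of j t] by (simp only: integral_mult_right_zero Bochner_Integration.integral_diff)
    finally show ?thesis by simp
  qed
  have P2: "?P 2 = D 1 t - \<mu> * (D 0 t - \<mu> * ?P 0)"
    using half_parts(1)[of \<mu> 1 t] half_parts(1)[of \<mu> 0 t] by (simp add: numeral_2_eq_2)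
  have Q2: "?Q 2 = - D 1 t + \<mu> * (- D 0 t + \<mu> * ?Q 0)"
    using half_parts(2)[of \<mu> 1 t] half_parts(2)[of \<mu> 0 t] by (simp add: numeral_2_eq_2)
  have alg: "((d - \<mu> * (d0 - \<mu> * P)) - (- d + \<mu> * (- d0 + \<mu> * Q))) / 2 = \<mu>\<^sup>2 * ((P - Q) / 2) + d"
    for P Q d d0 :: complex by (simp add: field_simps power2_eq_square)
  show ?thesis unfolding p P2 Q2 of_real_minus by (rule alg)
qed

text \<open>For t \<ge> 0 the part with t + r sees only the region where \<open>D 0\<close> is zero.
  In the other part the restriction r \<ge> 0 is automatic, so the substitution s = t - r pulls out
  e^{-\<mu> t} and leaves a factor without t.\<close>

lemma prof_pos:
  assumes neg: "\<And>t. t \<ge> 0 \<Longrightarrow> D 0 t = 0" and t: "t \<ge> 0"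
  shows "prof \<mu> 0 t = exp (- \<mu> * t) * (\<integral>s. exp (\<mu> * s) * complex_of_real (D 0 s / 2) \<partial>lborel)"
proof -
  have "prof \<mu> 0 t = (\<integral>r. exp (- \<mu> * r) * complex_of_real (D 0 (t - r) / 2) \<partial>lborel)"
    unfolding prof_def by (rule Bochner_Integration.integral_cong) (use t in \<open>auto split: split_indicator simp: neg\<close>)
  also have "\<dots> = (\<integral>s. exp (- \<mu> * (t + (-1) * s)) * complex_of_real (D 0 (t - (t + (-1) * s)) / 2) \<partial>lborel)"
    by (subst lborel_integral_real_affine[where c = "-1" and t = t]) simp_all
  also have "\<dots> = (\<integral>s. exp (- \<mu> * t) * (exp (\<mu> * s) * complex_of_real (D 0 s / 2)) \<partial>lborel)"
    by (rule Bochner_Integration.integral_cong) (simp_all add: algebra_simps exp_add exp_diff exp_minus field_simps)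
  finally show ?thesis by simp
qed

lemma prof_meas:
  assumes [measurable]: "\<mu> \<in> borel_measurable borel"
  shows "(\<lambda>p. prof (\<mu> (fst p)) j (snd p)) \<in> borel_measurable (borel \<Otimes>\<^sub>M borel)"
  unfolding prof_def by measurable

end

subsection \<open>The Fourier--Laplace transform of the right-hand side\<close>

context helmholtz begin

text \<open>The root of |\<xi>|^2 - lam in the closed right half-plane, nonnegative real outside the
  sphere and on the positive imaginary axis inside. The truncations by \<open>max\<close> give one
  formula that is visibly continuous across the sphere.\<close>

definition mu :: "'a \<Rightarrow> complex" where
  "mu \<xi> = Complex (sqrt (max 0 ((norm \<xi>)\<^sup>2 - lam))) (sqrt (max 0 (lam - (norm \<xi>)\<^sup>2)))"

lemma mu_Re: "Re (mu \<xi>) \<ge> 0" by (simp add: mu_def)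

lemma mu_sq: "(mu \<xi>)\<^sup>2 = complex_of_real ((norm \<xi>)\<^sup>2 - lam)"
  by (cases "(norm \<xi>)\<^sup>2 \<le> lam") (simp_all add: mu_def complex_eq_iff Re_power2 Im_power2 max_def)

lemma mu_meas[measurable]: "mu \<in> borel_measurable borel"
proof -
  have "mu = (\<lambda>\<xi>. complex_of_real (sqrt (max 0 ((norm \<xi>)\<^sup>2 - lam))) + \<i> * complex_of_real (sqrt (max 0 (lam - (norm \<xi>)\<^sup>2))))"
    by (auto simp: mu_def complex_eq_iff)
  then show ?thesis by simp
qed

lemma mu_cont: "isCont mu \<xi>"
proof -
  have "mu = (\<lambda>\<xi>. complex_of_real (sqrt (max 0 ((norm \<xi>)\<^sup>2 - lam))) + \<i> * complex_of_real (sqrt (max 0 (lam - (norm \<xi>)\<^sup>2))))"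
    by (auto simp: mu_def complex_eq_iff)
  then show ?thesis unfolding isCont_def by (simp only:) (intro tendsto_intros tendsto_max)
qed

definition fl :: "'a \<Rightarrow> complex" where
  "fl \<xi> = (\<integral>x. F x * (iexp (fst x \<bullet> \<xi>) * exp (- mu \<xi> * snd x)) \<partial>lborel)"

lemma fst_meas[measurable]: "fst \<in> (borel :: ('a \<times> real) measure) \<rightarrow>\<^sub>M borel"
  by (intro borel_measurable_continuous_onI continuous_intros)

lemma snd_meas[measurable]: "snd \<in> (borel :: ('a \<times> real) measure) \<rightarrow>\<^sub>M borel"
  by (intro borel_measurable_continuous_onI continuous_intros)

lemma fl_integrand_le: "norm (F x * (iexp (fst x \<bullet> \<xi>) * exp (- mu \<xi> * snd x))) \<le> norm (F x)"
proof (cases "snd x < 0")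
  case True
  then have "F x = 0" using F_supp[of "snd x" "fst x"] by simp
  then show ?thesis by simp
next
  case False
  then have "norm (exp (- mu \<xi> * snd x)) \<le> 1" using mu_Re[of \<xi>] by (simp add: mult_nonneg_nonneg)
  then show ?thesis by (simp add: norm_mult mult_left_le)
qed

text \<open>Continuity is what lifts vanishing almost everywhere, the outcome of the L^2 argument,
  to vanishing at every point.\<close>

lemma fl_cont: "isCont fl \<xi>0"
  unfolding continuous_at_sequentially
proof (intro allI impI)
  fix X :: "nat \<Rightarrow> 'a" assume X: "X \<longlonglongrightarrow> \<xi>0"
  have "(\<lambda>n. fl (X n)) \<longlonglongrightarrow> fl \<xi>0"
    unfolding fl_def
  proof (rule integral_dominated_convergence[where w = "\<lambda>x. norm (F x)"])
    show "integrable lborel (\<lambda>x. norm (F x))" using F_int by simp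
    show "AE x in lborel. (\<lambda>n. F x * (iexp (fst x \<bullet> X n) * exp (- mu (X n) * snd x)))
        \<longlonglongrightarrow> F x * (iexp (fst x \<bullet> \<xi>0) * exp (- mu \<xi>0 * snd x))"
      by (intro AE_I2 tendsto_intros X isCont_tendsto_compose[OF mu_cont X])
    show "AE x in lborel. norm (F x * (iexp (fst x \<bullet> X n) * exp (- mu (X n) * snd x))) \<le> norm (F x)" for n
      by (rule AE_I2, rule fl_integrand_le)
  qed measurable
  then show "(fl \<circ> X) \<longlonglongrightarrow> fl \<xi>0" by (simp add: o_def)
qed

lemma fl_meas[measurable]: "fl \<in> borel_measurable borel"
  by (intro borel_measurable_continuous_onI) (simp add: fl_cont continuous_at_imp_continuous_on)

text \<open>Rellich: the superposition of oscillating plane waves with amplitude \<open>cnj \<circ> fl\<close> solves the homogeneous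
  equation, and pairing it with \<open>F\<close> gives \<open>\<integral>\<bar>fl\<bar>\<^sup>2\<close>.\<close>

lemma fl_zero_inside:
  assumes "norm \<xi> < sqrt lam" shows "fl \<xi> = 0"
proof -
  \<comment> \<open>Inside the ball this is \<open>- mu \<xi>\<close>; being purely imaginary, it
    gives a profile of modulus 1 on the whole t-line.\<close>
  define \<kappa> where "\<kappa> = (\<lambda>\<xi>::'a. - \<i> * complex_of_real (sqrt (max 0 (lam - (norm \<xi>)\<^sup>2))))"
  define a where "a = (\<lambda>\<xi>. complex_of_real (indicator (ball 0 (sqrt lam)) \<xi>) * cnj (fl \<xi>))"
  have [measurable]: "\<kappa> \<in> borel_measurable borel" unfolding \<kappa>_def by measurable
  have [measurable]: "cnj \<in> borel_measurable borel"
    by (intro borel_measurable_continuous_onI continuous_intros)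
  have am[measurable]: "a \<in> borel_measurable borel"
  proof -
    have "indicat_real (ball (0::'a) (sqrt lam)) \<in> borel_measurable borel" by (rule borel_measurable_indicator) simp
    then show ?thesis unfolding a_def by measurable
  qed
  have flb: "norm (fl \<xi>) \<le> (\<integral>x. norm (F x) \<partial>lborel)" for \<xi>
    unfolding fl_def by (rule norm_integral_le) (use F_int fl_integrand_le in auto)
  have sl: "norm \<xi> < sqrt lam \<longleftrightarrow> (norm \<xi>)\<^sup>2 < lam" for \<xi> :: 'a
    using lam real_less_rsqrt[of "norm \<xi>" lam] real_sqrt_less_iff[of "(norm \<xi>)\<^sup>2" lam] by auto
  have k: "norm (\<kappa> \<xi>) \<le> sqrt lam" for \<xi>
    using lam by (auto simp: \<kappa>_def norm_mult max_def)
  have a_int: "integrable lborel (\<lambda>\<xi>. (1 + norm \<xi>) ^ N * norm (a \<xi>))" for N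
  proof (rule Bochner_Integration.integrable_bound)
    show "integrable lborel (\<lambda>\<xi>::'a. ((1 + sqrt lam) ^ N * (\<integral>x. norm (F x) \<partial>lborel)) * indicator (ball 0 (sqrt lam)) \<xi>)"
      by (intro integrable_mult_right integrable_real_indicator) (use emeasure_bounded_finite[OF bounded_ball] in auto)
    show "AE \<xi> in lborel. norm ((1 + norm \<xi>) ^ N * norm (a \<xi>)) \<le>
       norm (((1 + sqrt lam) ^ N * (\<integral>x. norm (F x) \<partial>lborel)) * indicator (ball 0 (sqrt lam)) \<xi>)"
    proof (rule AE_I2)
      fix \<xi> :: 'a
      show "norm ((1 + norm \<xi>) ^ N * norm (a \<xi>)) \<le>
       norm (((1 + sqrt lam) ^ N * (\<integral>x. norm (F x) \<partial>lborel)) * indicator (ball 0 (sqrt lam)) \<xi>)"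
      proof (cases "norm \<xi> < sqrt lam")
        case True
        have "(1 + norm \<xi>) ^ N * norm (fl \<xi>) \<le> (1 + sqrt lam) ^ N * (\<integral>x. norm (F x) \<partial>lborel)"
          using True lam by (intro mult_mono power_mono flb) auto
        then show ?thesis using True lam by (simp add: a_def norm_mult abs_mult power_abs)
      qed (simp add: a_def)
    qed
  qed measurable
  \<comment> \<open>The Green identity wants a solution of the profile equation for every \<xi>.
    Beyond the sphere, where the amplitude \<open>a\<close> vanishes anyway, the zero profile is
    one.\<close>
  define W where "W = (\<lambda>j \<xi> t. if (norm \<xi>)\<^sup>2 \<le> lam then (\<kappa> \<xi>) ^ j * exp (\<kappa> \<xi> * complex_of_real t) else 0)"
  have W_meas: "(\<lambda>p. W j (fst p) (snd p)) \<in> borel_measurable (borel \<Otimes>\<^sub>M borel)" for j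
    unfolding W_def by measurable
  have W_ode: "W 2 \<xi> t = complex_of_real ((norm \<xi>)\<^sup>2 - lam) * W 0 \<xi> t - 0" for \<xi> t
    by (auto simp: W_def \<kappa>_def power_mult_distrib left_diff_distrib simp flip: of_real_power)
  have W_der: "(W j \<xi> has_vector_derivative W (Suc j) \<xi> t) (at t)" for j \<xi> t
  proof (cases "(norm \<xi>)\<^sup>2 \<le> lam")
    case True
    have "((\<lambda>t. \<kappa> \<xi> ^ j * exp (\<kappa> \<xi> * complex_of_real t)) has_vector_derivative \<kappa> \<xi> ^ Suc j * exp (\<kappa> \<xi> * complex_of_real t)) (at t)"
      by (rule has_vector_derivative_real_field) (auto intro!: derivative_eq_intros simp: mult_ac)
    then show ?thesis using True by (simp add: W_def[abs_def])
  qed (simp add: W_def[abs_def])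
  have W_bd: "norm (W j \<xi> t) \<le> (sqrt lam) ^ j" for j \<xi> t
  proof -
    have "norm (exp (\<kappa> \<xi> * complex_of_real t)) = 1" by (simp add: \<kappa>_def)
    then have "norm (\<kappa> \<xi> ^ j * exp (\<kappa> \<xi> * complex_of_real t)) \<le> (sqrt lam) ^ j"
      unfolding norm_mult norm_power by (simp only: mult_1_right power_mono[OF k norm_ge_zero])
    then show ?thesis using lam by (simp add: W_def)
  qed
  have ab: "norm (a \<xi>) \<le> (\<integral>x. norm (F x) \<partial>lborel)" for \<xi>
    using flb[of \<xi>] by (auto simp: a_def norm_mult split: split_indicator)
  have "(\<integral>x. u x * ((\<integral>\<xi>. a \<xi> * iexp (fst x \<bullet> \<xi>) \<partial>lborel) * 0) \<partial>lborel) =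
    (\<integral>\<xi>. a \<xi> * (\<integral>x. F x * (iexp (fst x \<bullet> \<xi>) * W 0 \<xi> (snd x)) \<partial>lborel) \<partial>lborel)"
    by (rule green_slices[where c = "\<lambda>j. sqrt lam ^ j" and h = "\<lambda>_. 0", OF am ab a_int W_der W_bd W_meas W_ode]) simp
  also have "\<dots> = (\<integral>\<xi>. complex_of_real (indicator (ball 0 (sqrt lam)) \<xi> * (norm (fl \<xi>))\<^sup>2) \<partial>lborel)"
  proof (rule Bochner_Integration.integral_cong[OF refl])
    fix \<xi> :: 'a
    show "a \<xi> * (\<integral>x. F x * (iexp (fst x \<bullet> \<xi>) * W 0 \<xi> (snd x)) \<partial>lborel) =
       complex_of_real (indicator (ball 0 (sqrt lam)) \<xi> * (norm (fl \<xi>))\<^sup>2)"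
    proof (cases "norm \<xi> < sqrt lam")
      case True
      then have "W 0 \<xi> t = exp (- mu \<xi> * t)" for t
        using sl[of \<xi>] by (auto simp: W_def \<kappa>_def mu_def complex_eq_iff Re_exp Im_exp max_def)
      then have "(\<integral>x. F x * (iexp (fst x \<bullet> \<xi>) * W 0 \<xi> (snd x)) \<partial>lborel) = fl \<xi>"
        unfolding fl_def by simp
      then show ?thesis using True complex_norm_square[of "fl \<xi>"] by (simp add: a_def mult.commute)
    qed (simp add: a_def)
  qed
  finally have "0 = complex_of_real (\<integral>\<xi>. indicator (ball 0 (sqrt lam)) \<xi> * (norm (fl \<xi>))\<^sup>2 \<partial>lborel)"
    by (simp only: integral_complex_of_real mult_zero_right integral_zero)
  then have z: "(\<integral>\<xi>. indicator (ball 0 (sqrt lam)) \<xi> * (norm (fl \<xi>))\<^sup>2 \<partial>lborel) = 0"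
    using of_real_eq_0_iff by metis
  have "integrable lborel (\<lambda>\<xi>. indicator (ball 0 (sqrt lam)) \<xi> * (norm (fl \<xi>))\<^sup>2)"
  proof (rule Bochner_Integration.integrable_bound[OF integrable_mult_right[OF a_int[of 0], of "\<integral>x. norm (F x) \<partial>lborel"]])
    show "(\<lambda>\<xi>. indicator (ball 0 (sqrt lam)) \<xi> * (norm (fl \<xi>))\<^sup>2) \<in> borel_measurable lborel"
      by (rule measurable_ball_mult) measurable
    show "AE \<xi> in lborel. norm (indicator (ball 0 (sqrt lam)) \<xi> * (norm (fl \<xi>))\<^sup>2) \<le>
        norm ((\<integral>x. norm (F x) \<partial>lborel) * ((1 + norm \<xi>) ^ 0 * norm (a \<xi>)))"
      using flb by (intro AE_I2) (auto simp: a_def norm_mult abs_mult power2_eq_square split: split_indicator intro!: mult_right_mono order_trans[OF flb])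
  qed
  then have ae: "AE \<xi> in lborel. indicator (ball 0 (sqrt lam)) \<xi> * (norm (fl \<xi>))\<^sup>2 = 0"
    using z by (subst (asm) integral_nonneg_eq_0_iff_AE) auto
  show ?thesis
  proof (rule ccontr)
    assume nz: "fl \<xi> \<noteq> 0"
    define S where "S = (fl -` (- {0})) \<inter> ball 0 (sqrt lam)"
    have S: "open S"
      unfolding S_def by (intro open_Int open_vimage continuous_at_imp_continuous_on ballI fl_cont) auto
    have "AE \<xi> in lborel. \<xi> \<notin> S"
      using ae by eventually_elim (auto simp: S_def)
    then have "S \<in> null_sets lborel"
      using S by (subst AE_iff_null_sets) auto
    then have "negligible S" by (simp add: negligible_iff_null_sets null_sets_completionI)
    moreover have "\<xi> \<in> S" using nz assms by (simp add: S_def)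
    ultimately show False using open_not_negligible[OF S] by blast
  qed
qed

end

lemma Im_cos_sin:
  "Im (cos z) = sin (Re z) * ((exp (- Im z) - exp (Im z)) / 2)"
  "Im (sin z) = cos (Re z) * ((exp (Im z) - exp (- Im z)) / 2)"
  by (simp_all add: Im_cos Im_sin)

lemma norm_sin_cos_le:
  "norm (cos z) \<le> cosh (Im z)" "norm (sin z) \<le> cosh (Im z)"
proof -
  have e: "norm (exp (\<i> * z)) = exp (- Im z)" "norm (exp (- (\<i> * z))) = exp (Im z)" by simp_all
  have "norm (cos z) = norm (exp (\<i> * z) + exp (- (\<i> * z))) / 2" by (simp add: cos_exp_eq norm_divide)
  also have "\<dots> \<le> (norm (exp (\<i> * z)) + norm (exp (- (\<i> * z)))) / 2"
    by (intro divide_right_mono norm_triangle_ineq) simp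
  finally show "norm (cos z) \<le> cosh (Im z)" unfolding e by (simp add: cosh_field_def add.commute)
  have "norm (sin z) = norm (exp (\<i> * z) - exp (- (\<i> * z))) / 2" by (simp add: sin_exp_eq norm_divide norm_mult)
  also have "\<dots> \<le> (norm (exp (\<i> * z)) + norm (exp (- (\<i> * z)))) / 2"
    by (intro divide_right_mono norm_triangle_ineq4) simp
  finally show "norm (sin z) \<le> cosh (Im z)" unfolding e by (simp add: cosh_field_def add.commute)
qed

context helmholtz begin

text \<open>The quadric \<open>\<zeta> \<bullet> \<zeta> = lam\<close> is uniformised by \<open>(sqrt lam * cos z, sqrt lam * sin z)\<close>: real \<open>z\<close> gives
  oscillating waves, negative imaginary \<open>z\<close> gives waves decaying in \<open>t\<close>, and the exponential
  decay of \<open>F\<close> makes the transform holomorphic near the union of both segments.\<close>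

lemma fl_zero_outside:
  assumes \<xi>: "norm \<xi> \<ge> sqrt lam" shows "fl \<xi> = 0"
proof -
  define k where "k = sqrt lam"
  have k: "k > 0" and kk: "k * k = lam" using lam by (simp_all add: k_def)
  \<comment> \<open>Fixing the direction of \<xi> leaves the single parameter |\<xi>| to be
    complexified.\<close>
  define \<omega> where "\<omega> = \<xi> /\<^sub>R norm \<xi>"
  have n0: "norm \<xi> > 0" using \<xi> k unfolding k_def by linarith
  have \<omega>: "norm \<omega> = 1" using n0 by (simp add: \<omega>_def)
  \<comment> \<open>The target \<xi> will correspond to the parameter z = -i \<tau>, because cos(-i
    \<tau>) = cosh \<tau>.\<close>
  define \<tau> where "\<tau> = arcosh (norm \<xi> / k)"
  have rk: "norm \<xi> / k \<ge> 1" using \<xi> k by (simp add: k_def)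
  have \<tau>: "cosh \<tau> = norm \<xi> / k" "\<tau> \<ge> 0" using rk by (simp_all add: \<tau>_def)
  define M where "M = cosh (\<tau> + 1)"
  have M: "M \<ge> 1" unfolding M_def by (rule cosh_real_ge_1)
  \<comment> \<open>The exponents used below have components of norm \<delta> in the tangential and
    in the normal direction, so their norm is at most 2 \<delta> = \<gamma>/2, within reach of
    \<open>F_exp\<close>.\<close>
  define \<delta> where "\<delta> = \<gamma> / 4"
  have \<delta>: "\<delta> > 0" using gam by (simp add: \<delta>_def)
  \<comment> \<open>\<open>M\<close> bounds cosh(Im z) on the rectangle \<open>S\<close> defined
    next. With this width, |Im cos z| and Im sin z are at most 2 \<epsilon> M there, and hence at
    most \<delta> after multiplication by k.\<close>
  define \<epsilon> where "\<epsilon> = min 1 (\<delta> / (2 * k * M))"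
  have \<epsilon>: "\<epsilon> > 0" "\<epsilon> \<le> 1" "2 * k * (\<epsilon> * M) \<le> \<delta>"
  proof -
    show "\<epsilon> > 0" "\<epsilon> \<le> 1" using \<delta> k M by (simp_all add: \<epsilon>_def)
    have "\<epsilon> \<le> \<delta> / (2 * k * M)" by (simp add: \<epsilon>_def)
    then show "2 * k * (\<epsilon> * M) \<le> \<delta>" using k M by (simp add: field_simps)
  qed
  \<comment> \<open>A thin rectangle around the segment from 0 to -i \<tau>, containing also the
    real interval from 0 to \<epsilon>.\<close>
  define S where "S = box (Complex (- \<epsilon>) (- (\<tau> + 1))) (Complex \<epsilon> \<epsilon>)"
  have S_iff: "z \<in> S \<longleftrightarrow> - \<epsilon> < Re z \<and> Re z < \<epsilon> \<and> - (\<tau> + 1) < Im z \<and> Im z < \<epsilon>" for z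
    by (auto simp: S_def in_box_complex_iff)
  have S: "open S" "connected S"
    unfolding S_def by (rule open_box, rule convex_connected[OF convex_box(2)])
  have cosh_le: "cosh (Im z) \<le> M" if "z \<in> S" for z
  proof -
    have "\<bar>Im z\<bar> \<le> \<tau> + 1" using that \<epsilon> \<tau> by (auto simp: S_iff)
    then have "cosh \<bar>Im z\<bar> \<le> cosh (\<tau> + 1)" using \<tau> by (subst cosh_real_nonneg_le_iff) auto
    then show ?thesis by (simp add: M_def)
  qed
  have Imcos: "\<bar>Im (cos z)\<bar> \<le> \<epsilon> * M" if z: "z \<in> S" for z
  proof -
    have "\<bar>sin (Re z)\<bar> \<le> \<epsilon>" using abs_sin_x_le_abs_x[of "Re z"] z by (auto simp: S_iff)
    moreover have "\<bar>(exp (- Im z) - exp (Im z)) / 2\<bar> \<le> cosh (Im z)"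
      by (simp add: cosh_field_def abs_le_iff)
    then have "\<bar>(exp (- Im z) - exp (Im z)) / 2\<bar> \<le> M" using cosh_le[OF z] by linarith
    ultimately show ?thesis unfolding Im_cos_sin abs_mult using \<epsilon> by (intro mult_mono) auto
  qed
  \<comment> \<open>An upper bound is enough because t \<ge> 0 where \<open>F\<close> lives. For Im
    z \<le> 0 the quantity is even nonpositive, so the rectangle may extend downwards as far as
    desired; only its small part above the real axis costs anything.\<close>
  have Imsin: "Im (sin z) \<le> 2 * (\<epsilon> * M)" if z: "z \<in> S" for z
  proof -
    have "\<bar>Re z\<bar> < 1" using z \<epsilon> by (auto simp: S_iff)
    then have c: "0 \<le> cos (Re z)" using pi_gt3 by (intro cos_ge_zero) auto
    show ?thesis
    proof (cases "Im z \<le> 0")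
      case True
      then have "exp (Im z) - exp (- Im z) \<le> 0" by simp
      then have "Im (sin z) \<le> 0" unfolding Im_cos_sin using c by (intro mult_nonneg_nonpos) auto
      moreover have "0 \<le> 2 * (\<epsilon> * M)" using \<epsilon> M by simp
      ultimately show ?thesis by linarith
    next
      case False
      then have b: "0 \<le> Im z" "Im z \<le> 1" "Im z \<le> \<epsilon>" using z \<epsilon> by (auto simp: S_iff)
      have "exp (Im z) \<le> 1 + Im z + (Im z)\<^sup>2" by (rule exp_bound) (use b in auto)
      moreover have "(Im z)\<^sup>2 \<le> Im z" using b by (simp add: power2_eq_square mult_left_le)
      moreover have "1 - Im z \<le> exp (- Im z)" using exp_ge_add_one_self[of "- Im z"] by simp
      ultimately have "exp (Im z) - exp (- Im z) \<le> 4 * \<epsilon>" using b by linarith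
      then have s: "(exp (Im z) - exp (- Im z)) / 2 \<le> 2 * \<epsilon>" by simp
      have "Im (sin z) \<le> cos (Re z) * (2 * \<epsilon>)" unfolding Im_cos_sin by (rule mult_left_mono[OF s c])
      also have "\<dots> \<le> 1 * (2 * \<epsilon>)" using \<epsilon> by (intro mult_right_mono) auto
      also have "\<dots> \<le> 2 * (\<epsilon> * M)" using \<epsilon> M by simp
      finally show ?thesis .
    qed
  qed
  define X where "X = (\<lambda>z (x :: 'a \<times> real). \<i> * k * cos z * complex_of_real (fst x \<bullet> \<omega>) - \<i> * k * sin z * complex_of_real (snd x))"
  \<comment> \<open>Two exponentials, one for each sign of \<open>fst x \<bullet> \<omega>\<close>,
    replace the exponential of an absolute value, to which \<open>F_exp\<close> does not apply
    directly.\<close>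
  define e where "e = (\<lambda>x::'a \<times> real. exp (x \<bullet> (\<delta> *\<^sub>R \<omega>, \<delta>)) + exp (x \<bullet> (- (\<delta> *\<^sub>R \<omega>), \<delta>)))"
  have Xe: "norm (exp (X z x)) \<le> e x" if z: "z \<in> S" and t: "snd x \<ge> 0" for z x
  proof -
    have "Re (X z x) = - (k * Im (cos z) * (fst x \<bullet> \<omega>)) + k * Im (sin z) * snd x"
      by (simp add: X_def)
    also have "\<dots> \<le> \<delta> * \<bar>fst x \<bullet> \<omega>\<bar> + \<delta> * snd x"
    proof (rule add_mono)
      have "k * Im (sin z) \<le> k * (2 * (\<epsilon> * M))" using Imsin[OF z] k by (intro mult_left_mono) auto
      then have "k * Im (sin z) \<le> \<delta>" using \<epsilon>(3) by (simp add: mult_ac)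
      then show "k * Im (sin z) * snd x \<le> \<delta> * snd x" using t by (rule mult_right_mono)
      have "\<bar>k * Im (cos z)\<bar> \<le> k * (\<epsilon> * M)" unfolding abs_mult using Imcos[OF z] k by (simp add: mult_left_mono)
      moreover have "k * (\<epsilon> * M) \<ge> 0" using k \<epsilon> M by simp
      ultimately have "\<bar>k * Im (cos z)\<bar> \<le> \<delta>" using \<epsilon>(3) by linarith
      then have "\<bar>k * Im (cos z)\<bar> * \<bar>fst x \<bullet> \<omega>\<bar> \<le> \<delta> * \<bar>fst x \<bullet> \<omega>\<bar>" by (rule mult_right_mono) simp
      then show "- (k * Im (cos z) * (fst x \<bullet> \<omega>)) \<le> \<delta> * \<bar>fst x \<bullet> \<omega>\<bar>"
        using abs_ge_minus_self[of "k * Im (cos z) * (fst x \<bullet> \<omega>)"] by (simp add: abs_mult)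
    qed
    finally have "exp (Re (X z x)) \<le> exp (\<delta> * \<bar>fst x \<bullet> \<omega>\<bar> + \<delta> * snd x)" by simp
    also have "\<dots> \<le> e x"
    proof (cases "fst x \<bullet> \<omega> \<ge> 0")
      case True then show ?thesis by (simp add: e_def inner_prod_def mult.commute)
    next
      case False then show ?thesis by (simp add: e_def inner_prod_def mult.commute)
    qed
    finally show ?thesis by simp
  qed
  have n1: "norm (\<delta> *\<^sub>R \<omega>, \<delta>) < \<gamma>" "norm (- (\<delta> *\<^sub>R \<omega>), \<delta>) < \<gamma>"
    using norm_Pair_le[of "\<delta> *\<^sub>R \<omega>" \<delta>] norm_Pair_le[of "- (\<delta> *\<^sub>R \<omega>)" \<delta>] \<omega> \<delta> by (auto simp: \<delta>_def)
  have ei: "integrable lborel (\<lambda>x. (1 + (norm x)\<^sup>2) * norm (F x) * e x)"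
    using Bochner_Integration.integrable_add[OF F_exp[OF n1(1)] F_exp[OF n1(2)]]
    by (simp add: e_def distrib_left)
  have e0: "e x \<ge> 0" for x by (simp add: e_def add_nonneg_nonneg)
  have Fe: "norm (F x * exp (X z x)) \<le> norm (F x) * e x" if "z \<in> S" for z x
  proof (cases "snd x < 0")
    case True
    then have "F x = 0" using F_supp[of "snd x" "fst x"] by simp
    then show ?thesis by simp
  next
    case False then show ?thesis using Xe[OF that, of x] by (simp add: norm_mult mult_left_mono del: norm_exp_eq_Re)
  qed
  have Xm[measurable]: "(\<lambda>x. X z x) \<in> borel_measurable borel" for z unfolding X_def by measurable
  define \<Theta> where "\<Theta> = (\<lambda>z. \<integral>x. F x * exp (X z x) \<partial>lborel)"
  have \<Theta>i: "integrable lborel (\<lambda>x. F x * exp (X z x))" if "z \<in> S" for z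
  proof (rule Bochner_Integration.integrable_bound[OF ei])
    show "AE x in lborel. norm (F x * exp (X z x)) \<le> norm ((1 + (norm x)\<^sup>2) * norm (F x) * e x)"
    proof (rule AE_I2)
      fix x
      have "1 * (norm (F x) * e x) \<le> (1 + (norm x)\<^sup>2) * (norm (F x) * e x)"
        using e0 by (intro mult_right_mono) auto
      then show "norm (F x * exp (X z x)) \<le> norm ((1 + (norm x)\<^sup>2) * norm (F x) * e x)"
        using Fe[OF that, of x] e0[of x] by (simp add: mult.assoc abs_mult)
    qed
  qed measurable
  define X' where "X' = (\<lambda>z (x :: 'a \<times> real). - \<i> * k * sin z * complex_of_real (fst x \<bullet> \<omega>) - \<i> * k * cos z * complex_of_real (snd x))"
  have X'm[measurable]: "(\<lambda>x. X' z x) \<in> borel_measurable borel" for z unfolding X'_def by measurable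
  \<comment> \<open>The derivative of the exponent grows like |x|. The inequality 2 |x| \<le> 1 +
    |x|^2 hands this over to the weight in the decay hypothesis.\<close>
  have X'b: "norm (X' z x) \<le> k * M * (1 + (norm x)\<^sup>2)" if z: "z \<in> S" for z x
  proof -
    have s: "\<bar>fst x \<bullet> \<omega>\<bar> \<le> norm x"
      using Cauchy_Schwarz_ineq2[of "fst x" \<omega>] \<omega> norm_fst_le[of "fst x" "snd x"] by simp
    have t: "\<bar>snd x\<bar> \<le> norm x" using norm_snd_le[of "snd x" "fst x"] by simp
    have "norm (X' z x) \<le> k * norm (sin z) * \<bar>fst x \<bullet> \<omega>\<bar> + k * norm (cos z) * \<bar>snd x\<bar>"
      unfolding X'_def by (rule order_trans[OF norm_triangle_ineq4]) (use k in \<open>simp add: norm_mult\<close>)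
    also have "\<dots> \<le> k * M * norm x + k * M * norm x"
      using norm_sin_cos_le[of z] cosh_le[OF z] k M s t
      by (intro add_mono mult_mono mult_left_mono) auto
    also have "\<dots> = k * M * (2 * norm x)" by simp
    also have "\<dots> \<le> k * M * (1 + (norm x)\<^sup>2)"
      using sum_squares_bound[of "norm x" 1] k M by (intro mult_left_mono) auto
    finally show ?thesis .
  qed
  have der: "(\<Theta> has_field_derivative (\<integral>x. F x * (exp (X z x) * X' z x) \<partial>lborel)) (at z)" if z: "z \<in> S" for z
  proof -
    obtain r where r: "r > 0" "ball z r \<subseteq> S" using S(1) z open_contains_ball by blast
    have "((\<lambda>z. \<integral>x. F x * exp (X z x) \<partial>lborel) has_derivative (\<lambda>h. \<integral>x. (F x * (exp (X z x) * X' z x)) * h \<partial>lborel)) (at z)"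
    proof (rule has_derivative_integral[OF r(1), where f' = "\<lambda>z x h. (F x * (exp (X z x) * X' z x)) * h"
          and B = "\<lambda>x. k * M * ((1 + (norm x)\<^sup>2) * norm (F x) * e x)"])
      fix w x assume w: "w \<in> ball z r"
      have "((\<lambda>z. F x * exp (X z x)) has_field_derivative F x * (exp (X w x) * X' w x)) (at w)"
        unfolding X_def X'_def by (auto intro!: derivative_eq_intros simp: algebra_simps)
      then show "((\<lambda>z. F x * exp (X z x)) has_derivative (\<lambda>h. (F x * (exp (X w x) * X' w x)) * h)) (at w)"
        by (simp add: has_field_derivative_def)
    next
      fix w h :: complex and x assume w: "w \<in> ball z r"
      have "norm (F x * exp (X w x)) * norm (X' w x) \<le> (norm (F x) * e x) * (k * M * (1 + (norm x)\<^sup>2))"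
        using w r e0 by (intro mult_mono Fe X'b) auto
      then have "norm (F x * exp (X w x)) * norm (X' w x) * norm h \<le> (norm (F x) * e x) * (k * M * (1 + (norm x)\<^sup>2)) * norm h"
        by (rule mult_right_mono) simp
      then show "norm ((F x * (exp (X w x) * X' w x)) * h) \<le> k * M * ((1 + (norm x)\<^sup>2) * norm (F x) * e x) * norm h"
        by (simp only: norm_mult mult_ac)
    next
      show "integrable lborel (\<lambda>x. k * M * ((1 + (norm x)\<^sup>2) * norm (F x) * e x))"
        by (intro integrable_mult_right ei)
      show "0 \<le> k * M * ((1 + (norm x)\<^sup>2) * norm (F x) * e x)" for x using k M e0[of x] by simp
      show "(\<lambda>x. F x * (exp (X z x) * X' z x) * h) \<in> borel_measurable lborel" for h by measurable
      show "integrable lborel (\<lambda>x. F x * exp (X w x))" if "w \<in> ball z r" for w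
        by (rule \<Theta>i) (use that r in auto)
    qed
    then show ?thesis unfolding has_field_derivative_def \<Theta>_def by (simp only: integral_mult_left_zero)
  qed
  have hol: "\<Theta> holomorphic_on S"
    using der S(1) by (subst holomorphic_on_open) auto
  have zero: "\<Theta> z = 0" if zU: "z \<in> complex_of_real ` {0<..<\<epsilon>}" for z
  proof -
    obtain \<theta> where \<theta>: "z = complex_of_real \<theta>" "0 < \<theta>" "\<theta> < \<epsilon>" using zU by auto
    have th1: "\<theta> < 1" using \<theta> \<epsilon> by linarith
    have c: "0 < cos \<theta>" "cos \<theta> < 1" "0 < sin \<theta>"
      using \<theta> th1 pi_gt3 cos_monotone_0_pi[of 0 \<theta>] by (auto intro!: cos_gt_zero_pi sin_gt_zero)
    \<comment> \<open>A small real angle \<theta> > 0 gives a frequency of norm k cos \<theta> < k,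
      where the transform is already known to vanish.\<close>
    define \<eta> where "\<eta> = (k * cos \<theta>) *\<^sub>R \<omega>"
    have n\<eta>: "norm \<eta> = k * cos \<theta>" using k c \<omega> by (simp add: \<eta>_def)
    have sq: "(norm \<eta>)\<^sup>2 = lam * (cos \<theta>)\<^sup>2" "(norm \<eta>)\<^sup>2 = lam - (k * sin \<theta>)\<^sup>2"
    proof -
      show "(norm \<eta>)\<^sup>2 = lam * (cos \<theta>)\<^sup>2" unfolding n\<eta> power_mult_distrib using kk by (simp add: power2_eq_square)
      then show "(norm \<eta>)\<^sup>2 = lam - (k * sin \<theta>)\<^sup>2"
        unfolding power_mult_distrib cos_squared_eq using kk by (simp add: power2_eq_square algebra_simps)
    qed
    have "mu \<eta> = \<i> * complex_of_real (k * sin \<theta>)"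
      unfolding mu_def sq(2) using k c by (simp add: complex_eq_iff max_def)
    then have "X z x = \<i> * complex_of_real (fst x \<bullet> \<eta>) + - mu \<eta> * complex_of_real (snd x)" for x
      by (simp add: X_def \<eta>_def \<theta>(1) cos_of_real sin_of_real mult_ac)
    then have "exp (X z x) = iexp (fst x \<bullet> \<eta>) * exp (- mu \<eta> * snd x)" for x
      by (simp only: exp_add)
    then have "\<Theta> z = fl \<eta>" by (simp only: \<Theta>_def fl_def)
    also have "\<dots> = 0" by (rule fl_zero_inside) (use n\<eta> k c in \<open>simp add: k_def\<close>)
    finally show ?thesis .
  qed
  \<comment> \<open>The zeros accumulate at z = 0, the turning point, which is interior to
    \<open>S\<close>.\<close>
  have lp: "0 islimpt (complex_of_real ` {0<..<\<epsilon>})"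
    unfolding islimpt_approachable
  proof (intro allI impI)
    fix d :: real assume d: "d > 0"
    show "\<exists>x'\<in>complex_of_real ` {0<..<\<epsilon>}. x' \<noteq> 0 \<and> dist x' 0 < d"
      using d \<epsilon> by (intro bexI[of _ "complex_of_real (min (\<epsilon> / 2) (d / 2))"]) (auto simp: min_def)
  qed
  define w where "w = Complex 0 (- \<tau>)"
  have "\<Theta> w = 0"
  proof (rule analytic_continuation[OF hol S _ _ lp zero])
    show "complex_of_real ` {0<..<\<epsilon>} \<subseteq> S" using \<epsilon> \<tau> by (auto simp: S_iff)
    show "0 \<in> S" "w \<in> S" using \<epsilon> \<tau> by (auto simp: S_iff w_def)
  qed
  moreover have "exp (X w x) = iexp (fst x \<bullet> \<xi>) * exp (- mu \<xi> * snd x)" for x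
  proof -
    have cw: "cos w = complex_of_real (cosh \<tau>)"
      by (simp add: complex_eq_iff Re_cos Im_cos w_def cosh_field_def)
    have sw: "sin w = - \<i> * complex_of_real (sinh \<tau>)"
      by (simp add: complex_eq_iff Re_sin Im_sin w_def sinh_field_def field_simps)
    have "(norm \<xi>)\<^sup>2 = lam * (cosh \<tau>)\<^sup>2" unfolding \<tau>(1) using k kk lam by (simp add: power_divide power2_eq_square)
    then have "(norm \<xi>)\<^sup>2 = lam + (k * sinh \<tau>)\<^sup>2"
      unfolding cosh_square_eq power_mult_distrib using kk by (simp add: power2_eq_square algebra_simps)
    then have "mu \<xi> = complex_of_real (k * sinh \<tau>)"
      unfolding mu_def using k \<tau>(2) by (simp add: complex_eq_iff max_def)
    moreover have "k * cosh \<tau> * (fst x \<bullet> \<omega>) = fst x \<bullet> \<xi>"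
      using k n0 unfolding \<tau>(1) by (simp add: \<omega>_def)
    then have "complex_of_real k * complex_of_real (cosh \<tau>) * complex_of_real (fst x \<bullet> \<omega>) = complex_of_real (fst x \<bullet> \<xi>)"
      by (simp only: of_real_mult[symmetric])
    ultimately have "X w x = \<i> * complex_of_real (fst x \<bullet> \<xi>) + - mu \<xi> * complex_of_real (snd x)"
      unfolding X_def cw sw by (simp add: mult.assoc mult.left_commute[of "complex_of_real k" \<i>])
    then show ?thesis by (simp only: exp_add)
  qed
  ultimately show ?thesis by (simp only: \<Theta>_def fl_def)
qed

lemma fl_zero: "fl \<xi> = 0"
  using fl_zero_inside fl_zero_outside by (cases "norm \<xi> < sqrt lam") auto

end

subsection \<open>Annihilation of Gaussian wave packets in the lower half-space\<close>

lemma mass_mono: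
  assumes "u \<in> Bstar0" "R \<le> R'" shows "mass u R \<le> mass u R'"
  unfolding mass_def
  by (rule integral_mono[OF Bstar0_mass(1)[OF assms(1)] Bstar0_mass(1)[OF assms(1)]])
    (use assms(2) in \<open>auto split: split_indicator\<close>)

text \<open>The condition o(R) recast as an affine bound of arbitrarily small slope. Unlike the
  limit, it holds for all R \<ge> 0 and can be summed over shells.\<close>

lemma mass_affine_bound:
  assumes u: "u \<in> Bstar0" and e: "e > 0"
  obtains A where "A \<ge> 0" "\<And>R. R \<ge> 0 \<Longrightarrow> mass u R \<le> A + e * R"
proof -
  have "\<forall>\<^sub>F R in at_top. dist (mass u R / R) 0 < e"
    using Bstar0_mass(2)[OF u] e tendstoD by blast
  then obtain R0 where R0: "\<And>R. R \<ge> R0 \<Longrightarrow> \<bar>mass u R / R\<bar> < e"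
    unfolding eventually_at_top_linorder by auto
  define R1 where "R1 = max R0 1"
  have "mass u R \<le> mass u R1 + e * R" if R: "R \<ge> 0" for R
  proof (cases "R \<le> R1")
    case True
    then show ?thesis using mass_mono[OF u True] mult_nonneg_nonneg[of e R] e R by linarith
  next
    case False
    then have "R > 0" "\<bar>mass u R / R\<bar> < e" using R0[of R] by (auto simp: R1_def)
    then have "mass u R \<le> e * R" by (simp add: field_simps)
    then show ?thesis using mass_nonneg[of u R1] by linarith
  qed
  then show ?thesis using that mass_nonneg by blast
qed

text \<open>A strip is unbounded in y, so the weight e^{-|y|} is split into the shells k \<le> |y| <
  k + 1. The k-th shell lies in a ball of radius k + 1 + T, and e^{-k} beats the growth of the mass
  in k, leaving an affine bound in T.\<close>

lemma strip_mass:
  fixes u :: "'a::euclidean_space \<times> real \<Rightarrow> complex"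
  assumes u: "u \<in> Bstar0" and e: "e > 0"
  shows "\<exists>A\<ge>0. \<forall>T\<ge>0. (\<integral>\<^sup>+x. ennreal ((norm (u x))\<^sup>2 * (exp (- norm (fst x)) * indicator {-T..T} (snd x))) \<partial>lborel) \<le> ennreal (A + e * T)"
proof -
  have [measurable]: "u \<in> borel_measurable borel" by (rule Bstar0_measurable[OF u])
  define q where "q = exp (- 1 / 2 :: real)"
  have q: "0 < q" "q < 1" by (simp_all add: q_def)
  \<comment> \<open>The sum of the shell weights; the slope of the affine bound is divided by
    \<open>c\<close> beforehand, so that it comes out as \<open>e\<close>.\<close>
  define c where "c = (\<Sum>k. 2 * q ^ k)"
  have cs: "summable (\<lambda>k. 2 * q ^ k)" using q by (intro summable_mult summable_geometric) simp
  have c: "c > 0" unfolding c_def using q by (intro suminf_pos cs) auto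
  have ek: "exp (- real k) * (1 + real k) \<le> 2 * q ^ k" for k
  proof -
    have "2 * (1 + real k / 2) \<le> 2 * exp (real k / 2)" by (intro mult_left_mono exp_ge_add_one_self) simp
    then have "1 + real k \<le> 2 * exp (real k / 2)" by simp
    then have "exp (- real k) * (1 + real k) \<le> exp (- real k) * (2 * exp (real k / 2))"
      by (intro mult_left_mono) auto
    also have "\<dots> = 2 * exp (- real k + real k / 2)" unfolding exp_add by simp
    also have "- real k + real k / 2 = real k * (- 1 / 2)" by simp
    also have "exp (real k * (- 1 / 2)) = q ^ k" unfolding q_def by (rule exp_of_nat_mult)
    finally show ?thesis .
  qed
  obtain A where A: "A \<ge> 0" "\<And>R. R \<ge> 0 \<Longrightarrow> mass u R \<le> A + e / c * R"
    using mass_affine_bound[OF u, of "e / c"] e c by auto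
  have "(\<integral>\<^sup>+x. ennreal ((norm (u x))\<^sup>2 * (exp (- norm (fst x)) * indicator {-T..T} (snd x))) \<partial>lborel) \<le> ennreal (c * (A + e / c) + e * T)"
    if T: "T \<ge> 0" for T
  proof -
    define B where "B = A + e / c + e / c * T"
    have B: "B \<ge> 0" using A e c T by (simp add: B_def)
    have "(\<integral>\<^sup>+x. ennreal ((norm (u x))\<^sup>2 * (exp (- norm (fst x)) * indicator {-T..T} (snd x))) \<partial>lborel)
      \<le> (\<integral>\<^sup>+x. (\<Sum>k. ennreal (exp (- real k)) * (ennreal ((norm (u x))\<^sup>2) * indicator (ball 0 (real k + 1 + T)) x)) \<partial>lborel)"
    proof (rule nn_integral_mono)
      fix x :: "'a \<times> real"
      define k where "k = nat \<lfloor>norm (fst x)\<rfloor>"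
      have k: "real k \<le> norm (fst x)" "norm (fst x) < real k + 1"
        unfolding k_def by (simp_all add: of_nat_nat)
      show "ennreal ((norm (u x))\<^sup>2 * (exp (- norm (fst x)) * indicator {-T..T} (snd x))) \<le>
        (\<Sum>k. ennreal (exp (- real k)) * (ennreal ((norm (u x))\<^sup>2) * indicator (ball 0 (real k + 1 + T)) x))"
      proof (cases "\<bar>snd x\<bar> \<le> T")
        case True
        have "norm x \<le> norm (fst x) + \<bar>snd x\<bar>" using norm_Pair_le[of "fst x" "snd x"] by simp
        then have "x \<in> ball 0 (real k + 1 + T)" using True k by simp
        then have "ennreal ((norm (u x))\<^sup>2 * (exp (- norm (fst x)) * indicator {-T..T} (snd x)))
           \<le> ennreal (exp (- real k) * (norm (u x))\<^sup>2)"
          using True k by (intro ennreal_leI) (simp add: abs_le_iff mult.commute, intro mult_right_mono, auto)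
        also have "\<dots> = ennreal (exp (- real k)) * (ennreal ((norm (u x))\<^sup>2) * indicator (ball 0 (real k + 1 + T)) x)"
          using \<open>x \<in> ball 0 (real k + 1 + T)\<close> by (simp add: ennreal_mult)
        also have "\<dots> \<le> (\<Sum>k. ennreal (exp (- real k)) * (ennreal ((norm (u x))\<^sup>2) * indicator (ball 0 (real k + 1 + T)) x))"
          using sum_le_suminf[of "\<lambda>k. ennreal (exp (- real k)) * (ennreal ((norm (u x))\<^sup>2) * indicator (ball 0 (real k + 1 + T)) x)" "{k}"] by simp
        finally show ?thesis .
      next
        case False
        then have "snd x \<notin> {-T..T}" by (auto simp: abs_le_iff)
        then show ?thesis by simp
      qed
    qed
    also have "\<dots> = (\<Sum>k. ennreal (exp (- real k)) * ennreal (mass u (real k + 1 + T)))"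
    proof -
      have [measurable]: "(\<lambda>x. ennreal ((norm (u x))\<^sup>2) * indicator (ball 0 r) x) \<in> borel_measurable lborel" for r
        by (intro borel_measurable_times_ennreal borel_measurable_indicator) auto
      show ?thesis
        by (subst nn_integral_suminf) (auto simp: nn_integral_cmult Bstar0_mass(3)[OF u])
    qed
    also have "\<dots> \<le> (\<Sum>k. ennreal (2 * q ^ k * B))"
    proof (rule suminf_le)
      fix k
      have "mass u (real k + 1 + T) \<le> A + e / c * (real k + 1 + T)" using A(2) T by simp
      also have "\<dots> \<le> (1 + real k) * B"
      proof -
        have "(1 + real k) * B - (A + e / c * (real k + 1 + T)) = real k * A + real k * (e / c) * T"
          unfolding B_def by (simp add: algebra_simps add_divide_distrib)
        moreover have "\<dots> \<ge> 0" using A e c T by simp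
        ultimately show ?thesis by linarith
      qed
      finally have "exp (- real k) * mass u (real k + 1 + T) \<le> exp (- real k) * ((1 + real k) * B)"
        by (intro mult_left_mono) auto
      also have "\<dots> \<le> 2 * q ^ k * B" using mult_right_mono[OF ek[of k] B] by (simp add: mult.assoc)
      finally show "ennreal (exp (- real k)) * ennreal (mass u (real k + 1 + T)) \<le> ennreal (2 * q ^ k * B)"
        by (simp add: mass_nonneg ennreal_leI flip: ennreal_mult)
    qed auto
    also have "\<dots> = ennreal (c * B)"
      unfolding c_def using q B cs by (subst suminf_ennreal2) (auto simp: summable_mult2 suminf_mult2)
    also have "c * B = c * (A + e / c) + e * T" using c by (simp add: B_def field_simps)
    finally show ?thesis .
  qed
  then show ?thesis using A c e by (intro exI[of _ "c * (A + e / c)"]) auto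
qed

text \<open>Completing the square, 2 s r \<le> r^2 + s^2, trades the Gaussian for the weight
  e^{-|y|} of \<open>strip_mass\<close>; the triangle inequality moves the centre to 0.\<close>

lemma gss_le_exp:
  assumes s: "s > 0"
  shows "gss (1 / s) (y - y0) \<le> exp (s / 2 + norm y0) * exp (- norm y)"
proof -
  define r where "r = norm (y - y0)"
  have "0 \<le> (r - s)\<^sup>2" by simp
  then have "2 * s * r \<le> r\<^sup>2 + s * s" by (simp add: power2_diff power2_eq_square algebra_simps)
  then have "- (r\<^sup>2 / (2 * s)) \<le> s / 2 - r" using s by (simp add: field_simps)
  moreover have "norm y \<le> r + norm y0" unfolding r_def using norm_triangle_ineq[of "y - y0" y0] by simp
  ultimately have "- (r\<^sup>2 / (2 * s)) \<le> s / 2 + norm y0 + - norm y" by linarith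
  then have "exp (- (r\<^sup>2 / (2 * s))) \<le> exp (s / 2 + norm y0 + - norm y)" by simp
  then show ?thesis unfolding exp_add by (simp add: gss_def r_def mult.commute)
qed

text \<open>Cauchy-Schwarz with respect to the measure with density \<open>w T\<close>, for which
  the total mass is O(T) and the integral of |u|^2 is o(T).\<close>

lemma strip_gauss:
  fixes u :: "'a::euclidean_space \<times> real \<Rightarrow> complex" and y0 :: 'a
  assumes u: "u \<in> Bstar0" and s: "s > 0"
  defines "w \<equiv> \<lambda>T x. gss (1 / s) (fst x - y0) * indicator {-T..T} (snd x)"
  shows "T \<ge> 0 \<Longrightarrow> integrable lborel (\<lambda>x. norm (u x) * w T x)"
    and "((\<lambda>T. (\<integral>x. norm (u x) * w T x \<partial>lborel) / T) \<longlongrightarrow> 0) at_top"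
proof -
  have [measurable]: "u \<in> borel_measurable borel" by (rule Bstar0_measurable[OF u])
  have [measurable]: "fst \<in> (borel :: ('a \<times> real) measure) \<rightarrow>\<^sub>M borel" "snd \<in> (borel :: ('a \<times> real) measure) \<rightarrow>\<^sub>M borel"
    by (intro borel_measurable_continuous_onI continuous_intros)+
  have [measurable]: "w T \<in> borel_measurable borel" for T unfolding w_def by measurable
  have w0: "w T x \<ge> 0" for T x by (simp add: w_def)
  define K where "K = exp (s / 2 + norm y0)"
  have K: "K > 0" by (simp add: K_def)
  define G0 where "G0 = (\<integral>y. gss (1 / s) (y - y0) \<partial>lborel)"
  have gi: "integrable lborel (\<lambda>y::'a. gss (1 / s) (y - y0))"
  proof -
    have "integrable (distr lborel borel (\<lambda>y::'a. y0 - y)) (gss (1 / s) :: 'a \<Rightarrow> real)"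
      unfolding lborel_distr_reflect using gss_integrable[of "1 / s"] s by simp
    then have "integrable lborel (\<lambda>y::'a. gss (1 / s) (y0 - y))" by (subst (asm) integrable_distr_eq) auto
    then show ?thesis using gss_minus[of "1 / s" "y0 - _"] by simp
  qed
  have wi: "integrable lborel (w T)" "(\<integral>x. w T x \<partial>lborel) = G0 * (2 * T)" if "T \<ge> 0" for T
  proof -
    have ii: "integrable lborel (\<lambda>t::real. indicat_real {-T..T} t)"
      by (rule integrable_real_indicator) (auto simp: emeasure_lborel_Icc_eq)
    have it: "integrable (lborel \<Otimes>\<^sub>M lborel) (\<lambda>p::'a \<times> real. gss (1 / s) (fst p - y0) * indicat_real {-T..T} (snd p))"
      by (rule integrable_tensor[OF gi ii])
    then show "integrable lborel (w T)" by (simp add: w_def lborel_prod)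
    have "(\<integral>x. w T x \<partial>lborel) = (\<integral>p. gss (1 / s) (fst p - y0) * indicat_real {-T..T} (snd p) \<partial>(lborel \<Otimes>\<^sub>M lborel))"
      by (simp add: w_def lborel_prod)
    also have "\<dots> = (\<integral>y. \<integral>t. gss (1 / s) (y - y0) * indicat_real {-T..T} t \<partial>lborel \<partial>lborel)"
      using lborel_pair.integral_fst'[OF it] by simp
    also have "\<dots> = G0 * (2 * T)" using that by (simp add: G0_def)
    finally show "(\<integral>x. w T x \<partial>lborel) = G0 * (2 * T)" .
  qed
  have G0: "G0 \<ge> 0" unfolding G0_def by simp
  have sq: "(\<integral>\<^sup>+x. ennreal ((norm (u x))\<^sup>2 * w T x) \<partial>lborel) \<le> ennreal (K * B)"
    if B: "(\<integral>\<^sup>+x. ennreal ((norm (u x))\<^sup>2 * (exp (- norm (fst x)) * indicator {-T..T} (snd x))) \<partial>lborel) \<le> ennreal B" for T B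
  proof -
    have "(\<integral>\<^sup>+x. ennreal ((norm (u x))\<^sup>2 * w T x) \<partial>lborel) \<le>
       (\<integral>\<^sup>+x. ennreal K * ennreal ((norm (u x))\<^sup>2 * (exp (- norm (fst x)) * indicator {-T..T} (snd x))) \<partial>lborel)"
    proof (rule nn_integral_mono)
      fix x :: "'a \<times> real"
      have "(norm (u x))\<^sup>2 * w T x \<le> (norm (u x))\<^sup>2 * (K * exp (- norm (fst x)) * indicator {-T..T} (snd x))"
        unfolding w_def K_def by (intro mult_left_mono mult_right_mono gss_le_exp s) auto
      then have "ennreal ((norm (u x))\<^sup>2 * w T x) \<le> ennreal (K * ((norm (u x))\<^sup>2 * (exp (- norm (fst x)) * indicator {-T..T} (snd x))))"
        by (intro ennreal_leI) (simp add: mult_ac)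
      also have "\<dots> = ennreal K * ennreal ((norm (u x))\<^sup>2 * (exp (- norm (fst x)) * indicator {-T..T} (snd x)))"
        using K by (intro ennreal_mult) auto
      finally show "ennreal ((norm (u x))\<^sup>2 * w T x) \<le> ennreal K * ennreal ((norm (u x))\<^sup>2 * (exp (- norm (fst x)) * indicator {-T..T} (snd x)))" .
    qed
    also have "\<dots> = ennreal K * (\<integral>\<^sup>+x. ennreal ((norm (u x))\<^sup>2 * (exp (- norm (fst x)) * indicator {-T..T} (snd x))) \<partial>lborel)"
      by (rule nn_integral_cmult) measurable
    also have "\<dots> \<le> ennreal K * ennreal B" by (intro mult_left_mono B) simp
    also have "\<dots> = ennreal (K * B)" using K by (intro ennreal_mult'[symmetric]) simp
    finally show ?thesis .
  qed
  have ui: "integrable lborel (\<lambda>x. (norm (u x))\<^sup>2 * w T x)" if T: "T \<ge> 0" for T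
  proof (rule integrableI_nonneg)
    obtain A where "\<forall>T\<ge>0. (\<integral>\<^sup>+x. ennreal ((norm (u x))\<^sup>2 * (exp (- norm (fst x)) * indicator {-T..T} (snd x))) \<partial>lborel) \<le> ennreal (A + 1 * T)"
      using strip_mass[OF u zero_less_one] by blast
    then have "(\<integral>\<^sup>+x. ennreal ((norm (u x))\<^sup>2 * w T x) \<partial>lborel) \<le> ennreal (K * (A + 1 * T))" using T by (intro sq) blast
    then show "(\<integral>\<^sup>+x. ennreal ((norm (u x))\<^sup>2 * w T x) \<partial>lborel) < \<infinity>" by (rule le_less_trans) simp
  qed (use w0 in auto)
  define m where "m = (\<lambda>T. \<integral>x. (norm (u x))\<^sup>2 * w T x \<partial>lborel)"
  have m0: "m T \<ge> 0" for T unfolding m_def using w0 by simp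
  have mlim: "((\<lambda>T. m T / T) \<longlongrightarrow> 0) at_top"
  proof (rule tendstoI)
    fix r :: real assume r: "r > 0"
    \<comment> \<open>After multiplication by \<open>K\<close> the slope is r/2, which leaves the
      other half of r to absorb the constant for large T.\<close>
    have rK: "r / (2 * K) > 0" using r K by simp
    obtain A where A: "A \<ge> 0" "\<forall>T\<ge>0. (\<integral>\<^sup>+x. ennreal ((norm (u x))\<^sup>2 * (exp (- norm (fst x)) * indicator {-T..T} (snd x))) \<partial>lborel) \<le> ennreal (A + r / (2 * K) * T)"
      using strip_mass[OF u rK] by blast
    have "m T \<le> K * (A + r / (2 * K) * T)" if T: "T \<ge> 0" for T
    proof -
      have "ennreal (m T) = (\<integral>\<^sup>+x. ennreal ((norm (u x))\<^sup>2 * w T x) \<partial>lborel)"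
        unfolding m_def by (rule nn_integral_eq_integral[OF ui[OF T], symmetric]) (use w0 in auto)
      also have "\<dots> \<le> ennreal (K * (A + r / (2 * K) * T))" using A T by (intro sq) blast
      finally show ?thesis using A K r T by (subst (asm) ennreal_le_iff) auto
    qed
    moreover have "K * (A + r / (2 * K) * T) = K * A + r / 2 * T" for T using K by (simp add: field_simps)
    ultimately have b: "m T \<le> K * A + r / 2 * T" if "T \<ge> 0" for T using that by simp
    show "\<forall>\<^sub>F T in at_top. dist (m T / T) 0 < r"
      using eventually_gt_at_top[of "max 1 (2 * K * A / r)"]
    proof eventually_elim
      case (elim T)
      then have T: "T > 1" "T > 2 * K * A / r" by auto
      then have "2 * (K * A) < r * T" using r by (simp add: field_simps)
      then have "m T < r * T" using b[of T] T by simp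
      then show ?case using m0[of T] T by (simp add: field_simps)
    qed
  qed
  have am: "norm (u x) * w T x \<le> (1 / (2 * \<delta>)) * ((norm (u x))\<^sup>2 * w T x) + (\<delta> / 2) * w T x" if "\<delta> > 0" for \<delta> T x
  proof -
    have "2 * (norm (u x) * \<delta>) \<le> (norm (u x))\<^sup>2 + \<delta>\<^sup>2"
      using sum_squares_bound[of "norm (u x)" \<delta>] by (simp add: mult.assoc)
    then have "norm (u x) \<le> (1 / (2 * \<delta>)) * (norm (u x))\<^sup>2 + \<delta> / 2"
      using that by (simp add: field_simps power2_eq_square)
    from mult_right_mono[OF this w0[of T x]] show ?thesis by (simp add: algebra_simps)
  qed
  show i: "integrable lborel (\<lambda>x. norm (u x) * w T x)" if "T \<ge> 0" for T
  proof (rule Bochner_Integration.integrable_bound)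
    show "integrable lborel (\<lambda>x. (1 / (2 * 1)) * ((norm (u x))\<^sup>2 * w T x) + (1 / 2) * w T x)"
      by (intro Bochner_Integration.integrable_add integrable_mult_right ui wi that)
    show "AE x in lborel. norm (norm (u x) * w T x) \<le> norm ((1 / (2 * 1)) * ((norm (u x))\<^sup>2 * w T x) + (1 / 2) * w T x)"
      using am[of 1] w0 by (intro AE_I2) (simp add: abs_mult)
  qed measurable
  show "((\<lambda>T. (\<integral>x. norm (u x) * w T x \<partial>lborel) / T) \<longlongrightarrow> 0) at_top"
    by (rule mean_tendsto_0[OF i _ ui _ wi(1) am mlim[unfolded m_def], where C = "2 * G0"]) (use w0 wi(2) in auto)
qed

text \<open>(1 + |\<xi>|)^N is at most e^{N|\<xi>|}, and half of the Gaussian exponent absorbs this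
  by completing the square.\<close>

lemma gss_moments:
  assumes s: "s > 0"
  shows "integrable lborel (\<lambda>\<xi>::'a::euclidean_space. (1 + norm \<xi>) ^ N * gss s \<xi>)"
proof (rule Bochner_Integration.integrable_bound)
  show "integrable lborel (\<lambda>\<xi>::'a. exp (real N * real N / s) * gss (s / 2) \<xi>)"
    using s by (intro integrable_mult_right gss_integrable) simp
  show "AE \<xi> in lborel. norm ((1 + norm \<xi>) ^ N * gss s \<xi>) \<le> norm (exp (real N * real N / s) * gss (s / 2) (\<xi>::'a))"
  proof (rule AE_I2)
    fix \<xi> :: 'a
    define r where "r = norm \<xi>"
    have "0 \<le> (s * r - 2 * real N)\<^sup>2" by simp
    then have "s * (4 * real N * r) \<le> s * (s * r\<^sup>2) + 4 * (real N * real N)" by (simp add: power2_eq_square algebra_simps)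
    then have b: "real N * r - s * r\<^sup>2 / 4 \<le> real N * real N / s" using s by (simp add: field_simps)
    have "(1 + r) ^ N \<le> exp r ^ N" by (intro power_mono exp_ge_add_one_self) (simp add: r_def)
    also have "\<dots> = exp (real N * r)" by (rule exp_of_nat_mult[symmetric])
    finally have "(1 + r) ^ N * gss s \<xi> \<le> exp (real N * r) * gss s \<xi>" by (intro mult_right_mono) auto
    also have "\<dots> = exp ((real N * r - s * r\<^sup>2 / 4) + - (s * r\<^sup>2 / 4))" by (simp add: gss_def r_def flip: exp_add)
    also have "\<dots> \<le> exp (real N * real N / s + - (s * r\<^sup>2 / 4))" using b by simp
    also have "\<dots> = exp (real N * real N / s) * gss (s / 2) \<xi>" unfolding exp_add by (simp add: gss_def r_def)
    finally show "norm ((1 + norm \<xi>) ^ N * gss s \<xi>) \<le> norm (exp (real N * real N / s) * gss (s / 2) \<xi>)"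
      by (simp add: r_def abs_mult power_abs)
  qed
qed measurable

context helmholtz begin

text \<open>With a Gaussian amplitude and the profiles \<open>prof\<close>, the source in the Green
  identity is the packet on the left up to a constant. On the support of \<open>F\<close> the
  profile is e^{-\<mu> t} times a factor depending on \<xi> alone, so the other side is an integral
  of \<open>fl\<close> and vanishes.\<close>

lemma annihilate_derivative:
  assumes "profile D L" and neg: "\<And>t. t \<ge> 0 \<Longrightarrow> D 0 t = 0" and s: "s > 0"
  shows "(\<integral>x. u x * complex_of_real (gss (1 / s) (fst x - y0) * D 1 (snd x)) \<partial>lborel) = 0"
proof -
  interpret profile D L by (rule assms(1))
  \<comment> \<open>The modulation by \<open>y0\<close> on the frequency side moves the centre of
    the packet to \<open>y0\<close>.\<close>
  define a where "a = (\<lambda>\<xi>::'a. complex_of_real (gss s \<xi>) * iexp (- (y0 \<bullet> \<xi>)))"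
  define C where "C = sqrt (2 * pi / s) ^ DIM('a)"
  have C: "C > 0" using s by (simp add: C_def)
  have g: "(\<integral>\<xi>. a \<xi> * iexp (y \<bullet> \<xi>) \<partial>lborel) = complex_of_real (C * gss (1 / s) (y - y0))" for y
  proof -
    have "iexp (- (y0 \<bullet> \<xi>)) * iexp (y \<bullet> \<xi>) = iexp ((y - y0) \<bullet> \<xi>)" for \<xi>
      by (simp add: inner_diff_left algebra_simps flip: exp_add)
    then show ?thesis using gauss_fourier(2)[OF s, of "y - y0"] by (simp add: a_def C_def mult.assoc)
  qed
  define W where "W = (\<lambda>j \<xi>. prof (mu \<xi>) j)"
  obtain C1 where C1: "\<And>t. \<bar>D 1 t\<bar> \<le> C1" using D_bound by blast
  have int: "integrable lborel (\<lambda>x. norm (u x) * norm ((\<integral>\<xi>. a \<xi> * iexp (fst x \<bullet> \<xi>) \<partial>lborel) * - complex_of_real (D 1 (snd x))))"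
  proof (rule Bochner_Integration.integrable_bound)
    show "integrable lborel (\<lambda>x. C * C1 * (norm (u x) * (gss (1 / s) (fst x - y0) * indicator {-L..L} (snd x))))"
      using strip_gauss(1)[OF u s, of L y0] L by (intro integrable_mult_right) simp
    show "AE x in lborel. norm (norm (u x) * norm ((\<integral>\<xi>. a \<xi> * iexp (fst x \<bullet> \<xi>) \<partial>lborel) * - complex_of_real (D 1 (snd x))))
      \<le> norm (C * C1 * (norm (u x) * (gss (1 / s) (fst x - y0) * indicator {-L..L} (snd x))))"
    proof (rule AE_I2)
      fix x :: "'a \<times> real"
      have "\<bar>D 1 (snd x)\<bar> \<le> \<bar>C1\<bar> * indicator {-L..L} (snd x)"
        using C1[of "snd x"] D_supp[of "snd x" 1] by (auto split: split_indicator simp: abs_le_iff not_le)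
      then have "(norm (u x) * (C * gss (1 / s) (fst x - y0))) * \<bar>D 1 (snd x)\<bar> \<le> (norm (u x) * (C * gss (1 / s) (fst x - y0))) * (\<bar>C1\<bar> * indicator {-L..L} (snd x))"
        using C by (intro mult_left_mono) auto
      then show "norm (norm (u x) * norm ((\<integral>\<xi>. a \<xi> * iexp (fst x \<bullet> \<xi>) \<partial>lborel) * - complex_of_real (D 1 (snd x))))
         \<le> norm (C * C1 * (norm (u x) * (gss (1 / s) (fst x - y0) * indicator {-L..L} (snd x))))"
        using C unfolding g by (simp add: norm_mult abs_mult mult_ac)
    qed
    show "(\<lambda>x. norm (u x) * norm ((\<integral>\<xi>. a \<xi> * iexp (fst x \<bullet> \<xi>) \<partial>lborel) * - complex_of_real (D 1 (snd x)))) \<in> borel_measurable lborel"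
      unfolding g by measurable
  qed
  have "(\<integral>x. u x * ((\<integral>\<xi>. a \<xi> * iexp (fst x \<bullet> \<xi>) \<partial>lborel) * - complex_of_real (D 1 (snd x))) \<partial>lborel) =
    (\<integral>\<xi>. a \<xi> * (\<integral>x. F x * (iexp (fst x \<bullet> \<xi>) * W 0 \<xi> (snd x)) \<partial>lborel) \<partial>lborel)"
  proof (rule green_slices[where A = 1 and c = "\<lambda>j. \<integral>r. \<bar>D j r\<bar> \<partial>lborel" and h = "\<lambda>t. - complex_of_real (D 1 t)"])
    show "a \<in> borel_measurable borel" unfolding a_def by measurable
    show "norm (a \<xi>) \<le> 1" for \<xi> using s by (simp add: a_def norm_mult gss_le_1)
    show "integrable lborel (\<lambda>\<xi>. (1 + norm \<xi>) ^ N * norm (a \<xi>))" for N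
      using gss_moments[OF s, of N, where 'a = 'a] by (simp add: a_def norm_mult)
    show "(W j \<xi> has_vector_derivative W (Suc j) \<xi> t) (at t)" for j \<xi> t
      unfolding W_def by (rule prof_der[OF mu_Re])
    show "norm (W j \<xi> t) \<le> (\<integral>r. \<bar>D j r\<bar> \<partial>lborel)" for j \<xi> t
      unfolding W_def by (rule prof_bound[OF mu_Re])
    show "(\<lambda>p. W j (fst p) (snd p)) \<in> borel_measurable (borel \<Otimes>\<^sub>M borel)" for j
      unfolding W_def by (rule prof_meas[OF mu_meas])
    show "W 2 \<xi> t = complex_of_real ((norm \<xi>)\<^sup>2 - lam) * W 0 \<xi> t - - complex_of_real (D 1 t)" for \<xi> t
      unfolding W_def prof_ode[OF mu_Re] mu_sq by simp
    show "integrable lborel (\<lambda>x. norm (u x) * norm ((\<integral>\<xi>. a \<xi> * iexp (fst x \<bullet> \<xi>) \<partial>lborel) * - complex_of_real (D 1 (snd x))))"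
      by (rule int)
  qed
  also have "\<dots> = (\<integral>\<xi>. 0 \<partial>(lborel :: 'a measure))"
  proof (rule Bochner_Integration.integral_cong[OF refl])
    fix \<xi>
    \<comment> \<open>Free of x, this factor leaves the integral and \<open>fl \<xi>\<close>
      remains.\<close>
    define b where "b = (\<integral>s. exp (mu \<xi> * s) * complex_of_real (D 0 s / 2) \<partial>lborel)"
    have "(\<integral>x. F x * (iexp (fst x \<bullet> \<xi>) * W 0 \<xi> (snd x)) \<partial>lborel) =
      (\<integral>x. F x * (iexp (fst x \<bullet> \<xi>) * exp (- mu \<xi> * snd x)) * b \<partial>lborel)"
    proof (rule Bochner_Integration.integral_cong[OF refl])
      fix x :: "'a \<times> real"
      show "F x * (iexp (fst x \<bullet> \<xi>) * W 0 \<xi> (snd x)) = F x * (iexp (fst x \<bullet> \<xi>) * exp (- mu \<xi> * snd x)) * b"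
      proof (cases "snd x < 0")
        case True
        then have "F x = 0" using F_supp[of "snd x" "fst x"] by simp
        then show ?thesis by simp
      next
        case False
        then have "W 0 \<xi> (snd x) = exp (- mu \<xi> * snd x) * b"
          unfolding W_def b_def by (intro prof_pos neg) auto
        then show ?thesis by (simp only: mult.assoc)
      qed
    qed
    also have "\<dots> = fl \<xi> * b" unfolding fl_def by (rule integral_mult_left_zero)
    finally show "a \<xi> * (\<integral>x. F x * (iexp (fst x \<bullet> \<xi>) * W 0 \<xi> (snd x)) \<partial>lborel) = 0"
      unfolding fl_zero by simp
  qed
  finally have "(\<integral>x. - complex_of_real C * (u x * complex_of_real (gss (1 / s) (fst x - y0) * D 1 (snd x))) \<partial>lborel) = 0"
    unfolding g by (simp add: mult_ac)
  then show ?thesis using C by (simp only: integral_mult_right_zero mult_eq_0_iff) simp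
qed

end

section \<open>Derivatives and a primitive of the bump\<close>

definition bump_deriv :: "nat \<Rightarrow> real \<Rightarrow> real" where
  "bump_deriv n = pds (replicate n 1) bump"

lemma smooth_bump_deriv: "smooth_fun (bump_deriv n)"
  by (induction n) (simp_all add: bump_deriv_def smooth_bump smooth_fun_pd)

lemma bump_deriv_der: "(bump_deriv n has_real_derivative bump_deriv (Suc n) t) (at t)"
  using smooth_fun_real_deriv[OF smooth_bump_deriv[of n]] by (simp add: bump_deriv_def)

lemma bump_deriv_supp: "\<bar>t\<bar> > 1 \<Longrightarrow> bump_deriv n t = 0"
proof (induction n arbitrary: t)
  case 0 then show ?case by (simp add: bump_deriv_def bump_eq_0)
next
  case (Suc n)
  have "pd 1 (bump_deriv n) t = 0"
    by (rule pd_zero_outside[of 1]) (use Suc in auto)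
  then show ?case by (simp add: bump_deriv_def)
qed

text \<open>Being 0 on the left and constant on the right, rescaled copies of \<open>P\<close> have
  differences of compact support; this produces primitives admissible in
  \<open>profile\<close>.\<close>

lemma bump_antiderivative:
  obtains P where "\<And>t. (P has_real_derivative bump t) (at t)" "\<And>t. t \<le> -1 \<Longrightarrow> P t = 0" "\<And>t. t \<ge> 1 \<Longrightarrow> P t = P 1"
proof -
  have "\<exists>F. \<forall>x::real. -\<infinity> < ereal x \<longrightarrow> ereal x < \<infinity> \<longrightarrow> (F has_vector_derivative bump x) (at x)"
    by (rule einterval_antiderivative)
      (auto intro: differentiable_imp_continuous_within smooth_fun_differentiable smooth_bump)
  then obtain Q where "\<And>x. (Q has_vector_derivative bump x) (at x)" by auto
  then have Q: "(Q has_real_derivative bump t) (at t)" for t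
    by (simp add: has_real_derivative_iff_has_vector_derivative)
  have Qc: "continuous_on S Q" for S
    using Q by (meson DERIV_continuous continuous_at_imp_continuous_on)
  have l: "Q t = Q (-1)" if "t \<le> -1" for t
  proof (cases "t = -1")
    case False
    have "Q (-1) = Q t"
      by (rule DERIV_isconst_end) (use that False Q Qc in \<open>auto simp: bump_eq_0 intro: DERIV_cong[OF Q]\<close>)
    then show ?thesis by simp
  qed simp
  have r: "Q t = Q 1" if "t \<ge> 1" for t
  proof (cases "t = 1")
    case False
    show ?thesis
      by (rule DERIV_isconst_end) (use that False Q Qc in \<open>auto simp: bump_eq_0 intro: DERIV_cong[OF Q]\<close>)
  qed simp
  have d: "((\<lambda>t. Q t - Q (-1)) has_real_derivative bump t) (at t)" for t
    using DERIV_diff[OF Q DERIV_const] by simp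
  show ?thesis
  proof (rule that[of "\<lambda>t. Q t - Q (-1)"])
    show "Q t - Q (-1) = 0" if "t \<le> -1" for t using l[OF that] by simp
    show "Q t - Q (-1) = Q 1 - Q (-1)" if "t \<ge> 1" for t using r[OF that] by simp
  qed (rule d)
qed

lemma DERIV_affine:
  assumes "\<And>t. (f has_real_derivative f' t) (at t)"
  shows "((\<lambda>t. f ((t - c) / d)) has_real_derivative (1 / d) * f' ((t - c) / d)) (at t)"
proof -
  have "((\<lambda>t. (t - c) / d) has_real_derivative 1 / d) (at t)"
    by (rule DERIV_cdivide) (auto intro!: derivative_eq_intros)
  from DERIV_chain'[OF this assms] show ?thesis by (simp add: mult.commute)
qed

context helmholtz begin

text \<open>A bump in \<open>t\<close> differs from a wide flat bump of equal integral by a derivative, and wide flat bumps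
  are asymptotically orthogonal to \<open>u\<close>.\<close>

lemma annihilate_bump:
  assumes s: "s > 0" and d: "d > 0" and cd: "c + d \<le> 0"
  shows "(\<integral>x. u x * complex_of_real (gss (1 / s) (fst x - y0) * bump ((snd x - c) / d)) \<partial>lborel) = 0" (is "?I = 0")
proof -
  obtain P where P: "\<And>t. (P has_real_derivative bump t) (at t)" "\<And>t. t \<le> -1 \<Longrightarrow> P t = 0" "\<And>t. t \<ge> 1 \<Longrightarrow> P t = P 1"
    by (rule bump_antiderivative, rule that)
  have [measurable]: "bump \<in> borel_measurable borel" by (rule smooth_fun_measurable[OF smooth_bump])
  define w where "w = (\<lambda>T (x::'a \<times> real). gss (1 / s) (fst x - y0) * indicator {-T..T} (snd x))"
  have eq: "?I = complex_of_real (d / r) * (\<integral>x. u x * complex_of_real (gss (1 / s) (fst x - y0) * bump ((snd x - (- 2 * r)) / r)) \<partial>lborel)"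
    and bd: "norm ?I \<le> 3 * d * ((\<integral>x. norm (u x) * w (3 * r) x \<partial>lborel) / (3 * r))"
    if r: "r \<ge> 1" for r
  proof -
    \<comment> \<open>\<open>D 0\<close> is the primitive of the given bump minus d/r times a bump
      of half-width r centred at -2 r. The factor d/r equalises the two integrals. As c + d \<le> 0
      and -2 r + r < 0, both primitives have reached the same constant by t = 0, so
      \<open>D 0\<close> vanishes for t \<ge> 0.\<close>
    define D where "D = (\<lambda>j t. case j of 0 \<Rightarrow> d * P ((t - c) / d) - d * P ((t - (- 2 * r)) / r)
      | Suc n \<Rightarrow> (1 / d) ^ n * bump_deriv n ((t - c) / d) - d / r * ((1 / r) ^ n * bump_deriv n ((t - (- 2 * r)) / r)))"
    define L where "L = 3 * r + \<bar>c\<bar> + d"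
    have far: "(t - c) / d \<ge> 1 \<and> (t - (- 2 * r)) / r \<ge> 1" if "t \<ge> 0 \<or> t > L" for t
      using that d r cd by (auto simp: L_def field_simps)
    have far': "(t - c) / d > 1 \<and> (t - (- 2 * r)) / r > 1" if "t > L" for t
      using that d r cd by (auto simp: L_def field_simps)
    have near: "(t - c) / d < - 1 \<and> (t - (- 2 * r)) / r < - 1" if "t < - L" for t
      using that d r cd by (auto simp: L_def field_simps)
    have profD: "profile D L"
    proof
      show "L > 0" using d r by (simp add: L_def add_pos_nonneg)
      show "(D j has_real_derivative D (Suc j) t) (at t)" for j t
      proof (cases j)
        case 0
        have "((\<lambda>t. d * P ((t - c) / d) - d * P ((t - (- 2 * r)) / r)) has_real_derivative
           d * ((1 / d) * bump ((t - c) / d)) - d * ((1 / r) * bump ((t - (- 2 * r)) / r))) (at t)"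
          by (intro DERIV_diff DERIV_cmult DERIV_affine P(1))
        then show ?thesis using 0 d by (simp add: D_def bump_deriv_def)
      next
        case (Suc n)
        have "((\<lambda>t. (1 / d) ^ n * bump_deriv n ((t - c) / d) - d / r * ((1 / r) ^ n * bump_deriv n ((t - (- 2 * r)) / r))) has_real_derivative
           (1 / d) ^ n * ((1 / d) * bump_deriv (Suc n) ((t - c) / d)) - d / r * ((1 / r) ^ n * ((1 / r) * bump_deriv (Suc n) ((t - (- 2 * r)) / r)))) (at t)"
          by (intro DERIV_diff DERIV_cmult DERIV_affine bump_deriv_der)
        then show ?thesis using Suc by (simp add: D_def mult_ac)
      qed
      fix j t assume t: "\<bar>t\<bar> > L"
      then consider "t > L" | "t < - L" by linarith
      then show "D j t = 0"
      proof cases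
        case 1
        then have "P ((t - c) / d) = P ((t - (- 2 * r)) / r)" using far[of t] P(3) by metis
        moreover have "bump_deriv n ((t - c) / d) = 0" "bump_deriv n ((t - (- 2 * r)) / r) = 0" for n
          using far'[OF 1] by (auto intro!: bump_deriv_supp simp del: abs_divide)
        ultimately show ?thesis unfolding D_def by (cases j) (simp_all only: nat.case diff_self mult_zero_right)
      next
        case 2
        have "P ((t - c) / d) = 0" "P ((t - (- 2 * r)) / r) = 0"
          using near[OF 2] by (auto intro!: P(2))
        moreover have "bump_deriv n ((t - c) / d) = 0" "bump_deriv n ((t - (- 2 * r)) / r) = 0" for n
          using near[OF 2] by (auto intro!: bump_deriv_supp simp del: abs_divide)
        ultimately show ?thesis unfolding D_def by (cases j) (simp_all only: nat.case diff_self mult_zero_right)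
      qed
    qed
    have "D 0 t = 0" if "t \<ge> 0" for t
    proof -
      have "P ((t - c) / d) = P ((t - (- 2 * r)) / r)" using far[of t] P(3) that by metis
      then show ?thesis by (simp add: D_def)
    qed
    from annihilate_derivative[OF profD this s]
    have z: "(\<integral>x. u x * complex_of_real (gss (1 / s) (fst x - y0) * D 1 (snd x)) \<partial>lborel) = 0" by blast
    have i: "integrable lborel (\<lambda>x. u x * complex_of_real (gss (1 / s) (fst x - y0) * \<beta> (snd x)))"
      and ib: "norm (\<integral>x. u x * complex_of_real (gss (1 / s) (fst x - y0) * \<beta> (snd x)) \<partial>lborel) \<le> (\<integral>x. norm (u x) * w T x \<partial>lborel)"
      if T: "T \<ge> 0" and [measurable]: "\<beta> \<in> borel_measurable borel" and b: "\<And>t. \<bar>\<beta> t\<bar> \<le> indicator {-T..T} t" for \<beta> T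
    proof -
      have bb: "norm (u x * complex_of_real (gss (1 / s) (fst x - y0) * \<beta> (snd x))) \<le> norm (u x) * w T x" for x
      proof -
        have "norm (u x) * gss (1 / s) (fst x - y0) * \<bar>\<beta> (snd x)\<bar> \<le> norm (u x) * gss (1 / s) (fst x - y0) * indicator {-T..T} (snd x)"
          by (intro mult_left_mono b) simp
        then show ?thesis by (simp add: w_def norm_mult abs_mult mult.assoc)
      qed
      have wi: "integrable lborel (\<lambda>x. norm (u x) * w T x)" unfolding w_def by (rule strip_gauss(1)[OF u s T])
      show "integrable lborel (\<lambda>x. u x * complex_of_real (gss (1 / s) (fst x - y0) * \<beta> (snd x)))"
        by (rule Bochner_Integration.integrable_bound[OF wi])
          (use bb in \<open>auto intro!: AE_I2 intro: order_trans[OF _ abs_ge_self]\<close>)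
      show "norm (\<integral>x. u x * complex_of_real (gss (1 / s) (fst x - y0) * \<beta> (snd x)) \<partial>lborel) \<le> (\<integral>x. norm (u x) * w T x \<partial>lborel)"
        by (rule norm_integral_le[OF wi bb])
    qed
    have b1: "\<bar>bump ((t - c) / d)\<bar> \<le> indicator {-L..L} t" for t
    proof (cases "\<bar>t\<bar> > L")
      case True
      then have "bump ((t - c) / d) = 0" using far'[of t] near[of t] by (intro bump_eq_0) linarith
      then show ?thesis by simp
    next
      case False
      then have "indicat_real {-L..L} t = 1" by (auto simp: abs_le_iff not_less)
      then show ?thesis using bump_nonneg[of "(t - c) / d"] bump_le_1[of "(t - c) / d"] by simp
    qed
    \<comment> \<open>The wide bump lives between -3 r and -r, inside the symmetric strip of
      half-width 3 r to which \<open>strip_gauss\<close> applies.\<close>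
    have b2: "\<bar>bump ((t - (- 2 * r)) / r)\<bar> \<le> indicator {-(3 * r)..3 * r} t" for t
    proof (cases "\<bar>t\<bar> > 3 * r")
      case True
      then have "(t - (- 2 * r)) / r > 1 \<or> (t - (- 2 * r)) / r < - 1" using r by (auto simp: field_simps abs_if split: if_splits)
      then have "bump ((t - (- 2 * r)) / r) = 0" by (intro bump_eq_0) linarith
      then show ?thesis by simp
    next
      case False
      then have "indicat_real {-(3 * r)..3 * r} t = 1" by (auto simp: abs_le_iff not_less)
      then show ?thesis using bump_nonneg[of "(t - (- 2 * r)) / r"] bump_le_1[of "(t - (- 2 * r)) / r"] by simp
    qed
    have L0: "L \<ge> 0" "3 * r \<ge> 0" using d r by (auto simp: L_def)
    have i1: "integrable lborel (\<lambda>x. u x * complex_of_real (gss (1 / s) (fst x - y0) * bump ((snd x - c) / d)))"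
      by (rule i[OF L0(1) _ b1]) measurable
    have i2: "integrable lborel (\<lambda>x. u x * complex_of_real (gss (1 / s) (fst x - y0) * bump ((snd x - (- 2 * r)) / r)))"
      by (rule i[OF L0(2) _ b2]) measurable
    have D1: "D 1 t = bump ((t - c) / d) - d / r * bump ((t - (- 2 * r)) / r)" for t
      by (simp add: D_def bump_deriv_def)
    have "U * complex_of_real (g * (B1 - q * B2)) = U * complex_of_real (g * B1) - complex_of_real q * (U * complex_of_real (g * B2))"
      for U g B1 B2 q by (simp add: algebra_simps)
    then have "u x * complex_of_real (gss (1 / s) (fst x - y0) * D 1 (snd x)) =
       u x * complex_of_real (gss (1 / s) (fst x - y0) * bump ((snd x - c) / d)) -
       complex_of_real (d / r) * (u x * complex_of_real (gss (1 / s) (fst x - y0) * bump ((snd x - (- 2 * r)) / r)))" for x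
      unfolding D1 by blast
    then have "(\<integral>x. u x * complex_of_real (gss (1 / s) (fst x - y0) * D 1 (snd x)) \<partial>lborel) =
       ?I - complex_of_real (d / r) * (\<integral>x. u x * complex_of_real (gss (1 / s) (fst x - y0) * bump ((snd x - (- 2 * r)) / r)) \<partial>lborel)"
      by (simp only: Bochner_Integration.integral_diff[OF i1 integrable_mult_right[OF i2]] integral_mult_right_zero)
    then show eq: "?I = complex_of_real (d / r) * (\<integral>x. u x * complex_of_real (gss (1 / s) (fst x - y0) * bump ((snd x - (- 2 * r)) / r)) \<partial>lborel)"
      unfolding z by simp
    have "norm ?I \<le> d / r * (\<integral>x. norm (u x) * w (3 * r) x \<partial>lborel)"
    proof -
      have q: "norm (complex_of_real (d / r)) = d / r" using d r by (simp del: of_real_divide)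
      have "norm (\<integral>x. u x * complex_of_real (gss (1 / s) (fst x - y0) * bump ((snd x - (- 2 * r)) / r)) \<partial>lborel)
         \<le> (\<integral>x. norm (u x) * w (3 * r) x \<partial>lborel)"
        by (rule ib[OF L0(2) _ b2]) measurable
      then show ?thesis unfolding eq norm_mult q using d r by (intro mult_left_mono) auto
    qed
    then show "norm ?I \<le> 3 * d * ((\<integral>x. norm (u x) * w (3 * r) x \<partial>lborel) / (3 * r))" by simp
  qed
  \<comment> \<open>The integral does not depend on r, whereas its bound tends to 0 as the
    comparison bump flattens.\<close>
  have "((\<lambda>r::real. ?I) \<longlongrightarrow> 0) at_top"
  proof (rule Lim_null_comparison)
    show "\<forall>\<^sub>F r in at_top. norm ?I \<le> 3 * d * ((\<integral>x. norm (u x) * w (3 * r) x \<partial>lborel) / (3 * r))"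
      using eventually_ge_at_top[of "1::real"] by eventually_elim (rule bd)
    have "filterlim (\<lambda>r::real. 3 * r) at_top at_top" by real_asymp
    from filterlim_compose[OF strip_gauss(2)[OF u s, of y0] this]
    have "((\<lambda>r. 3 * d * ((\<integral>x. norm (u x) * w (3 * r) x \<partial>lborel) / (3 * r))) \<longlongrightarrow> 3 * d * 0) at_top"
      unfolding w_def by (intro tendsto_mult tendsto_const)
    then show "((\<lambda>r. 3 * d * ((\<integral>x. norm (u x) * w (3 * r) x \<partial>lborel) / (3 * r))) \<longlongrightarrow> 0) at_top" by simp
  qed
  then show ?thesis by (rule tendsto_unique[OF trivial_limit_at_top_linorder tendsto_const])
qed

end

subsection \<open>Density of the wave packets\<close>

lemma lborel_integral_dilate:
  fixes f :: "'a::euclidean_space \<Rightarrow> real"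
  assumes e: "e > 0" and [measurable]: "f \<in> borel_measurable borel"
  shows "(\<integral>y. f y \<partial>lborel) = e ^ DIM('a) * (\<integral>z. f (x - e *\<^sub>R z) \<partial>lborel)"
proof -
  have "(\<integral>y. f y \<partial>lborel) = (\<integral>y. f y \<partial>density (distr lborel borel (\<lambda>z. x + (- e) *\<^sub>R z)) (\<lambda>_. ennreal (\<bar>- e\<bar> ^ DIM('a))))"
    using e by (subst lborel_affine[of "- e" x]) simp_all
  also have "\<dots> = (\<integral>y. e ^ DIM('a) *\<^sub>R f y \<partial>distr lborel borel (\<lambda>z. x + (- e) *\<^sub>R z))"
    using e by (subst integral_density) auto
  also have "\<dots> = (\<integral>z. e ^ DIM('a) *\<^sub>R f (x + (- e) *\<^sub>R z) \<partial>lborel)"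
    by (subst integral_distr) auto
  finally show ?thesis by simp
qed

lemma box_frontier_null: "cbox a b - box a b \<in> null_sets (lborel :: 'a::euclidean_space measure)"
proof (rule null_setsI)
  have "emeasure lborel (cbox a b - box a b) = emeasure lborel (cbox a b) - emeasure lborel (box a b)"
    by (rule emeasure_Diff) (auto simp: emeasure_lborel_box_eq box_subset_cbox)
  then show "emeasure lborel (cbox a b - box a b) = 0"
    by (simp add: emeasure_lborel_box_eq emeasure_lborel_cbox_eq)
qed simp

text \<open>The indicator of the box is mollified by a kernel of the shape Gaussian times bump. The
  mollification is a superposition of packets centred in the box, each orthogonal to
  \<open>u\<close>, and it tends to a multiple of the indicator. Gaussian tails are the obstacle:
  the domination must be uniform in the scale and integrable against |u|.\<close>

lemma box_integral_zero:
  fixes u :: "'a::euclidean_space \<times> real \<Rightarrow> complex"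
  assumes u[measurable]: "u \<in> borel_measurable borel"
    and ui: "\<And>T. T \<ge> 0 \<Longrightarrow> integrable lborel (\<lambda>x. norm (u x) * (gss (1 / 4) (fst x) * indicator {-T..T} (snd x)))"
    and ann: "\<And>e x0. 0 < e \<Longrightarrow> snd x0 + e \<le> 0 \<Longrightarrow>
      (\<integral>x. u x * complex_of_real (gss (1 / e\<^sup>2) (fst x - fst x0) * bump ((snd x - snd x0) / e)) \<partial>lborel) = 0"
    and b: "snd b < 0"
  shows "(\<integral>x. indicator (box a b) x * u x \<partial>lborel) = 0"
proof -
  have fm[measurable]: "fst \<in> (borel :: ('a \<times> real) measure) \<rightarrow>\<^sub>M borel" "snd \<in> (borel :: ('a \<times> real) measure) \<rightarrow>\<^sub>M borel"
    by (intro borel_measurable_continuous_onI continuous_intros)+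
  have [measurable]: "bump \<in> borel_measurable borel" by (rule smooth_fun_measurable[OF smooth_bump])
  define Q where "Q = box a b"
  have Qm[measurable]: "(\<lambda>x. indicat_real Q x) \<in> borel_measurable borel"
    unfolding Q_def by (rule borel_measurable_indicator) simp
  define k where "k = (\<lambda>z::'a \<times> real. gss 1 (fst z) * bump (snd z))"
  have [measurable]: "k \<in> borel_measurable borel" unfolding k_def by measurable
  have k0: "k z \<ge> 0" for z by (simp add: k_def bump_nonneg)
  obtain B where B: "B > 0" "\<And>x. x \<in> Q \<Longrightarrow> norm x \<le> B"
    using bounded_box[of a b] unfolding Q_def bounded_pos by blast
  define T where "T = B + 1"
  define p where "p = (\<lambda>x::'a \<times> real. gss (1 / 4) (fst x) * indicator {-T..T} (snd x))"
  define q where "q = (\<lambda>z::'a \<times> real. gss (1 / 2) (fst z) * bump (snd z))"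
  have [measurable]: "p \<in> borel_measurable borel" "q \<in> borel_measurable borel"
    unfolding p_def q_def by measurable
  have q0: "q z \<ge> 0" for z by (simp add: q_def bump_nonneg)
  have bi: "integrable lborel bump"
  proof (rule Bochner_Integration.integrable_bound)
    show "integrable lborel (\<lambda>t::real. indicat_real {-1..1} t)"
      by (rule integrable_real_indicator) (auto simp: emeasure_lborel_Icc_eq)
    show "AE t in lborel. norm (bump t) \<le> norm (indicat_real {-1..1} t)"
      using bump_nonneg bump_le_1 bump_eq_0 by (intro AE_I2) (auto split: split_indicator simp: abs_le_iff not_le)
  qed simp
  have gb: "integrable lborel (\<lambda>z::'a \<times> real. gss s (fst z) * bump (snd z))" if "s > 0" for s
    using integrable_tensor[OF gss_integrable[OF that, where 'a = 'a] bi] by (simp add: lborel_prod)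
  have ki: "integrable lborel k" and qi: "integrable lborel q" unfolding k_def q_def by (rule gb, simp)+
  \<comment> \<open>Factor the Gaussian in z into two equal halves. Since |fst x| \<le> B + |fst z|
    for e \<le> 1, one half yields decay in x, at the price of a constant; the other stays behind in
    \<open>q\<close> and keeps it integrable in z.\<close>
  have dom: "k z \<le> exp (B\<^sup>2 / 4) * (p x * q z)" if xz: "x - e *\<^sub>R z \<in> Q" and e: "0 < e" "e \<le> 1" for x z e
  proof (cases "\<bar>snd z\<bar> \<ge> 1")
    case True then show ?thesis using bump_eq_0[OF True] by (simp add: k_def q_def)
  next
    case False
    have f: "norm (fst y) \<le> norm y" "\<bar>snd y\<bar> \<le> norm y" for y :: "'a \<times> real"
      using norm_fst_le[of "fst y" "snd y"] norm_snd_le[of "snd y" "fst y"] by simp_all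
    have n: "norm (fst x - e *\<^sub>R fst z) \<le> B" "\<bar>snd x - e * snd z\<bar> \<le> B"
      using order_trans[OF f(1) B(2)[OF xz]] order_trans[OF f(2) B(2)[OF xz]] by simp_all
    have "\<bar>e * snd z\<bar> \<le> 1" using False e by (simp add: abs_mult mult_le_one)
    then have T: "\<bar>snd x\<bar> \<le> T" using n(2) unfolding T_def by linarith
    have "norm (fst x) \<le> norm (fst x - e *\<^sub>R fst z) + norm (e *\<^sub>R fst z)"
      using norm_triangle_ineq[of "fst x - e *\<^sub>R fst z" "e *\<^sub>R fst z"] by simp
    also have "\<dots> \<le> B + norm (fst z)" using n(1) e by (simp add: add_mono mult_left_le_one_le)
    finally have "(norm (fst x))\<^sup>2 \<le> (B + norm (fst z))\<^sup>2" by (rule power_mono) simp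
    also have "\<dots> \<le> 2 * B\<^sup>2 + 2 * (norm (fst z))\<^sup>2"
      using zero_le_power2[of "B - norm (fst z)"] by (simp add: power2_sum power2_diff)
    finally have "- ((norm (fst z))\<^sup>2 / 4) \<le> B\<^sup>2 / 4 + - ((norm (fst x))\<^sup>2 / 8)" by simp
    then have "exp (- ((norm (fst z))\<^sup>2 / 4)) \<le> exp (B\<^sup>2 / 4 + - ((norm (fst x))\<^sup>2 / 8))" by simp
    then have g: "gss (1 / 2) (fst z) \<le> exp (B\<^sup>2 / 4) * gss (1 / 4) (fst x)" unfolding exp_add by (simp add: gss_def)
    have "gss 1 (fst z) = gss (1 / 2) (fst z) * gss (1 / 2) (fst z)" by (simp add: gss_def flip: exp_add)
    then have "k z = gss (1 / 2) (fst z) * q z" by (simp add: k_def q_def)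
    also have "\<dots> \<le> (exp (B\<^sup>2 / 4) * gss (1 / 4) (fst x)) * q z" by (intro mult_right_mono g q0)
    finally show ?thesis using T by (simp add: p_def abs_le_iff mult.assoc)
  qed
  define j where "j = (\<lambda>e x. \<integral>z. indicator Q (x - e *\<^sub>R z) * k z \<partial>lborel)"
  have jm[measurable]: "j e \<in> borel_measurable borel" for e
  proof -
    have "(\<lambda>p::('a \<times> real) \<times> ('a \<times> real). indicat_real Q (fst p - e *\<^sub>R snd p)) \<in> borel_measurable (borel \<Otimes>\<^sub>M borel)"
      by (rule measurable_compose[OF _ Qm]) measurable
    then have [measurable]: "(\<lambda>p::('a \<times> real) \<times> ('a \<times> real). indicat_real Q (fst p - e *\<^sub>R snd p)) \<in> borel_measurable (borel \<Otimes>\<^sub>M lborel)"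
      by simp
    have "(\<lambda>x. \<integral>z. indicat_real Q (x - e *\<^sub>R z) * k z \<partial>lborel) \<in> borel_measurable borel"
      by (rule lborel.borel_measurable_lebesgue_integral) (simp add: split_beta')
    then show ?thesis by (simp add: j_def)
  qed
  have jb: "\<bar>j e x\<bar> \<le> exp (B\<^sup>2 / 4) * (\<integral>z. q z \<partial>lborel) * p x" if e: "0 < e" "e \<le> 1" for e x
  proof -
    have "norm (j e x) \<le> (\<integral>z. exp (B\<^sup>2 / 4) * (p x * q z) \<partial>lborel)"
      unfolding j_def
    proof (rule norm_integral_le)
      show "integrable lborel (\<lambda>z. exp (B\<^sup>2 / 4) * (p x * q z))" by (intro integrable_mult_right qi)
      show "norm (indicator Q (x - e *\<^sub>R z) * k z) \<le> exp (B\<^sup>2 / 4) * (p x * q z)" for z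
        using dom[OF _ e, of x z] k0[of z] q0[of z] by (auto split: split_indicator simp: p_def)
    qed
    then show ?thesis by (simp add: mult_ac)
  qed
  \<comment> \<open>By Fubini, up to the factor \<open>n\<close> this integrates the pairing of
    \<open>u\<close> with the packet at x0 over x0 in the box. The condition e < - snd b keeps all
    these packets below t = 0.\<close>
  have uj: "(\<integral>x. u x * complex_of_real (j e x) \<partial>lborel) = 0" if e: "0 < e" "e \<le> 1" "e < - snd b" for e
  proof -
    define n where "n = e ^ DIM('a \<times> real)"
    have n: "n > 0" using e by (simp add: n_def)
    define S where "S = (\<lambda>x x0. u x * complex_of_real (indicator Q x0 * k ((x - x0) /\<^sub>R e)))"
    have kk: "k ((x - x0) /\<^sub>R e) = gss (1 / e\<^sup>2) (fst x - fst x0) * bump ((snd x - snd x0) / e)" for x x0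
      using e by (simp add: k_def gss_def power_mult_distrib divide_simps)
    have "n * j e x = (\<integral>x0. indicator Q x0 * k ((x - x0) /\<^sub>R e) \<partial>lborel)" for x
      using lborel_integral_dilate[OF e(1), of "\<lambda>x0. indicator Q x0 * k ((x - x0) /\<^sub>R e)" x] e
      by (simp add: j_def n_def)
    then have "(\<integral>x. complex_of_real n * (u x * complex_of_real (j e x)) \<partial>lborel) = (\<integral>x. \<integral>x0. S x x0 \<partial>lborel \<partial>lborel)"
      unfolding S_def by (simp only: integral_mult_right_zero integral_complex_of_real mult.left_commute[of "complex_of_real n"] of_real_mult[symmetric])
    also have "\<dots> = (\<integral>x0. \<integral>x. S x x0 \<partial>lborel \<partial>lborel)"
    proof (rule integral_swap_dominated(2))
      show "integrable lborel (\<lambda>x. exp (B\<^sup>2 / 4) * (norm (u x) * p x))"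
        unfolding p_def using B by (intro integrable_mult_right ui) (simp add: T_def)
      show "integrable lborel (\<lambda>x0. indicat_real Q x0)"
        unfolding Q_def by (rule integrable_real_indicator) (auto simp: emeasure_lborel_box_eq)
      show "norm (S x x0) \<le> exp (B\<^sup>2 / 4) * (norm (u x) * p x) * indicat_real Q x0" for x x0
      proof (cases "x0 \<in> Q")
        case True
        let ?z = "(x - x0) /\<^sub>R e"
        have "x - e *\<^sub>R ?z \<in> Q" using True e by simp
        then have "k ?z \<le> exp (B\<^sup>2 / 4) * (p x * q ?z)" by (rule dom) (use e in auto)
        also have "\<dots> \<le> exp (B\<^sup>2 / 4) * (p x * 1)"
          using bump_le_1 bump_nonneg by (intro mult_left_mono) (auto simp: q_def p_def gss_le_1 intro!: mult_le_one)
        finally have "norm (u x) * k ?z \<le> norm (u x) * (exp (B\<^sup>2 / 4) * (p x * 1))" by (rule mult_left_mono) simp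
        then show ?thesis using True k0[of ?z] by (simp add: S_def norm_mult mult_ac)
      qed (simp add: S_def)
      have [measurable]: "(\<lambda>q::('a \<times> real) \<times> ('a \<times> real). k ((fst q - snd q) /\<^sub>R e)) \<in> borel_measurable (borel \<Otimes>\<^sub>M borel)"
        by (rule measurable_compose[of _ _ borel]) measurable
      show "(\<lambda>p. S (fst p) (snd p)) \<in> borel_measurable (lborel \<Otimes>\<^sub>M lborel)"
        unfolding S_def by measurable
    qed
    also have "\<dots> = (\<integral>x0. 0 \<partial>(lborel :: ('a \<times> real) measure))"
    proof (rule Bochner_Integration.integral_cong[OF refl])
      fix x0 :: "'a \<times> real"
      show "(\<integral>x. S x x0 \<partial>lborel) = 0"
      proof (cases "x0 \<in> Q")
        case True
        have "(0, 1) \<in> (Basis :: ('a \<times> real) set)" by (simp add: Basis_prod_def)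
        then have "x0 \<bullet> (0, 1) < b \<bullet> (0, 1)" using True unfolding Q_def mem_box by blast
        then have "snd x0 < snd b" by (simp add: inner_prod_def)
        then have "snd x0 + e \<le> 0" using e by linarith
        from ann[OF e(1) this] show ?thesis using True by (simp add: S_def kk)
      qed (simp add: S_def)
    qed
    finally show ?thesis using n by (simp only: integral_mult_right_zero mult_eq_0_iff) simp
  qed
  define \<kappa> where "\<kappa> = (\<integral>z. k z \<partial>lborel)"
  have \<kappa>: "\<kappa> \<noteq> 0"
  proof
    assume "\<kappa> = 0"
    then have kz: "AE z in lborel. k z = 0"
      unfolding \<kappa>_def using integral_nonneg_eq_0_iff_AE[OF ki] k0 by simp
    have nz: "k z \<noteq> 0" if "z \<in> box (- One) One" for z
    proof -
      have b: "(0, 1) \<in> (Basis :: ('a \<times> real) set)" by (simp add: Basis_prod_def)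
      then have "(- One) \<bullet> ((0, 1) :: 'a \<times> real) < z \<bullet> (0, 1) \<and> z \<bullet> (0, 1) < One \<bullet> ((0, 1) :: 'a \<times> real)"
        using that unfolding mem_box by blast
      then have "- 1 < z \<bullet> (0, 1) \<and> z \<bullet> (0, 1) < 1"
        unfolding inner_minus_left inner_sum_Basis[OF b] .
      then have "\<bar>snd z\<bar> < 1" by (simp add: inner_prod_def abs_less_iff)
      then show ?thesis using bump_pos[of "snd z"] gss_pos[of 1 "fst z"] by (simp add: k_def)
    qed
    have "AE z in lborel. z \<notin> box (- One) (One :: 'a \<times> real)"
      using kz by eventually_elim (use nz in blast)
    then have "box (- One) (One :: 'a \<times> real) \<in> null_sets lborel" by (subst AE_iff_null_sets) auto
    then have "negligible (box (- One) (One :: 'a \<times> real))"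
      by (simp add: negligible_iff_null_sets null_sets_completionI)
    moreover have "0 \<in> box (- One) (One :: 'a \<times> real)" by (simp add: mem_box)
    ultimately show False using open_not_negligible[OF open_box] by blast
  qed
  define N where "N = max 1 (1 / - snd b)"
  \<comment> \<open>The shift by \<open>N\<close> makes every term, and not only the late ones, at
    most 1 and smaller than - snd b.\<close>
  define \<epsilon> where "\<epsilon> = (\<lambda>i::nat. 1 / (real i + N + 1))"
  have N: "N \<ge> 1" "1 / - snd b \<le> N" by (simp_all add: N_def)
  have \<epsilon>: "0 < \<epsilon> i" "\<epsilon> i \<le> 1" "\<epsilon> i < - snd b" for i
  proof -
    show "0 < \<epsilon> i" "\<epsilon> i \<le> 1" using N by (simp_all add: \<epsilon>_def)
    have "1 / - snd b < real i + N + 1" using N by linarith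
    then show "\<epsilon> i < - snd b" using b N by (simp add: \<epsilon>_def field_simps)
  qed
  have \<epsilon>lim: "\<epsilon> \<longlonglongrightarrow> 0" unfolding \<epsilon>_def by real_asymp
  \<comment> \<open>Off the frontier, x and x - \<epsilon> z are eventually on the same side of the
    box; the frontier itself is a null set.\<close>
  have jlim: "(\<lambda>i. j (\<epsilon> i) x) \<longlonglongrightarrow> indicator Q x * \<kappa>" if x: "x \<notin> cbox a b - box a b" for x
  proof -
    have "(\<lambda>i. j (\<epsilon> i) x) \<longlonglongrightarrow> (\<integral>z. indicator Q x * k z \<partial>lborel)"
      unfolding j_def
    proof (rule integral_dominated_convergence[OF _ _ ki])
      show "(\<lambda>z. indicator Q (x - \<epsilon> i *\<^sub>R z) * k z) \<in> borel_measurable lborel" for i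
      proof -
        have "(\<lambda>z. indicat_real Q (x - \<epsilon> i *\<^sub>R z)) \<in> borel_measurable borel"
          by (rule measurable_compose[OF _ Qm]) measurable
        then show ?thesis by simp
      qed
      show "AE z in lborel. norm (indicator Q (x - \<epsilon> i *\<^sub>R z) * k z) \<le> k z" for i
        using k0 by (intro AE_I2) (auto split: split_indicator)
      show "AE z in lborel. (\<lambda>i. indicator Q (x - \<epsilon> i *\<^sub>R z) * k z) \<longlonglongrightarrow> indicator Q x * k z"
      proof (rule AE_I2)
        fix z
        have "(\<lambda>i. x - \<epsilon> i *\<^sub>R z) \<longlonglongrightarrow> x - 0 *\<^sub>R z" by (intro tendsto_intros \<epsilon>lim)
        then have l: "(\<lambda>i. x - \<epsilon> i *\<^sub>R z) \<longlonglongrightarrow> x" by simp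
        have "\<forall>\<^sub>F i in sequentially. indicat_real Q (x - \<epsilon> i *\<^sub>R z) = indicator Q x"
        proof (cases "x \<in> Q")
          case True
          have "\<forall>\<^sub>F i in sequentially. x - \<epsilon> i *\<^sub>R z \<in> Q"
            by (rule topological_tendstoD[OF l]) (use True in \<open>auto simp: Q_def\<close>)
          then show ?thesis using True by (auto elim!: eventually_mono)
        next
          case False
          then have "x \<in> - cbox a b" using x by (auto simp: Q_def)
          then have "\<forall>\<^sub>F i in sequentially. x - \<epsilon> i *\<^sub>R z \<in> - cbox a b"
            by (intro topological_tendstoD[OF l]) auto
          then show ?thesis
            by (rule eventually_mono) (use False box_subset_cbox[of a b] in \<open>auto simp: Q_def indicator_def\<close>)
        qed
        then show "(\<lambda>i. indicator Q (x - \<epsilon> i *\<^sub>R z) * k z) \<longlonglongrightarrow> indicator Q x * k z"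
          by (intro tendsto_mult tendsto_const) (rule tendsto_eventually)
      qed
    qed measurable
    then show ?thesis by (simp add: \<kappa>_def)
  qed
  have "(\<lambda>i. \<integral>x. u x * complex_of_real (j (\<epsilon> i) x) \<partial>lborel) \<longlonglongrightarrow> (\<integral>x. u x * complex_of_real (indicator Q x * \<kappa>) \<partial>lborel)"
  proof (rule integral_dominated_convergence[where w = "\<lambda>x. exp (B\<^sup>2 / 4) * (\<integral>z. q z \<partial>lborel) * (norm (u x) * p x)"])
    show "integrable lborel (\<lambda>x. exp (B\<^sup>2 / 4) * (\<integral>z. q z \<partial>lborel) * (norm (u x) * p x))"
      unfolding p_def using B by (intro integrable_mult_right ui) (simp add: T_def)
    show "AE x in lborel. norm (u x * complex_of_real (j (\<epsilon> i) x)) \<le> exp (B\<^sup>2 / 4) * (\<integral>z. q z \<partial>lborel) * (norm (u x) * p x)" for i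
      using mult_left_mono[OF jb[OF \<epsilon>(1,2)], of "norm (u _)"] by (intro AE_I2) (simp add: norm_mult mult_ac)
    have "AE x in lborel. x \<notin> cbox a b - box a b"
      by (rule AE_not_in) (rule box_frontier_null)
    then show "AE x in lborel. (\<lambda>i. u x * complex_of_real (j (\<epsilon> i) x)) \<longlonglongrightarrow> u x * complex_of_real (indicator Q x * \<kappa>)"
      by eventually_elim (intro tendsto_mult tendsto_const tendsto_of_real jlim)
  qed measurable
  then have "(\<lambda>i. 0 :: complex) \<longlonglongrightarrow> (\<integral>x. u x * complex_of_real (indicator Q x * \<kappa>) \<partial>lborel)"
    using uj[OF \<epsilon>] by simp
  then have "(\<integral>x. u x * complex_of_real (indicator Q x * \<kappa>) \<partial>lborel) = 0"
    using LIMSEQ_unique tendsto_const by metis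
  moreover have "u x * complex_of_real (indicator Q x * \<kappa>) = complex_of_real \<kappa> * (indicator (box a b) x * u x)" for x
    by (auto simp: Q_def split: split_indicator)
  ultimately show ?thesis using \<kappa> by (simp only: integral_mult_right_zero mult_eq_0_iff) simp
qed

text \<open>Fix one box and integrate \<open>u\<close> over its intersections with Borel sets. Boxes
  are stable under intersection and generate the Borel sets, so by the \<pi>-\<lambda> theorem all
  these integrals vanish, and then \<open>u\<close> is zero almost everywhere in the fixed
  box.\<close>

lemma AE_zero_half_space:
  fixes u :: "'a::euclidean_space \<times> real \<Rightarrow> complex"
  assumes u[measurable]: "u \<in> borel_measurable borel"
    and ui: "\<And>a b. integrable lborel (\<lambda>x. indicator (box a b) x * u x)"
    and z: "\<And>a b. snd b < 0 \<Longrightarrow> (\<integral>x. indicator (box a b) x * u x \<partial>lborel) = 0"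
  shows "AE x in lborel. snd x < 0 \<longrightarrow> u x = 0"
proof -
  have b01: "(0, 1) \<in> (Basis :: ('a \<times> real) set)" by (simp add: Basis_prod_def)
  have one: "AE x in lborel. x \<in> box a0 b0 \<longrightarrow> u x = 0" if b0: "snd b0 < 0" for a0 b0 :: "'a \<times> real"
  proof -
    let ?f = "\<lambda>x. indicator (box a0 b0) x * u x"
    have "set_lebesgue_integral lborel A ?f = 0" if A: "A \<in> sets lborel" for A
    proof -
      have gen: "sets (lborel :: ('a \<times> real) measure) = sigma_sets UNIV (range (\<lambda>(a, b). box a b))"
        by (simp add: borel_eq_box sets_measure_of_conv)
      have int: "set_integrable lborel A ?f" if "A \<in> sets lborel" for A
        unfolding set_integrable_def using that ui by (intro integrable_mult_indicator) auto
      have "Int_stable (range (\<lambda>(a, b). box a b :: ('a \<times> real) set))"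
        by (auto simp: Int_stable_def box_Int_box)
      moreover have "range (\<lambda>(a, b). box a b) \<subseteq> Pow (UNIV :: ('a \<times> real) set)" by simp
      moreover have "A \<in> sigma_sets UNIV (range (\<lambda>(a, b). box a b))" using A gen by simp
      ultimately show ?thesis
      proof (induction rule: sigma_sets_induct_disjoint)
        case (basic A)
        then obtain a b where A: "A = box a b" by auto
        define b' where "b' = (\<Sum>i\<in>Basis. min (b \<bullet> i) (b0 \<bullet> i) *\<^sub>R i)"
        define a' where "a' = (\<Sum>i\<in>Basis. max (a \<bullet> i) (a0 \<bullet> i) *\<^sub>R i)"
        have "b' \<bullet> (0, 1) = min (b \<bullet> (0, 1)) (b0 \<bullet> (0, 1))" unfolding b'_def using b01 by (rule inner_sum_left_Basis)
        then have "snd b' < 0" using b0 by (simp add: inner_prod_def)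
        moreover have "box a b \<inter> box a0 b0 = box a' b'" unfolding a'_def b'_def by (rule box_Int_box)
        then have "indicator (box a b) x *\<^sub>R (indicator (box a0 b0) x * u x) = indicator (box a' b') x * u x" for x
          by (auto split: split_indicator)
        ultimately show ?case using z unfolding A set_lebesgue_integral_def by simp
      next
        case empty then show ?case by (simp add: set_lebesgue_integral_def)
      next
        case (compl A)
        then have A: "A \<in> sets lborel" using gen by simp
        have "(\<lambda>x. indicator (UNIV - A) x *\<^sub>R ?f x) = (\<lambda>x. ?f x - indicator A x *\<^sub>R ?f x)"
          by (auto split: split_indicator)
        then show ?case using compl.IH int[OF A] ui[of a0 b0] z[OF b0, of a0]
          unfolding set_lebesgue_integral_def set_integrable_def by simp
      next
        case (union A)
        then have A: "A i \<in> sets lborel" for i using gen by auto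
        have "set_lebesgue_integral lborel (\<Union>i. A i) ?f = (\<Sum>i. set_lebesgue_integral lborel (A i) ?f)"
          by (rule lebesgue_integral_countable_add)
            (use A union(1) int in \<open>auto simp: disjoint_family_on_def\<close>)
        then show ?case using union by simp
      qed
    qed
    then have "AE x in lborel. ?f x = 0"
      using sigma_finite_measure.density_zero[OF lborel.sigma_finite_measure_axioms ui[of a0 b0]] by blast
    then show ?thesis by eventually_elim (auto split: split_indicator_asm)
  qed
  \<comment> \<open>Countably many boxes exhaust the open half-space, each keeping a positive
    distance from t = 0.\<close>
  define lo hi :: "nat \<Rightarrow> 'a \<times> real" where "lo = (\<lambda>n. (- real n *\<^sub>R One, - real n))" and "hi = (\<lambda>n. (real n *\<^sub>R One, - (1 / (real n + 1))))"
  have "AE x in lborel. \<forall>n. x \<in> box (lo n) (hi n) \<longrightarrow> u x = 0"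
    unfolding AE_all_countable by (intro allI one) (simp add: hi_def)
  then show ?thesis
  proof eventually_elim
    case (elim x)
    show ?case
    proof
      assume x: "snd x < 0"
      obtain n :: nat where n: "real n > norm x + 1 / - snd x" using reals_Archimedean2 by blast
      have p: "0 < 1 / - snd x" using x by simp
      have nn: "norm x < real n" "1 / - snd x < real n + 1" using n p norm_ge_zero[of x] by linarith+
      have "x \<in> box (lo n) (hi n)"
      proof -
        have O: "lo n = (- real n *\<^sub>R One, - real n)"
          by (simp add: lo_def)
        have "fst x \<bullet> i < real n \<and> - real n < fst x \<bullet> i" if "i \<in> Basis" for i
          using Basis_le_norm[OF that, of "fst x"] norm_fst_le[of "fst x" "snd x"] nn(1) by (auto simp: abs_le_iff)
        moreover have "- real n < snd x" using norm_snd_le[of "snd x" "fst x"] nn(1) by auto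
        moreover have "snd x < - (1 / (real n + 1))"
          using nn(2) x by (simp add: field_simps)
        ultimately show ?thesis unfolding O hi_def by (auto simp: mem_box Basis_prod_def inner_prod_def)
      qed
      then show "u x = 0" using elim by blast
    qed
  qed
qed

section \<open>Conclusion\<close>

lemma (in helmholtz) zero_half_space: "AE x in lborel. snd x < 0 \<longrightarrow> u x = 0"
proof (rule AE_zero_half_space[OF u_meas])
  fix a b :: "'a \<times> real"
  obtain B where B: "\<And>x. x \<in> box a b \<Longrightarrow> norm x \<le> B"
    using bounded_box[of a b] unfolding bounded_iff by blast
  have "integrable lborel (\<lambda>x. u x * complex_of_real (indicator (box a b) x))"
  proof (rule Bstar0_integrable_compact[OF u, where C = 1 and N = B])
    show "indicat_real (box a b) x = 0" if "norm x > B" for x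
      using B[of x] that by (auto split: split_indicator)
  qed (auto intro: borel_measurable_indicator split: split_indicator)
  moreover have "u x * complex_of_real (indicator (box a b) x) = indicator (box a b) x * u x" for x
    by (simp split: split_indicator)
  ultimately show "integrable lborel (\<lambda>x. indicator (box a b) x * u x)" by simp
next
  fix a b :: "'a \<times> real" assume b: "snd b < 0"
  show "(\<integral>x. indicator (box a b) x * u x \<partial>lborel) = 0"
  proof (rule box_integral_zero[OF u_meas _ _ b])
    show "integrable lborel (\<lambda>x. norm (u x) * (gss (1 / 4) (fst x) * indicator {-T..T} (snd x)))" if "T \<ge> 0" for T
      using strip_gauss(1)[OF u _ that, of 4 0] by simp
    \<comment> \<open>The choice s = e^2 and d = e gives the packet the same scale in all
      directions, as a mollifier requires.\<close>
    show "(\<integral>x. u x * complex_of_real (gss (1 / e\<^sup>2) (fst x - fst x0) * bump ((snd x - snd x0) / e)) \<partial>lborel) = 0"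
      if "0 < e" "snd x0 + e \<le> 0" for e and x0 :: "'a \<times> real"
      by (rule annihilate_bump) (use that in auto)
  qed
qed

lemma norm_ee: "norm (ee (cdot x 0 \<eta>)) = exp (- (2 * pi * (x \<bullet> \<eta>)))"
  by (simp add: ee_def cdot_def)

theorem theorem5:
  fixes u f :: "((real^('m::finite)) \<times> real) \<Rightarrow> complex"
    and D1 :: "((real^('m::finite)) \<times> real) \<Rightarrow> ((real^('m::finite)) \<times> real) \<Rightarrow> complex"
    and D2 :: "((real^('m::finite)) \<times> real) \<Rightarrow> ((real^('m::finite)) \<times> real) \<Rightarrow> ((real^('m::finite)) \<times> real) \<Rightarrow> complex"
    and lam \<gamma>\<^sub>0 :: real
  assumes lam: "lam > 0"
    and u: "Bstar0_2 u D1 D2"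
    and eq: "AE x in lborel. - (\<Sum>b\<in>Basis. D2 b b x) - complex_of_real lam * u x = f x"
    and f_vanish: "\<And>y t. t < 0 \<Longrightarrow> f (y, t) = 0"
    and gam: "\<gamma>\<^sub>0 > 0"
    and f_bound: "(SUP p \<in> {(xi, eta). norm eta < \<gamma>\<^sub>0}.
        \<integral>\<^sup>+ x. ennreal (norm (complex_of_real ((jbr x)\<^sup>2) * f x * ee (cdot x (fst p) (snd p))))
        \<partial>lborel) < \<infinity>"
  shows "AE x in lborel. snd x < 0 \<longrightarrow> u x = 0"
proof -
  \<comment> \<open>\<open>f\<close> itself need not be Borel measurable.\<close>
  define F where "F = (\<lambda>x. if snd x < 0 then 0 else - (\<Sum>b\<in>Basis. D2 b b x) - complex_of_real lam * u x)"
  have uB: "u \<in> Bstar0" and D2B: "\<And>b. b \<in> Basis \<Longrightarrow> D2 b b \<in> Bstar0"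
    and wk: "\<And>b. b \<in> Basis \<Longrightarrow> weak_deriv [b, b] u (D2 b b)"
    using u by (auto simp: Bstar0_2_def)
  have [measurable]: "u \<in> borel_measurable borel" by (rule Bstar0_measurable[OF uB])
  have [measurable]: "D2 b b \<in> borel_measurable borel" if "b \<in> Basis" for b
    by (rule Bstar0_measurable[OF D2B[OF that]])
  have [measurable]: "snd \<in> (borel :: ((real^'m) \<times> real) measure) \<rightarrow>\<^sub>M borel"
    by (intro borel_measurable_continuous_onI continuous_intros)
  have Fm[measurable]: "F \<in> borel_measurable borel" unfolding F_def by measurable
  have f0: "f x = 0" if "snd x < 0" for x using f_vanish[of "snd x" "fst x"] that by simp
  have Ff: "AE x in lborel. F x = f x"
    using eq by eventually_elim (auto simp: F_def f0)
  have eqF: "AE x in lborel. - (\<Sum>b\<in>Basis. D2 b b x) - complex_of_real lam * u x = F x"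
    using eq Ff by eventually_elim simp
  have "helmholtz u F D2 lam (2 * pi * \<gamma>\<^sub>0)"
  proof
    show "integrable lborel (\<lambda>x. (1 + (norm x)\<^sup>2) * norm (F x) * exp (x \<bullet> \<eta>))" if \<eta>: "norm \<eta> < 2 * pi * \<gamma>\<^sub>0" for \<eta>
    proof (rule integrableI_bounded)
      \<comment> \<open>The modulus of e(x \<bullet> \<zeta>) is exp(-2 pi x \<bullet> Im \<zeta>),
        which explains the sign and the factor; Re \<zeta> is taken to be 0.\<close>
      define e where "e = - (inverse (2 * pi) *\<^sub>R \<eta>)"
      have e: "norm e < \<gamma>\<^sub>0" using \<eta> by (simp add: e_def field_simps)
      have "norm (complex_of_real ((jbr x)\<^sup>2) * f x * ee (cdot x 0 e)) = (1 + (norm x)\<^sup>2) * norm (f x) * exp (x \<bullet> \<eta>)" for x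
      proof -
        have "norm (complex_of_real ((jbr x)\<^sup>2)) = 1 + (norm x)\<^sup>2"
          unfolding norm_of_real by (simp add: jbr_def)
        moreover have "- (2 * pi * (x \<bullet> e)) = x \<bullet> \<eta>" by (simp add: e_def field_simps)
        ultimately show ?thesis by (simp only: norm_mult norm_ee)
      qed
      then have "(\<integral>\<^sup>+x. ennreal (norm ((1 + (norm x)\<^sup>2) * norm (F x) * exp (x \<bullet> \<eta>))) \<partial>lborel)
        = (\<integral>\<^sup>+x. ennreal (norm (complex_of_real ((jbr x)\<^sup>2) * f x * ee (cdot x 0 e))) \<partial>lborel)"
        using Ff by (intro nn_integral_cong_AE) (auto elim!: eventually_mono simp: abs_mult)
      also have "\<dots> \<le> (SUP p \<in> {(xi, eta). norm eta < \<gamma>\<^sub>0}.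
        \<integral>\<^sup>+ x. ennreal (norm (complex_of_real ((jbr x)\<^sup>2) * f x * ee (cdot x (fst p) (snd p)))) \<partial>lborel)"
        by (rule SUP_upper2[of "(0, e)"]) (use e in auto)
      finally show "(\<integral>\<^sup>+x. ennreal (norm ((1 + (norm x)\<^sup>2) * norm (F x) * exp (x \<bullet> \<eta>))) \<partial>lborel) < \<infinity>"
        using f_bound by (rule le_less_trans)
    qed measurable
    show "F (y, t) = 0" if "t < 0" for y t using that by (simp add: F_def)
  qed (use lam uB D2B wk eqF gam in auto)
  then show ?thesis by (rule helmholtz.zero_half_space)
qed

end
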